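(* Let $\mathbb F$ be a finitely generated noncyclic free group, $\Phi\colon\mathbb F\to\mathbb F$ an automorphism, and $\mathbb G=\mathbb F\rtimes_\Phi\mathbb Z$. Every free-by-cyclic subgroup of $\mathbb G$ is undistorted in $\mathbb G$.
   Context: A group is free-by-cyclic if it has a nontrivial finitely generated free normal subgroup whose quotient group is infinite cyclic. $\mathbb F\rtimes_\Phi\mathbb Z=\langle\mathbb F,t\mid txt^{-1}=\Phi(x)\text{ for all }x\in\mathbb F\rangle$. A function $f\colon\Gamma\to\Gamma'$ between connected locally finite graphs with combinatorial metrics $d,d'$ is a quasi-isometric embedding if there is $K\ge1$ with $\frac1K d(p_1,p_2)-K\le d'(f(p_1),f(p_2))\le K d(p_1,p_2)+K$ for all $p_1,p_2\in\Gamma$. A finitely generated subgroup $\mathbb H'$ of a finitely generated group $\mathbb H$ is undistorted if the inclusion extends to a quasi-isometric embedding of Cayley graphs $\mathrm{Cay}(\mathbb H')\to\mathrm{Cay}(\mathbb H)$ (with respect to any finite generating sets). *)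

theory Defs
  imports "HOL-Algebra.Algebra" "Graph_Theory.Digraph"
begin

section \<open>Free groups and finite generation\<close>

definition generates :: "('a, 'b) monoid_scheme \<Rightarrow> 'a set \<Rightarrow> bool" where
  "generates G A \<longleftrightarrow> A \<subseteq> carrier G \<and> generate G A = carrier G"

definition finitely_generated :: "('a, 'b) monoid_scheme \<Rightarrow> bool" where
  "finitely_generated G \<longleftrightarrow> (\<exists>A. finite A \<and> generates G A)"

text \<open>The letter \<open>(s, True)\<close> stands for the generator \<open>s\<close> and \<open>(s, False)\<close> for its formal inverse.\<close>

definition reduced_words :: "'a set \<Rightarrow> ('a \<times> bool) list set" where
  "reduced_words S =
     {w. fst ` set w \<subseteq> S \<and> successively (\<lambda>(s, b) (t, c). \<not> (s = t \<and> b \<noteq> c)) w}"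

definition word_value :: "('a, 'b) monoid_scheme \<Rightarrow> ('a \<times> bool) list \<Rightarrow> 'a" where
  "word_value G w = foldr (\<lambda>(s, b) x. (if b then s else inv\<^bsub>G\<^esub> s) \<otimes>\<^bsub>G\<^esub> x) w \<one>\<^bsub>G\<^esub>"

definition free_basis :: "('a, 'b) monoid_scheme \<Rightarrow> 'a set \<Rightarrow> bool" where
  "free_basis G S \<longleftrightarrow>
     S \<subseteq> carrier G \<and> bij_betw (word_value G) (reduced_words S) (carrier G)"

definition free_group :: "('a, 'b) monoid_scheme \<Rightarrow> bool" where
  "free_group G \<longleftrightarrow> group G \<and> (\<exists>S. free_basis G S)"

section \<open>Free-by-cyclic groups\<close>

definition free_by_cyclic :: "('a, 'b) monoid_scheme \<Rightarrow> bool" where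
  "free_by_cyclic G \<longleftrightarrow> group G \<and>
     (\<exists>N. N \<lhd> G \<and> N \<noteq> {\<one>\<^bsub>G\<^esub>} \<and>
          free_group (G\<lparr>carrier := N\<rparr>) \<and> finitely_generated (G\<lparr>carrier := N\<rparr>) \<and>
          cyclic_group (G Mod N) \<and> infinite (carrier (G Mod N)))"

text \<open>The pair \<open>(x, m)\<close> is the element \<open>x t\<^sup>m\<close>; the multiplication is forced by
  \<open>t x t\<^sup>-\<^sup>1 = \<Phi> x\<close>. Powers of \<open>\<Phi>\<close> are taken in the automorphism group.\<close>

definition semidirect_Z :: "('a, 'b) monoid_scheme \<Rightarrow> ('a \<Rightarrow> 'a) \<Rightarrow> ('a \<times> int) monoid" where
  "semidirect_Z F \<Phi> =
     \<lparr>carrier = carrier F \<times> UNIV,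
      monoid.mult = (\<lambda>(x, m) (y, n). (x \<otimes>\<^bsub>F\<^esub> (\<Phi> [^]\<^bsub>AutoGroup F\<^esub> m) y, m + n)),
      one = (\<one>\<^bsub>F\<^esub>, 0)\<rparr>"

section \<open>Graphs as metric spaces\<close>

text \<open>A \<open>pre_digraph\<close> represents the graph obtained by forgetting the orientations of
  its arcs (parallel arcs and loops allowed). The graph is the space consisting of its vertices and
  the interior points of its arcs: \<open>Inner e r\<close> is the point of \<open>e\<close> at distance \<open>r\<close> from
  the tail of \<open>e\<close>, where every arc is an interval of length 1.\<close>

datatype ('v, 'e) graph_point = Vertex 'v | Inner 'e real

definition graph_points :: "('v, 'e) pre_digraph \<Rightarrow> ('v, 'e) graph_point set" where
  "graph_points \<Gamma> = Vertex ` verts \<Gamma> \<union> {Inner e r |e r. e \<in> arcs \<Gamma> \<and> 0 < r \<and> r < 1}"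

text \<open>Least number of edges in an edge path; meaningful for connected graphs only.\<close>

definition vertex_dist :: "('v, 'e) pre_digraph \<Rightarrow> 'v \<Rightarrow> 'v \<Rightarrow> nat" where
  "vertex_dist \<Gamma> u v = (LEAST n. (u, v) \<in> symcl (arcs_ends \<Gamma>) ^^ n)"

fun nearby_vertices :: "('v, 'e) pre_digraph \<Rightarrow> ('v, 'e) graph_point \<Rightarrow> ('v \<times> real) set" where
  "nearby_vertices \<Gamma> (Vertex v) = {(v, 0)}"
| "nearby_vertices \<Gamma> (Inner e r) = {(tail \<Gamma> e, r), (head \<Gamma> e, 1 - r)}"

definition dist_via_vertices ::
    "('v, 'e) pre_digraph \<Rightarrow> ('v, 'e) graph_point \<Rightarrow> ('v, 'e) graph_point \<Rightarrow> real" where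
  "dist_via_vertices \<Gamma> p q =
     Min {a + real (vertex_dist \<Gamma> u v) + b |u a v b.
            (u, a) \<in> nearby_vertices \<Gamma> p \<and> (v, b) \<in> nearby_vertices \<Gamma> q}"

text \<open>The combinatorial (path) metric: a shortest path either passes through a vertex or stays
  in the interior of one arc.\<close>

fun graph_dist ::
    "('v, 'e) pre_digraph \<Rightarrow> ('v, 'e) graph_point \<Rightarrow> ('v, 'e) graph_point \<Rightarrow> real" where
  "graph_dist \<Gamma> (Inner e r) (Inner e' s) =
     (if e = e' then min \<bar>r - s\<bar> (dist_via_vertices \<Gamma> (Inner e r) (Inner e' s))
      else dist_via_vertices \<Gamma> (Inner e r) (Inner e' s))"
| "graph_dist \<Gamma> p q = dist_via_vertices \<Gamma> p q"

definition quasi_isometric_embedding ::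
    "('v, 'e) pre_digraph \<Rightarrow> ('w, 'f) pre_digraph \<Rightarrow>
     (('v, 'e) graph_point \<Rightarrow> ('w, 'f) graph_point) \<Rightarrow> bool" where
  "quasi_isometric_embedding \<Gamma> \<Gamma>' f \<longleftrightarrow>
     f \<in> graph_points \<Gamma> \<rightarrow> graph_points \<Gamma>' \<and>
     (\<exists>K \<ge> 1. \<forall>p \<in> graph_points \<Gamma>. \<forall>q \<in> graph_points \<Gamma>.
        1 / K * graph_dist \<Gamma> p q - K \<le> graph_dist \<Gamma>' (f p) (f q) \<and>
        graph_dist \<Gamma>' (f p) (f q) \<le> K * graph_dist \<Gamma> p q + K)"

section \<open>Undistorted subgroups\<close>

definition cayley_graph :: "('a, 'b) monoid_scheme \<Rightarrow> 'a set \<Rightarrow> ('a, 'a \<times> 'a) pre_digraph" where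
  "cayley_graph G A =
     \<lparr>verts = carrier G, arcs = carrier G \<times> A, tail = fst, head = (\<lambda>(g, s). g \<otimes>\<^bsub>G\<^esub> s)\<rparr>"

text \<open>An extension of the inclusion is prescribed on the vertices only.\<close>

definition undistorted :: "'a set \<Rightarrow> ('a, 'b) monoid_scheme \<Rightarrow> bool" where
  "undistorted H G \<longleftrightarrow>
     group G \<and> finitely_generated G \<and>
     subgroup H G \<and> finitely_generated (G\<lparr>carrier := H\<rparr>) \<and>
     (\<forall>A B. finite A \<and> generates (G\<lparr>carrier := H\<rparr>) A \<and> finite B \<and> generates G B \<longrightarrow>
        (\<exists>f. quasi_isometric_embedding (cayley_graph (G\<lparr>carrier := H\<rparr>) A) (cayley_graph G B) f \<and>
             (\<forall>h \<in> H. f (Vertex h) = Vertex h)))"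

section \<open>Basic facts\<close>

lemma group_semidirect_Z:
  assumes "group F" and "\<Phi> \<in> auto F"
  shows "group (semidirect_Z F \<Phi>)"
proof -
  interpret F: group F by fact
  interpret A: group "AutoGroup F" by (rule F.AutoGroup)
  have car: "carrier (AutoGroup F) = auto F"
    by (simp add: AutoGroup_def)
  have pw: "\<Phi> [^]\<^bsub>AutoGroup F\<^esub> m \<in> auto F" for m :: int
    using assms(2) A.int_pow_closed car by auto
  have autD: "f x \<in> carrier F" "f (x \<otimes>\<^bsub>F\<^esub> y) = f x \<otimes>\<^bsub>F\<^esub> f y"
    if "f \<in> auto F" "x \<in> carrier F" "y \<in> carrier F" for f x y
    using that by (auto simp: auto_def hom_def)
  have add: "(\<Phi> [^]\<^bsub>AutoGroup F\<^esub> (m + n)) x = (\<Phi> [^]\<^bsub>AutoGroup F\<^esub> m) ((\<Phi> [^]\<^bsub>AutoGroup F\<^esub> n) x)"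
    if "x \<in> carrier F" for m n :: int and x
  proof -
    have "\<Phi> [^]\<^bsub>AutoGroup F\<^esub> (m + n) = \<Phi> [^]\<^bsub>AutoGroup F\<^esub> m \<otimes>\<^bsub>AutoGroup F\<^esub> \<Phi> [^]\<^bsub>AutoGroup F\<^esub> n"
      using assms(2) car by (simp add: A.int_pow_mult)
    also have "\<dots> = compose (carrier F) (\<Phi> [^]\<^bsub>AutoGroup F\<^esub> m) (\<Phi> [^]\<^bsub>AutoGroup F\<^esub> n)"
      using pw[of m] pw[of n] by (simp add: AutoGroup_def BijGroup_def auto_def)
    finally show ?thesis
      using that by (simp add: compose_def)
  qed
  have zero: "(\<Phi> [^]\<^bsub>AutoGroup F\<^esub> (0::int)) x = x" if "x \<in> carrier F" for x
    using that by (simp add: AutoGroup_def BijGroup_def)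
  show ?thesis
  proof (rule groupI, goal_cases)
    case (1 x y)
    then show ?case using autD pw by (auto simp: semidirect_Z_def)
  next
    case 2
    then show ?case by (simp add: semidirect_Z_def)
  next
    case (3 x y z)
    then show ?case using autD pw
      by (auto simp: semidirect_Z_def add F.m_assoc split: prod.splits)
  next
    case (4 x)
    then show ?case using zero by (auto simp: semidirect_Z_def simp del: int_pow_0)
  next
    case (5 p)
    obtain x m where p: "p = (x, m)" "x \<in> carrier F"
      using 5 by (auto simp: semidirect_Z_def)
    let ?y = "(\<Phi> [^]\<^bsub>AutoGroup F\<^esub> (- m)) (inv\<^bsub>F\<^esub> x)"
    have "?y \<otimes>\<^bsub>F\<^esub> (\<Phi> [^]\<^bsub>AutoGroup F\<^esub> (- m)) x = (\<Phi> [^]\<^bsub>AutoGroup F\<^esub> (- m)) (inv\<^bsub>F\<^esub> x \<otimes>\<^bsub>F\<^esub> x)"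
      using p autD(2)[OF pw, of "inv\<^bsub>F\<^esub> x" x] by simp
    also have "\<dots> = \<one>\<^bsub>F\<^esub>"
    proof -
      have "\<Phi> [^]\<^bsub>AutoGroup F\<^esub> (- m) \<in> hom F F"
        using pw[of "- m"] by (simp add: auto_def)
      then show ?thesis
        using p F.is_group by (simp add: hom_one)
    qed
    finally have "(?y, - m) \<otimes>\<^bsub>semidirect_Z F \<Phi>\<^esub> p = \<one>\<^bsub>semidirect_Z F \<Phi>\<^esub>"
      using p by (simp add: semidirect_Z_def)
    moreover have "(?y, - m) \<in> carrier (semidirect_Z F \<Phi>)"
      using p autD(1)[OF pw, of "inv\<^bsub>F\<^esub> x"] by (auto simp: semidirect_Z_def)
    ultimately show ?case by blast
  qed
qed

lemma semidirect_Z_conj: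
  assumes "group F" and "\<Phi> \<in> auto F" and "x \<in> carrier F"
  defines "G \<equiv> semidirect_Z F \<Phi>" and "t \<equiv> (\<one>\<^bsub>F\<^esub>, 1)"
  shows "t \<otimes>\<^bsub>G\<^esub> (x, 0) \<otimes>\<^bsub>G\<^esub> inv\<^bsub>G\<^esub> t = (\<Phi> x, 0)"
proof -
  interpret F: group F by fact
  interpret A: group "AutoGroup F" by (rule F.AutoGroup)
  interpret G: group G unfolding G_def using assms by (simp add: group_semidirect_Z)
  have one: "\<Phi> [^]\<^bsub>AutoGroup F\<^esub> (1::int) = \<Phi>"
    using assms(2) A.int_pow_1[of \<Phi>] by (simp add: AutoGroup_def)
  have zero: "(\<Phi> [^]\<^bsub>AutoGroup F\<^esub> (0::int)) y = y" if "y \<in> carrier F" for y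
    using that by (simp add: AutoGroup_def BijGroup_def)
  have ph: "\<Phi> x \<in> carrier F"
    using assms by (auto simp: auto_def hom_def)
  have t: "t \<in> carrier G" and x: "(x, 0) \<in> carrier G" and px: "(\<Phi> x, 0) \<in> carrier G"
    using assms ph by (auto simp: semidirect_Z_def)
  have "t \<otimes>\<^bsub>G\<^esub> (x, 0) = (\<Phi> x, 0) \<otimes>\<^bsub>G\<^esub> t"
    using ph one zero by (simp add: G_def t_def semidirect_Z_def)
  then show ?thesis
    using t px by (simp add: G.m_assoc)
qed

text \<open>Cayley graphs are connected, so \<open>vertex_dist\<close> is the intended distance on them.\<close>

lemma cayley_graph_connected:
  assumes "group G" "generates G A" "g \<in> carrier G" "h \<in> carrier G"
  shows "\<exists>n. (g, h) \<in> symcl (arcs_ends (cayley_graph G A)) ^^ n"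
proof -
  interpret group G by fact
  let ?R = "symcl (arcs_ends (cayley_graph G A))"
  have A: "A \<subseteq> carrier G" and gen: "generate G A = carrier G"
    using assms(2) by (auto simp: generates_def)
  have step: "(x, x \<otimes>\<^bsub>G\<^esub> s) \<in> ?R" "(x \<otimes>\<^bsub>G\<^esub> s, x) \<in> ?R" if "x \<in> carrier G" "s \<in> A" for x s
    using that by (force simp: symcl_def arcs_ends_conv cayley_graph_def)+
  have reach: "\<forall>x \<in> carrier G. (x, x \<otimes>\<^bsub>G\<^esub> k) \<in> ?R\<^sup>*" if "k \<in> generate G A" for k
    using that
  proof induction
    case one
    then show ?case by simp
  next
    case (incl s)
    then show ?case using step by blast
  next
    case (inv s)
    show ?case
    proof
      fix x assume x: "x \<in> carrier G"
      then have "(x \<otimes>\<^bsub>G\<^esub> inv\<^bsub>G\<^esub> s \<otimes>\<^bsub>G\<^esub> s, x \<otimes>\<^bsub>G\<^esub> inv\<^bsub>G\<^esub> s) \<in> ?R"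
        using step(2)[of "x \<otimes>\<^bsub>G\<^esub> inv\<^bsub>G\<^esub> s" s] inv A by auto
      moreover have "x \<otimes>\<^bsub>G\<^esub> inv\<^bsub>G\<^esub> s \<otimes>\<^bsub>G\<^esub> s = x"
        using x inv A by (simp add: m_assoc subset_iff)
      ultimately show "(x, x \<otimes>\<^bsub>G\<^esub> inv\<^bsub>G\<^esub> s) \<in> ?R\<^sup>*" by auto
    qed
  next
    case (eng k l)
    have kl: "k \<in> carrier G" "l \<in> carrier G" using eng gen by auto
    show ?case
    proof
      fix x assume x: "x \<in> carrier G"
      have "(x, x \<otimes>\<^bsub>G\<^esub> k) \<in> ?R\<^sup>*" "(x \<otimes>\<^bsub>G\<^esub> k, x \<otimes>\<^bsub>G\<^esub> k \<otimes>\<^bsub>G\<^esub> l) \<in> ?R\<^sup>*"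
        using eng x kl by auto
      then show "(x, x \<otimes>\<^bsub>G\<^esub> (k \<otimes>\<^bsub>G\<^esub> l)) \<in> ?R\<^sup>*"
        using x kl by (simp add: m_assoc)
    qed
  qed
  have "g \<otimes>\<^bsub>G\<^esub> (inv\<^bsub>G\<^esub> g \<otimes>\<^bsub>G\<^esub> h) = h"
    using assms by (simp add: m_assoc[symmetric])
  moreover have "inv\<^bsub>G\<^esub> g \<otimes>\<^bsub>G\<^esub> h \<in> generate G A"
    using assms gen by simp
  ultimately have "(g, h) \<in> ?R\<^sup>*"
    using reach assms(3) by metis
  then show ?thesis
    by (rule rtrancl_imp_relpow)
qed

end

(* Let p be the projection of the group G = F x| Z to Z, let H be a free-by-cyclic subgroup with fibre N,
   and let K = H \<inter> F.

   K is finitely generated: if N is contained in F, then K = N. Otherwise L = N \<inter> F is the common kernel of two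
   characters p, q of H, so V = Hom(L, Z/2) is a module over the group ring of Z^2. For r in K with q(r)
   minimal, r - 1 is surjective on V because K is free, and it moves windows of the finitely cogenerated
   Z/2[s, 1/s]-module V by a bounded amount; comparing the sizes of the windows, r - 1 has a finite
   kernel, so Hom(K, Z/2) is finite and the free group K has finite rank. The same surjectivity
   excludes H \<le> F: some power of r acts trivially on the finite set Hom(N, Z/2), which is then trivial.

   Choose y in H of least positive height. Since K is quasiconvex in F, the nearest point
   projection of the Cayley tree of F to K commutes up to bounded error with the automorphism
   "conjugation by y", which preserves K (bounded cancellation). Hence y^k f t^i \<mapsto> y^k \<pi>(f), for
   0 \<le> i < p(y), is a coarsely Lipschitz retraction of G to H. *)

theory Submission
  imports Defs "HOL-Library.Sublist"
begin

section \<open>Words in a free basis\<close>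

text \<open>The obstacle is that \<open>N\<close> need not lie in \<open>F\<close>: finite
  generation of \<open>N\<close> then says nothing direct about \<open>K\<close>, and
  \<open>L\<close>, unless trivial, is not finitely generated (\<open>fg_kernel_trivial\<close>).
  Rank is therefore measured dually. Each nontrivial Schreier generator of a subgroup of a free
  group has a homomorphism to Z/2 that is nonzero on it and on no other generator, so a finite
  Hom(K, Z/2) leaves only finitely many generators. Passing to the dual also makes counting
  possible: on a finite window of generators of \<open>L\<close>, homomorphisms restrict to finitely
  many patterns. The kernel of r - 1 matters because a homomorphism on \<open>K\<close> cannot see
  conjugation by the element \<open>r\<close> of \<open>K\<close>, so its restriction to
  \<open>L\<close> lies in that kernel.

  For the retraction, boundedness is recorded as finiteness of sets of displacements
  \<open>inv (\<rho> g) \<otimes> \<rho> (g \<otimes> s)\<close>. Such a statement mentions no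
  generating set and is inherited by products and inverses of the \<open>s\<close>. It is checked on
  one generating set of the group, whereas \<open>undistorted\<close> quantifies over all of
  them.\<close>

definition neg :: "'a \<times> bool \<Rightarrow> 'a \<times> bool" where
  "neg a = (fst a, \<not> snd a)"

lemma neg_simps [simp]:
  "neg (neg a) = a" "fst (neg a) = fst a" "snd (neg a) = (\<not> snd a)" "neg a \<noteq> a" "a \<noteq> neg a"
  "neg a = neg b \<longleftrightarrow> a = b" "neg a \<in> S \<times> UNIV \<longleftrightarrow> a \<in> S \<times> UNIV"
  by (auto simp: neg_def prod_eq_iff mem_Times_iff)

definition inv_word :: "('a \<times> bool) list \<Rightarrow> ('a \<times> bool) list" where
  "inv_word w = rev (map neg w)"

text \<open>Left multiplication by a letter, carried out on reduced words: at most one cancellation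
  occurs.\<close>

definition push :: "'a \<times> bool \<Rightarrow> ('a \<times> bool) list \<Rightarrow> ('a \<times> bool) list" where
  "push a w = (if w \<noteq> [] \<and> hd w = neg a then tl w else a # w)"

definition compat :: "'a \<times> bool \<Rightarrow> 'a \<times> bool \<Rightarrow> bool" where
  "compat a b \<longleftrightarrow> b \<noteq> neg a"

abbreviation reduced :: "('a \<times> bool) list \<Rightarrow> bool" where
  "reduced \<equiv> successively compat"

lemma compat_neg: "compat (neg b) (neg a) = compat a b"
  by (auto simp: compat_def)

lemma reduced_words_iff:
  "w \<in> reduced_words S \<longleftrightarrow> set w \<subseteq> S \<times> UNIV \<and> reduced w"
proof -
  have "(\<lambda>(s, b) (t, c). \<not> (s = t \<and> b \<noteq> c)) = compat"
    by (auto simp: fun_eq_iff compat_def neg_def)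
  moreover have "fst ` set w \<subseteq> S \<longleftrightarrow> set w \<subseteq> S \<times> UNIV" by force
  ultimately show ?thesis unfolding reduced_words_def mem_Collect_eq by metis
qed

lemma inv_word_simps [simp]:
  "inv_word [] = []" "inv_word (a # w) = inv_word w @ [neg a]"
  "inv_word (v @ w) = inv_word w @ inv_word v"
  "inv_word (inv_word w) = w" "length (inv_word w) = length w"
  "inv_word w = [] \<longleftrightarrow> w = []"
  by (auto simp: inv_word_def rev_map o_def)

lemma set_inv_word [simp]: "set (inv_word w) \<subseteq> S \<times> UNIV \<longleftrightarrow> set w \<subseteq> S \<times> UNIV"
  by (induction w) auto

lemma last_inv_word: "w \<noteq> [] \<Longrightarrow> last (inv_word w) = neg (hd w)"
  by (cases w) auto

lemma reduced_inv_word [simp]: "reduced (inv_word w) = reduced w"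
  by (simp add: inv_word_def successively_rev successively_map compat_neg)

lemma reduced_push: "reduced w \<Longrightarrow> reduced (push a w)"
  by (cases w) (auto simp: push_def successively_Cons compat_def)

lemma set_push: "set (push a w) \<subseteq> insert a (set w)"
  by (cases w) (auto simp: push_def)

lemma (in group) inv_mult_cancel:
  assumes "x \<in> carrier G" "y \<in> carrier G"
  shows "inv x \<otimes> (x \<otimes> y) = y" "x \<otimes> (inv x \<otimes> y) = y"
  using assms by (simp_all add: m_assoc[symmetric])

section \<open>Normal forms and word length with respect to a basis\<close>

locale free_basis_group = group F for F :: "('a, 'b) monoid_scheme" (structure) +
  fixes S :: "'a set"
  assumes basis: "free_basis F S"
begin

lemma basis_closed [simp, intro]: "s \<in> S \<Longrightarrow> s \<in> carrier F"
  using basis by (auto simp: free_basis_def)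

definition letter :: "'a \<times> bool \<Rightarrow> 'a" where
  "letter a = (if snd a then fst a else inv (fst a))"

abbreviation letters :: "('a \<times> bool) set" where
  "letters \<equiv> S \<times> UNIV"

abbreviation val :: "('a \<times> bool) list \<Rightarrow> 'a" where
  "val \<equiv> word_value F"

lemma letter_closed [simp, intro]: "a \<in> letters \<Longrightarrow> letter a \<in> carrier F"
  by (auto simp: letter_def)

lemma letter_neg: "a \<in> letters \<Longrightarrow> letter (neg a) = inv (letter a)"
  by (auto simp: letter_def neg_def)

lemma val_Nil [simp]: "val [] = \<one>"
  by (simp add: word_value_def)

lemma val_Cons [simp]: "val (a # w) = letter a \<otimes> val w"
  by (cases a) (simp add: word_value_def letter_def)

lemma val_closed [simp, intro]: "set w \<subseteq> letters \<Longrightarrow> val w \<in> carrier F"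
  by (induction w) auto

lemma val_append [simp]:
  "set v \<subseteq> letters \<Longrightarrow> set w \<subseteq> letters \<Longrightarrow> val (v @ w) = val v \<otimes> val w"
  by (induction v) (auto simp: m_assoc)

lemma val_inv_word: "set w \<subseteq> letters \<Longrightarrow> val (inv_word w) = inv (val w)"
proof (induction w)
  case (Cons a w)
  then have "set (inv_word w) \<subseteq> letters" by simp
  with Cons show ?case by (auto simp: inv_mult_group letter_neg)
qed simp

lemma val_push: "a \<in> letters \<Longrightarrow> set w \<subseteq> letters \<Longrightarrow> val (push a w) = letter a \<otimes> val w"
  by (cases w) (auto simp: push_def letter_neg m_assoc[symmetric])

definition nf :: "'a \<Rightarrow> ('a \<times> bool) list" where
  "nf g = the_inv_into (reduced_words S) val g"

lemma nf_unique:
  assumes "reduced w" "set w \<subseteq> letters"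
  shows "nf (val w) = w"
proof -
  have "w \<in> reduced_words S" using assms by (simp add: reduced_words_iff)
  then show ?thesis
    using basis by (auto simp: nf_def free_basis_def bij_betw_def the_inv_into_f_f)
qed

lemma nf_props [simp, intro]:
  assumes "g \<in> carrier F"
  shows "reduced (nf g)" "set (nf g) \<subseteq> letters" "val (nf g) = g"
proof -
  have b: "bij_betw val (reduced_words S) (carrier F)"
    using basis by (auto simp: free_basis_def)
  have "nf g \<in> reduced_words S"
    unfolding nf_def using b assms
    by (metis bij_betw_def bij_betw_the_inv_into imageI)
  then show "reduced (nf g)" "set (nf g) \<subseteq> letters"
    by (simp_all add: reduced_words_iff)
  show "val (nf g) = g"
    unfolding nf_def using b assms
    by (metis bij_betw_def f_the_inv_into_f)
qed

lemma nf_one [simp]: "nf \<one> = []"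
  using nf_unique[of "[]"] by simp

lemma nf_eq_Nil [simp]: "g \<in> carrier F \<Longrightarrow> nf g = [] \<longleftrightarrow> g = \<one>"
  using nf_props(3) by fastforce

lemma nf_inv: "g \<in> carrier F \<Longrightarrow> nf (inv g) = inv_word (nf g)"
  using nf_unique[of "inv_word (nf g)"] by (simp add: val_inv_word)

lemma nf_letter_mult:
  assumes "a \<in> letters" "g \<in> carrier F"
  shows "nf (letter a \<otimes> g) = push a (nf g)"
proof -
  have "set (push a (nf g)) \<subseteq> letters" "reduced (push a (nf g))"
    using set_push[of a "nf g"] nf_props(1,2)[of g] assms
    by (blast, simp add: reduced_push)
  then show ?thesis using nf_unique[of "push a (nf g)"] assms by (simp add: val_push)
qed

lemma nf_letter: "a \<in> letters \<Longrightarrow> nf (letter a) = [a]"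
  using nf_letter_mult[of a \<one>] by (simp add: push_def)

lemma val_induct [consumes 1, case_names one step]:
  assumes "g \<in> carrier F" "P \<one>"
    and "\<And>a g. a \<in> letters \<Longrightarrow> g \<in> carrier F \<Longrightarrow> P g \<Longrightarrow> P (letter a \<otimes> g)"
  shows "P g"
proof -
  have "P (val w)" if "set w \<subseteq> letters" for w
    using that by (induction w) (auto intro: assms)
  then show ?thesis using assms(1) by (metis nf_props(2,3))
qed

definition len :: "'a \<Rightarrow> nat" where
  "len g = length (nf g)"

text \<open>Behind the longest common prefix the two remainders start with different letters, so
  \<open>inv_word a @ b\<close> admits no cancellation. Geometrically, \<open>val p\<close> is the
  branch point of the tripod spanned by \<one>, \<open>g\<close> and \<open>h\<close> in the Cayley
  tree.\<close>

lemma nf_split: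
  assumes "g \<in> carrier F" "h \<in> carrier F"
  obtains p a b where "nf g = p @ a" "nf h = p @ b" "nf (inv g \<otimes> h) = inv_word a @ b"
    and "a = [] \<or> b = [] \<or> hd a \<noteq> hd b"
proof -
  obtain p a b where e: "nf g = p @ a" "nf h = p @ b" "a = [] \<or> b = [] \<or> hd a \<noteq> hd b"
    using longest_common_prefix by blast
  have l: "set p \<subseteq> letters" "set a \<subseteq> letters" "set b \<subseteq> letters"
    using nf_props(2)[OF assms(1)] nf_props(2)[OF assms(2)] e by auto
  have r: "reduced a" "reduced b"
    using nf_props(1)[OF assms(1)] nf_props(1)[OF assms(2)] e by (auto simp: successively_append_iff)
  have "reduced (inv_word a @ b)"
    using e(3) r unfolding successively_append_iff
    by (auto simp: last_inv_word compat_def[of "neg _"])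
  moreover have "val (inv_word a @ b) = inv g \<otimes> h"
  proof -
    have "g = val p \<otimes> val a" "h = val p \<otimes> val b"
      using nf_props(3)[OF assms(1)] nf_props(3)[OF assms(2)] e l by (metis val_append)+
    then show ?thesis using l
      by (simp add: val_inv_word inv_mult_group m_assoc inv_mult_cancel)
  qed
  ultimately have "nf (inv g \<otimes> h) = inv_word a @ b"
    using nf_unique[of "inv_word a @ b"] l by simp
  with e that show thesis by blast
qed

lemma len_inv [simp]: "g \<in> carrier F \<Longrightarrow> len (inv g) = len g"
  by (simp add: len_def nf_inv)

lemma len_one [simp]: "len \<one> = 0"
  by (simp add: len_def)

lemma len_mult:
  assumes "g \<in> carrier F" "h \<in> carrier F"
  shows "len (g \<otimes> h) \<le> len g + len h"
proof -
  obtain p a b where "nf (inv g) = p @ a" "nf h = p @ b" "nf (inv (inv g) \<otimes> h) = inv_word a @ b"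
    using nf_split[of "inv g" h] assms by (metis inv_closed)
  moreover have "len (inv g) = len g" using assms by simp
  ultimately show ?thesis using assms by (simp add: len_def)
qed

end

section \<open>Coarse projection to a finitely generated subgroup\<close>

context free_basis_group
begin

lemma val_reduced_len: "reduced w \<Longrightarrow> set w \<subseteq> letters \<Longrightarrow> len (val w) = length w"
  by (simp add: len_def nf_unique)

lemma nf_appendE:
  assumes "g \<in> carrier F" "nf g = v @ w"
  shows "set v \<subseteq> letters" "set w \<subseteq> letters" "reduced v" "reduced w" "g = val v \<otimes> val w"
    "nf (val v) = v" "nf (val w) = w" "inv (val v) \<otimes> g = val w"
proof -
  show s: "set v \<subseteq> letters" "set w \<subseteq> letters"
    using nf_props(2)[OF assms(1)] assms(2) by auto
  show r: "reduced v" "reduced w"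
    using nf_props(1)[OF assms(1)] assms(2) by (auto simp: successively_append_iff)
  show g: "g = val v \<otimes> val w"
    using nf_props(3)[OF assms(1)] assms(2) s by simp
  show "nf (val v) = v" "nf (val w) = w" using s r by (simp_all add: nf_unique)
  show "inv (val v) \<otimes> g = val w" using g val_closed[OF s(1)] val_closed[OF s(2)] by (simp add: inv_mult_cancel)
qed

text \<open>This is the Gromov product based at \<one>. In a tree it is the length of the common
  prefix, so \<open>div\<close> is exact. Written through lengths, it changes in a controlled way
  under multiplication, by the triangle inequality alone.\<close>

definition common_prefix_len :: "'a \<Rightarrow> 'a \<Rightarrow> nat" where
  "common_prefix_len g h = (len g + len h - len (inv g \<otimes> h)) div 2"

lemma common_prefix_split:
  assumes "g \<in> carrier F" "h \<in> carrier F"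
  obtains p a b where "nf g = p @ a" "nf h = p @ b" "nf (inv g \<otimes> h) = inv_word a @ b"
    "common_prefix_len g h = length p"
proof -
  obtain p a b where "nf g = p @ a" "nf h = p @ b" "nf (inv g \<otimes> h) = inv_word a @ b"
    using nf_split[OF assms] by metis
  with that show thesis by (simp add: common_prefix_len_def len_def)
qed

lemma common_prefix_len_eq:
  assumes "g \<in> carrier F" "h \<in> carrier F"
  shows "len g + len h = len (inv g \<otimes> h) + 2 * common_prefix_len g h"
proof -
  obtain p a b where "nf g = p @ a" "nf h = p @ b" "nf (inv g \<otimes> h) = inv_word a @ b"
    "common_prefix_len g h = length p"
    using common_prefix_split[OF assms] .
  then show ?thesis by (simp add: len_def)
qed

lemma common_prefix_len_ge:
  assumes "g \<in> carrier F" "h \<in> carrier F" "nf g = p @ a" "nf h = p @ b"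
  shows "length p \<le> common_prefix_len g h"
proof -
  note A = nf_appendE[OF assms(1,3)] and B = nf_appendE[OF assms(2,4)]
  have "inv g \<otimes> h = inv (val a) \<otimes> val b"
    unfolding A(5) B(5) using val_closed[OF A(1)] val_closed[OF A(2)] val_closed[OF B(2)]
    by (simp add: inv_mult_group m_assoc inv_mult_cancel)
  then have "len (inv g \<otimes> h) \<le> len (val a) + len (val b)"
    using len_mult[of "inv (val a)" "val b"] val_closed[OF A(2)] val_closed[OF B(2)] by simp
  also have "\<dots> = length a + length b"
    using A B by (simp add: val_reduced_len)
  finally have "len (inv g \<otimes> h) \<le> length a + length b" .
  moreover have "len g = length p + length a" "len h = length p + length b"
    using assms by (simp_all add: len_def)
  ultimately show ?thesis using common_prefix_len_eq[OF assms(1,2)] by linarith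
qed

lemma common_prefix_len_mult_right:
  assumes "g \<in> carrier F" "c \<in> carrier F" "h \<in> carrier F"
  shows "common_prefix_len (g \<otimes> c) h \<le> common_prefix_len g h + len c"
proof -
  have "inv g \<otimes> h = c \<otimes> (inv (g \<otimes> c) \<otimes> h)"
    using assms by (simp add: inv_mult_group m_assoc inv_mult_cancel)
  then have "len (inv g \<otimes> h) \<le> len c + len (inv (g \<otimes> c) \<otimes> h)"
    using assms len_mult[of c "inv (g \<otimes> c) \<otimes> h"] by simp
  moreover have "len (g \<otimes> c) \<le> len g + len c" using assms by (simp add: len_mult)
  ultimately show ?thesis
    using common_prefix_len_eq[of g h] common_prefix_len_eq[of "g \<otimes> c" h] assms by simp
qed

lemma common_prefix_len_mult_left:
  assumes "x \<in> carrier F" "g \<in> carrier F" "h \<in> carrier F"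
  shows "common_prefix_len (x \<otimes> g) (x \<otimes> h) \<le> len x + common_prefix_len g h"
proof -
  have "inv (x \<otimes> g) \<otimes> (x \<otimes> h) = inv g \<otimes> h"
    using assms by (simp add: inv_mult_group m_assoc inv_mult_cancel)
  moreover have "len (x \<otimes> g) \<le> len x + len g" "len (x \<otimes> h) \<le> len x + len h"
    using assms by (simp_all add: len_mult)
  ultimately show ?thesis
    using common_prefix_len_eq[of g h] common_prefix_len_eq[of "x \<otimes> g" "x \<otimes> h"] assms by simp
qed

text \<open>In the Cayley tree a path that enters the branch beyond \<open>u\<close> passes through \<open>u\<close>.\<close>

lemma len_step_into_branch:
  assumes "u \<in> carrier F" "x \<in> carrier F" "y \<in> carrier F"
    and "prefix (nf u) (nf y)" "\<not> prefix (nf u) (nf x)"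
  shows "len (inv u \<otimes> y) \<le> len (inv x \<otimes> y)"
proof -
  obtain p a b where s: "nf x = p @ a" "nf y = p @ b" "nf (inv x \<otimes> y) = inv_word a @ b"
    using nf_split[OF assms(2,3)] by metis
  from assms(4) s(2) obtain z where z: "p @ b = nf u @ z" by (auto simp: prefix_def)
  have "\<not> prefix (nf u) p" using assms(5) s(1) by (metis prefix_prefix)
  then have "prefix p (nf u)"
    using prefix_same_cases[of "nf u" "p @ b" p] z by (metis prefixI)
  then have "length z \<le> length b"
    using prefix_length_le[of p "nf u"] arg_cong[OF z, of length] by simp
  moreover have "len (inv u \<otimes> y) = length z"
  proof -
    have "nf y = nf u @ z" using s z by simp
    then show ?thesis using nf_appendE[OF assms(3), of "nf u" z] assms(1) by (simp add: val_reduced_len)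
  qed
  ultimately show ?thesis using s(3) by (simp add: len_def)
qed

text \<open>The generators trace a path in \<open>K\<close> from \<one> to \<open>\<kappa>\<close>
  with jumps of length at most \<open>C\<close>. The jump that enters the branch beyond
  \<open>u\<close> ends within \<open>C\<close> of \<open>u\<close>.\<close>

lemma subgroup_quasiconvex:
  assumes "subgroup K F" "A \<subseteq> K" "generate F A = K" "\<And>a. a \<in> A \<Longrightarrow> len a \<le> C"
    and "\<kappa> \<in> K" "u \<in> carrier F" "prefix (nf u) (nf \<kappa>)"
  shows "\<exists>k\<in>K. len (inv u \<otimes> k) \<le> C"
proof -
  interpret K: subgroup K F by fact
  define P where "P x \<longleftrightarrow> x \<in> K \<and> (\<forall>u\<in>carrier F. prefix (nf u) (nf x) \<longrightarrow> (\<exists>k\<in>K. len (inv u \<otimes> k) \<le> C))" for x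
  have P_one: "P \<one>"
    using K.one_closed by (auto simp: P_def intro!: bexI[of _ \<one>])
  have P_step: "P (x \<otimes> a)" if "P x" "a \<in> K" "len a \<le> C" for x a
  proof -
    have xK: "x \<in> K" "x \<in> carrier F" "a \<in> carrier F" using that by (auto simp: P_def)
    have "\<exists>k\<in>K. len (inv u \<otimes> k) \<le> C" if u: "u \<in> carrier F" "prefix (nf u) (nf (x \<otimes> a))" for u
    proof (cases "prefix (nf u) (nf x)")
      case True
      then show ?thesis using \<open>P x\<close> u by (simp add: P_def)
    next
      case False
      have "inv x \<otimes> (x \<otimes> a) = a" using xK by (simp add: inv_mult_cancel)
      then have "len (inv u \<otimes> (x \<otimes> a)) \<le> len a"
        using len_step_into_branch[OF u(1) xK(2) _ u(2) False] xK by simp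
      then show ?thesis using xK \<open>a \<in> K\<close> \<open>len a \<le> C\<close> by (intro bexI[of _ "x \<otimes> a"]) auto
    qed
    then show ?thesis using xK \<open>a \<in> K\<close> by (simp add: P_def)
  qed
  \<comment> \<open>Quantifying over all starting points \<open>x\<close> lets the product case of
    \<open>generate\<close> compose two stretches of the path.\<close>
  have "\<forall>x. P x \<longrightarrow> P (x \<otimes> k)" if "k \<in> generate F A" for k
    using that
  proof induction
    case one
    then show ?case using K.mem_carrier by (simp add: P_def)
  next
    case (incl a)
    then show ?case using P_step assms(2,4) by (simp add: subset_iff)
  next
    case (inv a)
    then have "inv a \<in> K" "len (inv a) \<le> C" using assms(2,4) by (auto simp: subset_iff)
    then show ?case using P_step by simp
  next
    case (eng g h)
    then have "g \<in> K" "h \<in> K" using assms(3) by simp_all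
    show ?case
    proof (intro allI impI)
      fix x assume "P x"
      then have "P (x \<otimes> g)" using eng.IH(1) by blast
      then have "P (x \<otimes> g \<otimes> h)" using eng.IH(2) by blast
      moreover have "x \<in> K" using \<open>P x\<close> by (simp add: P_def)
      ultimately have "P (x \<otimes> g \<otimes> h)" "x \<in> K" .
      then show "P (x \<otimes> (g \<otimes> h))" using \<open>g \<in> K\<close> \<open>h \<in> K\<close> by (simp add: m_assoc)
    qed
  qed
  then have "P (\<one> \<otimes> \<kappa>)" using P_one assms(3,5) by blast
  then have "P \<kappa>" using assms(5) by simp
  then show ?thesis using assms(6,7) by (simp add: P_def)
qed

lemma len_hom:
  assumes "\<psi> \<in> hom F F" "\<And>a. a \<in> letters \<Longrightarrow> len (\<psi> (letter a)) \<le> C" "g \<in> carrier F"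
  shows "len (\<psi> g) \<le> C * len g"
proof -
  interpret h: group_hom F F \<psi> by (simp add: assms(1) group_hom.intro group_hom_axioms.intro is_group)
  have "len (\<psi> (val w)) \<le> C * length w" if "set w \<subseteq> letters" for w
    using that
  proof (induction w)
    case (Cons a w)
    then have "letter a \<in> carrier F" "val w \<in> carrier F" by auto
    moreover have "len (\<psi> (letter a)) \<le> C" using Cons.prems assms(2) by simp
    ultimately show ?case
      using Cons len_mult[of "\<psi> (letter a)" "\<psi> (val w)"] by simp
  qed simp
  from this[of "nf g"] show ?thesis using assms(3) by (simp add: len_def)
qed

text \<open>The images of the prefixes of \<open>w\<close> form a path from \<one> with jumps of
  length at most \<open>C\<close>. Again the jump into the branch beyond \<open>u\<close> lands near
  \<open>u\<close>. The word grows at its right end, so that one induction step is one jump.\<close>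

lemma prefix_of_hom_image:
  assumes "\<psi> \<in> hom F F" "\<And>a. a \<in> letters \<Longrightarrow> len (\<psi> (letter a)) \<le> C"
    and "set w \<subseteq> letters" "u \<in> carrier F" "prefix (nf u) (nf (\<psi> (val w)))"
  shows "\<exists>v. prefix v w \<and> len (inv u \<otimes> \<psi> (val v)) \<le> C"
  using assms(3,5)
proof (induction w rule: rev_induct)
  interpret h: group_hom F F \<psi> by (simp add: assms(1) group_hom.intro group_hom_axioms.intro is_group)
  case Nil
  then have "u = \<one>" using assms(4) by simp
  then show ?case by (intro exI[of _ "[]"]) simp
next
  interpret h: group_hom F F \<psi> by (simp add: assms(1) group_hom.intro group_hom_axioms.intro is_group)
  case (snoc a w)
  have c: "val w \<in> carrier F" "letter a \<in> carrier F" using snoc.prems by auto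
  show ?case
  proof (cases "prefix (nf u) (nf (\<psi> (val w)))")
    case True
    then obtain v where "prefix v w" "len (inv u \<otimes> \<psi> (val v)) \<le> C" using snoc by auto
    then show ?thesis by (intro exI[of _ v]) (simp add: prefix_prefix)
  next
    case False
    have "inv (\<psi> (val w)) \<otimes> \<psi> (val (w @ [a])) = \<psi> (letter a)"
      using c snoc.prems by (simp add: inv_mult_cancel)
    moreover have "\<psi> (val (w @ [a])) \<in> carrier F" using c snoc.prems by simp
    ultimately have "len (inv u \<otimes> \<psi> (val (w @ [a]))) \<le> len (\<psi> (letter a))"
      using len_step_into_branch[OF assms(4) _ _ snoc.prems(2) False] c by simp
    also have "\<dots> \<le> C" using assms(2) snoc.prems by simp
    finally show ?thesis by (intro exI[of _ "w @ [a]"]) simp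
  qed
qed

text \<open>Let \<open>u\<close> be the end of the common prefix of the two images. Both image paths
  pass within \<open>C\<close> of \<open>u\<close>, at prefixes \<open>a'\<close> and
  \<open>b'\<close>, so the image of the quotient of \<open>a'\<close> and \<open>b'\<close> has
  length at most \<open>2 * C\<close>. Applying \<open>\<phi>\<close>, that quotient has length at
  most \<open>C' * (2 * C)\<close>. Since \<open>inv_word a @ b\<close> does not cancel, this bounds
  \<open>b'\<close> itself, then its image, and finally \<open>u\<close>, which is within
  \<open>C\<close> of that image.\<close>

lemma bounded_cancellation:
  assumes hom: "\<psi> \<in> hom F F" "\<phi> \<in> hom F F" and inv: "\<And>x. x \<in> carrier F \<Longrightarrow> \<phi> (\<psi> x) = x"
    and C: "\<And>a. a \<in> letters \<Longrightarrow> len (\<psi> (letter a)) \<le> C"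
    and C': "\<And>a. a \<in> letters \<Longrightarrow> len (\<phi> (letter a)) \<le> C'"
    and ab: "set a \<subseteq> letters" "set b \<subseteq> letters" "reduced (inv_word a @ b)"
  shows "common_prefix_len (\<psi> (val a)) (\<psi> (val b)) \<le> C * (C' * (2 * C)) + C"
proof -
  interpret h: group_hom F F \<psi> by (simp add: hom group_hom.intro group_hom_axioms.intro is_group)
  have c: "\<psi> (val a) \<in> carrier F" "\<psi> (val b) \<in> carrier F" using ab by simp_all
  obtain p x y where s: "nf (\<psi> (val a)) = p @ x" "nf (\<psi> (val b)) = p @ y"
    "common_prefix_len (\<psi> (val a)) (\<psi> (val b)) = length p"
    using common_prefix_split[OF c] by metis
  let ?u = "val p"
  note sp = nf_appendE[OF c(1) s(1)]
  have u: "?u \<in> carrier F" "nf ?u = p" "len ?u = length p"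
    using sp by (simp_all add: val_reduced_len)
  obtain a' where a': "prefix a' a" "len (inv ?u \<otimes> \<psi> (val a')) \<le> C"
    using prefix_of_hom_image[OF hom(1) C ab(1) u(1)] s u by auto
  obtain b' where b': "prefix b' b" "len (inv ?u \<otimes> \<psi> (val b')) \<le> C"
    using prefix_of_hom_image[OF hom(1) C ab(2) u(1)] s u by auto
  obtain a2 b2 where ab2: "a = a' @ a2" "b = b' @ b2" using a' b' by (auto simp: prefix_def)
  then have l: "set a' \<subseteq> letters" "set b' \<subseteq> letters" using ab by auto
  have "inv_word a @ b = inv_word a2 @ (inv_word a' @ b') @ b2" using ab2 by simp
  then have red: "reduced (inv_word a' @ b')"
    using ab(3) by (metis successively_append_iff)
  have len_b': "len (val b') = length b'"
    using red l(2) by (simp add: val_reduced_len successively_append_iff)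
  from red have len: "len (val (inv_word a' @ b')) = length a' + length b'"
    using l val_reduced_len[of "inv_word a' @ b'"] by simp
  let ?z = "val (inv_word a' @ b')"
  have va: "val a' \<in> carrier F" "val b' \<in> carrier F" using l by simp_all
  have z: "?z \<in> carrier F" "?z = inv (val a') \<otimes> val b'" using l by (simp_all add: val_inv_word)
  have "\<psi> ?z = inv (inv ?u \<otimes> \<psi> (val a')) \<otimes> (inv ?u \<otimes> \<psi> (val b'))"
    unfolding z(2) using u(1) va by (simp add: inv_mult_group m_assoc inv_mult_cancel)
  then have "len (\<psi> ?z) \<le> len (inv ?u \<otimes> \<psi> (val a')) + len (inv ?u \<otimes> \<psi> (val b'))"
    using u(1) va len_mult[of "inv (inv ?u \<otimes> \<psi> (val a'))" "inv ?u \<otimes> \<psi> (val b')"] by simp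
  then have "len (\<psi> ?z) \<le> 2 * C" using a' b' by simp
  moreover have "len ?z \<le> C' * len (\<psi> ?z)"
    using len_hom[OF hom(2) C', of "\<psi> ?z"] z(1) inv[of ?z] by simp
  ultimately have "length b' \<le> C' * (2 * C)"
    using len by (metis add_leE le_trans mult_le_mono2)
  moreover have "len (\<psi> (val b')) \<le> C * length b'"
    using len_hom[OF hom(1) C va(2)] unfolding len_b' by simp
  ultimately have "len (\<psi> (val b')) \<le> C * (C' * (2 * C))"
    by (meson le_trans mult_le_mono2)
  moreover have "len ?u \<le> len (\<psi> (val b')) + len (inv ?u \<otimes> \<psi> (val b'))"
  proof -
    have "?u = \<psi> (val b') \<otimes> inv (inv ?u \<otimes> \<psi> (val b'))"
      using u(1) va by (simp add: inv_mult_group m_assoc inv_mult_cancel)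
    then show ?thesis
      using len_mult[of "\<psi> (val b')" "inv (inv ?u \<otimes> \<psi> (val b'))"] u(1) va by simp
  qed
  ultimately show ?thesis using b' s(3) u(3) by linarith
qed

text \<open>For quasiconvex \<open>K\<close> this says that \<one> is, up to a bounded error, a
  nearest point of \<open>K\<close> to \<open>g\<close>. Unlike being nearest, the condition
  survives right multiplication and automorphisms preserving \<open>K\<close>, at the price of a
  larger \<open>D\<close>.\<close>

definition transverse :: "'a set \<Rightarrow> nat \<Rightarrow> 'a \<Rightarrow> bool" where
  "transverse K D g \<longleftrightarrow> (\<forall>k\<in>K. common_prefix_len g k \<le> D)"

text \<open>A nearest point \<open>k\<close> works. If \<open>inv k \<otimes> f\<close> shares a
  prefix \<open>p\<close> with an element of \<open>K\<close>, quasiconvexity gives \<open>l\<close>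
  in \<open>K\<close> within \<open>C\<close> of the end of \<open>p\<close>; were \<open>p\<close>
  longer than \<open>C\<close>, the element \<open>k \<otimes> l\<close> would be closer to
  \<open>f\<close> than \<open>k\<close>.\<close>

lemma ex_transverse:
  assumes "subgroup K F" "A \<subseteq> K" "generate F A = K" "\<And>a. a \<in> A \<Longrightarrow> len a \<le> C" "f \<in> carrier F"
  shows "\<exists>k\<in>K. transverse K C (inv k \<otimes> f)"
proof -
  interpret K: subgroup K F by fact
  obtain k where k: "k \<in> K" "\<And>l. l \<in> K \<Longrightarrow> len (inv k \<otimes> f) \<le> len (inv l \<otimes> f)"
    using ex_has_least_nat[of "\<lambda>k. k \<in> K" \<one> "\<lambda>k. len (inv k \<otimes> f)"] by auto
  have kc: "k \<in> carrier F" using k by simp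
  let ?g = "inv k \<otimes> f"
  have g: "?g \<in> carrier F" using kc assms(5) by simp
  have "common_prefix_len ?g \<kappa> \<le> C" if \<kappa>: "\<kappa> \<in> K" for \<kappa>
  proof -
    have \<kappa>c: "\<kappa> \<in> carrier F" using \<kappa> by simp
    obtain p a b where s: "nf ?g = p @ a" "nf \<kappa> = p @ b" "common_prefix_len ?g \<kappa> = length p"
      using common_prefix_split[OF g \<kappa>c] by metis
    note sg = nf_appendE[OF g s(1)]
    have u: "val p \<in> carrier F" using sg by simp
    obtain l where l: "l \<in> K" "len (inv (val p) \<otimes> l) \<le> C"
      using subgroup_quasiconvex[OF assms(1-4) \<kappa> u] sg s by auto
    have lc: "l \<in> carrier F" using l by simp
    have "len ?g \<le> len (inv (k \<otimes> l) \<otimes> f)" using k l by simp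
    also have "inv (k \<otimes> l) \<otimes> f = inv (inv (val p) \<otimes> l) \<otimes> (inv (val p) \<otimes> ?g)"
      using kc lc u assms(5) by (simp add: inv_mult_group m_assoc inv_mult_cancel)
    also have "len \<dots> \<le> len (inv (val p) \<otimes> l) + len (inv (val p) \<otimes> ?g)"
      using len_mult[of "inv (inv (val p) \<otimes> l)" "inv (val p) \<otimes> ?g"] u lc g by simp
    also have "\<dots> \<le> C + length a"
      using l(2) unfolding sg(8) using sg by (simp add: val_reduced_len)
    finally show ?thesis using s by (simp add: len_def)
  qed
  then show ?thesis using k(1) by (auto simp: transverse_def)
qed

text \<open>Cut \<open>inv k \<otimes> l\<close> where it branches off from
  \<open>inv k \<otimes> f\<close>. The first piece is a prefix shared with
  \<open>inv k \<otimes> f\<close>, hence of length at most \<open>D\<close>. The inverse of the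
  second piece is a prefix shared by \<open>inv l \<otimes> f\<close> and
  \<open>inv l \<otimes> k\<close>, hence of length at most \<open>E\<close>.\<close>

lemma transverse_unique:
  assumes "subgroup K F" "k \<in> K" "l \<in> K" "f \<in> carrier F"
    and "transverse K D (inv k \<otimes> f)" "transverse K E (inv l \<otimes> f)"
  shows "len (inv k \<otimes> l) \<le> D + E"
proof -
  interpret K: subgroup K F by fact
  let ?\<kappa> = "inv k \<otimes> l"
  have c: "k \<in> carrier F" "l \<in> carrier F" using assms by simp_all
  have \<kappa>: "?\<kappa> \<in> K" "?\<kappa> \<in> carrier F" "inv ?\<kappa> \<in> K" using assms c by simp_all
  have g: "inv k \<otimes> f \<in> carrier F" using c assms(4) by simp
  have g2: "inv ?\<kappa> \<otimes> (inv k \<otimes> f) = inv l \<otimes> f"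
    using c assms(4) by (simp add: inv_mult_group m_assoc inv_mult_cancel)
  obtain p a b where s: "nf ?\<kappa> = p @ a" "nf (inv k \<otimes> f) = p @ b"
    "nf (inv ?\<kappa> \<otimes> (inv k \<otimes> f)) = inv_word a @ b"
    using nf_split[OF \<kappa>(2) g] by metis
  have "length p \<le> common_prefix_len (inv k \<otimes> f) ?\<kappa>"
    by (rule common_prefix_len_ge[OF g \<kappa>(2) s(2,1)])
  then have 1: "length p \<le> D" using assms(5) \<kappa>(1) unfolding transverse_def by (meson le_trans)
  have "nf (inv ?\<kappa>) = inv_word a @ inv_word p" using s(1) \<kappa>(2) by (simp add: nf_inv del: inv_mult_group)
  then have "length (inv_word a) \<le> common_prefix_len (inv l \<otimes> f) (inv ?\<kappa>)"
    using s(3) c assms(4) \<kappa>(2) unfolding g2 by (intro common_prefix_len_ge) auto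
  then have 2: "length a \<le> E" using assms(6) \<kappa>(3) unfolding transverse_def
    by (metis inv_word_simps(5) le_trans)
  show ?thesis using 1 2 s(1) by (simp add: len_def)
qed

lemma transverse_mult:
  assumes "K \<subseteq> carrier F" "g \<in> carrier F" "c \<in> carrier F" "transverse K D g"
  shows "transverse K (D + len c) (g \<otimes> c)"
  unfolding transverse_def
proof
  fix k assume "k \<in> K"
  then have "common_prefix_len (g \<otimes> c) k \<le> common_prefix_len g k + len c" "common_prefix_len g k \<le> D"
    using assms common_prefix_len_mult_right[of g c k] by (auto simp: transverse_def)
  then show "common_prefix_len (g \<otimes> c) k \<le> D + len c" by simp
qed

text \<open>Every element of \<open>K\<close> is the image of some \<open>l\<close> in
  \<open>K\<close>. The images of \<open>g\<close> and \<open>l\<close> share at most the image of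
  the common prefix of \<open>g\<close> and \<open>l\<close>, which accounts for
  \<open>C * D\<close>, and what bounded cancellation allows for the two remainders.\<close>

lemma transverse_hom:
  assumes hom: "\<psi> \<in> hom F F" "\<phi> \<in> hom F F" and inv: "\<And>x. x \<in> carrier F \<Longrightarrow> \<phi> (\<psi> x) = x"
    and C: "\<And>a. a \<in> letters \<Longrightarrow> len (\<psi> (letter a)) \<le> C"
    and C': "\<And>a. a \<in> letters \<Longrightarrow> len (\<phi> (letter a)) \<le> C'"
    and K: "K \<subseteq> carrier F" "K \<subseteq> \<psi> ` K"
    and g: "g \<in> carrier F" "transverse K D g"
  shows "transverse K (C * D + (C * (C' * (2 * C)) + C)) (\<psi> g)"
  unfolding transverse_def
proof
  interpret h: group_hom F F \<psi> by (simp add: hom group_hom.intro group_hom_axioms.intro is_group)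
  fix k assume "k \<in> K"
  then obtain l where l: "l \<in> K" "k = \<psi> l" using K by auto
  have lc: "l \<in> carrier F" using l K by auto
  obtain p a b where s: "nf g = p @ a" "nf l = p @ b" "nf (inv g \<otimes> l) = inv_word a @ b"
    "common_prefix_len g l = length p"
    using common_prefix_split[OF g(1) lc] .
  note sg = nf_appendE[OF g(1) s(1)] and sl = nf_appendE[OF lc s(2)]
  have v: "val p \<in> carrier F" "val a \<in> carrier F" "val b \<in> carrier F" using sg sl by simp_all
  have "reduced (inv_word a @ b)"
    using nf_props(1)[of "inv g \<otimes> l"] s(3) g(1) lc by simp
  then have B: "common_prefix_len (\<psi> (val a)) (\<psi> (val b)) \<le> C * (C' * (2 * C)) + C"
    using bounded_cancellation[OF hom inv C C' sg(2) sl(2)] by simp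
  have "length p \<le> D" using g(2) l(1) s(4) unfolding transverse_def by metis
  moreover have "len (\<psi> (val p)) \<le> C * length p"
    using len_hom[OF hom(1) C v(1)] sg by (simp add: val_reduced_len)
  ultimately have "len (\<psi> (val p)) \<le> C * D" by (meson le_trans mult_le_mono2)
  moreover have "common_prefix_len (\<psi> g) k \<le> len (\<psi> (val p)) + common_prefix_len (\<psi> (val a)) (\<psi> (val b))"
  proof -
    have "\<psi> g = \<psi> (val p) \<otimes> \<psi> (val a)" by (subst sg(5)) (use v in simp)
    moreover have "k = \<psi> (val p) \<otimes> \<psi> (val b)" unfolding l(2) by (subst sl(5)) (use v in simp)
    ultimately show ?thesis using v common_prefix_len_mult_left[of "\<psi> (val p)" "\<psi> (val a)" "\<psi> (val b)"] by simp
  qed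
  ultimately show "common_prefix_len (\<psi> g) k \<le> C * D + (C * (C' * (2 * C)) + C)" using B by linarith
qed

lemma finite_len_le:
  assumes "finite S"
  shows "finite {x \<in> carrier F. len x \<le> n}"
proof (rule inj_on_finite[of nf _ "{w. set w \<subseteq> letters \<and> length w \<le> n}"])
  show "inj_on nf {x \<in> carrier F. len x \<le> n}"
    by (rule inj_onI) (metis (mono_tags, lifting) mem_Collect_eq nf_props(3))
  show "nf ` {x \<in> carrier F. len x \<le> n} \<subseteq> {w. set w \<subseteq> letters \<and> length w \<le> n}"
  proof clarify
    fix x assume "x \<in> carrier F" "len x \<le> n"
    then show "set (nf x) \<subseteq> letters \<and> length (nf x) \<le> n" using nf_props(2) by (simp add: len_def)
  qed
  show "finite {w. set w \<subseteq> letters \<and> length w \<le> n}"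
    using assms by (intro finite_lists_length_le) simp
qed

lemma letters_bound:
  assumes "finite S"
  shows "\<exists>C. \<forall>a\<in>letters. len (\<psi> (letter a)) \<le> C"
proof -
  have "finite ((\<lambda>a. len (\<psi> (letter a))) ` letters)" using assms by simp
  then show ?thesis by (meson finite_nat_set_iff_bounded_le imageI)
qed

text \<open>\<open>\<rho> f\<close> is chosen such that \<open>inv (\<rho> f) \<otimes> f\<close> is
  transverse to \<open>K\<close>. In each clause \<open>transverse_unique\<close> compares two
  candidates for the same point: \<open>\<rho> f\<close> and \<open>\<rho> (f \<otimes> c)\<close>
  for \<open>f \<otimes> c\<close>, then \<open>k\<close> and \<open>\<rho> k\<close> for
  \<open>k\<close>, then \<open>\<psi> (\<rho> f)\<close> and \<open>\<rho> (\<psi> f)\<close> for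
  \<open>\<psi> f\<close>. Balls in \<open>F\<close> are finite because \<open>S\<close> is, so
  bounded displacements form finite sets.\<close>

lemma coarse_projection:
  assumes S: "finite S" and K: "subgroup K F" "finite A" "A \<subseteq> K" "generate F A = K"
  obtains \<rho> where "\<And>f. f \<in> carrier F \<Longrightarrow> \<rho> f \<in> K"
    and "\<And>c. c \<in> carrier F \<Longrightarrow> finite {inv (\<rho> f) \<otimes> \<rho> (f \<otimes> c) |f. f \<in> carrier F}"
    and "finite {inv k \<otimes> \<rho> k |k. k \<in> K}"
    and "\<And>\<psi> \<phi>. \<psi> \<in> hom F F \<Longrightarrow> \<phi> \<in> hom F F \<Longrightarrow> (\<And>x. x \<in> carrier F \<Longrightarrow> \<phi> (\<psi> x) = x) \<Longrightarrow>
      \<psi> ` K = K \<Longrightarrow> finite {inv (\<psi> (\<rho> f)) \<otimes> \<rho> (\<psi> f) |f. f \<in> carrier F}"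
proof -
  interpret K: subgroup K F by fact
  obtain C where C: "\<And>a. a \<in> A \<Longrightarrow> len a \<le> C"
    using K(2) by (meson finite_imageI finite_nat_set_iff_bounded_le imageI)
  have "\<exists>k. k \<in> K \<and> transverse K C (inv k \<otimes> f)" if "f \<in> carrier F" for f
    using ex_transverse[OF K(1,3,4) C that] by auto
  then obtain \<rho> where \<rho>: "\<And>f. f \<in> carrier F \<Longrightarrow> \<rho> f \<in> K"
    "\<And>f. f \<in> carrier F \<Longrightarrow> transverse K C (inv (\<rho> f) \<otimes> f)" by metis
  have \<rho>c: "\<rho> f \<in> carrier F" if "f \<in> carrier F" for f using \<rho>(1)[OF that] by simp
  have fin: "finite T" if "\<And>x. x \<in> T \<Longrightarrow> x \<in> carrier F \<and> len x \<le> n" for T n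
    using finite_subset[OF _ finite_len_le[OF S, of n]] that by auto
  show thesis
  proof (rule that[of \<rho>])
    show "\<rho> f \<in> K" if "f \<in> carrier F" for f using \<rho>(1)[OF that] .
    show "finite {inv (\<rho> f) \<otimes> \<rho> (f \<otimes> c) |f. f \<in> carrier F}" if c: "c \<in> carrier F" for c
    proof (rule fin[of _ "C + len c + C"])
      fix x assume "x \<in> {inv (\<rho> f) \<otimes> \<rho> (f \<otimes> c) |f. f \<in> carrier F}"
      then obtain f where f: "f \<in> carrier F" "x = inv (\<rho> f) \<otimes> \<rho> (f \<otimes> c)" by auto
      have "transverse K (C + len c) (inv (\<rho> f) \<otimes> f \<otimes> c)"
        using transverse_mult[OF K.subset _ c \<rho>(2)[OF f(1)]] f \<rho>c by simp
      then have "transverse K (C + len c) (inv (\<rho> f) \<otimes> (f \<otimes> c))"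
        using f c \<rho>c by (simp add: m_assoc)
      then have "len x \<le> C + len c + C"
        unfolding f(2) using f(1) c \<rho> by (intro transverse_unique[OF K(1)]) auto
      then show "x \<in> carrier F \<and> len x \<le> C + len c + C" using f c \<rho>c by simp
    qed
    show "finite {inv k \<otimes> \<rho> k |k. k \<in> K}"
    proof (rule fin[of _ "0 + C"])
      fix x assume "x \<in> {inv k \<otimes> \<rho> k |k. k \<in> K}"
      then obtain k where k: "k \<in> K" "x = inv k \<otimes> \<rho> k" by auto
      have "transverse K 0 \<one>"
        using common_prefix_len_eq[of \<one>] by (auto simp: transverse_def)
      then have "len x \<le> 0 + C"
        unfolding k(2) using k(1) \<rho> by (intro transverse_unique[OF K(1), of _ _ k]) auto
      then show "x \<in> carrier F \<and> len x \<le> 0 + C" using k \<rho>c by simp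
    qed
    fix \<psi> \<phi> assume hom: "\<psi> \<in> hom F F" "\<phi> \<in> hom F F" and inv: "\<And>x. x \<in> carrier F \<Longrightarrow> \<phi> (\<psi> x) = x"
      and \<psi>K: "\<psi> ` K = K"
    interpret h: group_hom F F \<psi> by (simp add: hom group_hom.intro group_hom_axioms.intro is_group)
    obtain B where B: "\<And>a. a \<in> letters \<Longrightarrow> len (\<psi> (letter a)) \<le> B" using letters_bound[OF S, of \<psi>] by auto
    obtain B' where B': "\<And>a. a \<in> letters \<Longrightarrow> len (\<phi> (letter a)) \<le> B'" using letters_bound[OF S, of \<phi>] by auto
    let ?D = "B * C + (B * (B' * (2 * B)) + B)"
    show "finite {inv (\<psi> (\<rho> f)) \<otimes> \<rho> (\<psi> f) |f. f \<in> carrier F}"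
    proof (rule fin[of _ "?D + C"])
      fix x assume "x \<in> {inv (\<psi> (\<rho> f)) \<otimes> \<rho> (\<psi> f) |f. f \<in> carrier F}"
      then obtain f where f: "f \<in> carrier F" "x = inv (\<psi> (\<rho> f)) \<otimes> \<rho> (\<psi> f)" by auto
      have "transverse K ?D (\<psi> (inv (\<rho> f) \<otimes> f))"
        using f \<rho>c \<psi>K by (intro transverse_hom[OF hom inv B B' K.subset _ _ \<rho>(2)]) auto
      then have t: "transverse K ?D (inv (\<psi> (\<rho> f)) \<otimes> \<psi> f)"
        using f \<rho>c by simp
      have "\<psi> (\<rho> f) \<in> K" using \<psi>K \<rho>(1)[OF f(1)] by blast
      then have "len x \<le> ?D + C"
        unfolding f(2) using f(1) \<rho> t by (intro transverse_unique[OF K(1)]) auto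
      then show "x \<in> carrier F \<and> len x \<le> ?D + C" using f \<rho>c by simp
    qed
  qed
qed

end

section \<open>Schreier generators\<close>

context free_basis_group
begin

text \<open>\<open>E u s\<close> labels the edge of the Cayley tree from \<open>u\<close> to
  \<open>u \<otimes> s\<close>. An inverse letter runs through an edge backwards, so its label is
  looked up at the end point and inverted.\<close>

definition edge :: "('q, 'c) monoid_scheme \<Rightarrow> ('a \<Rightarrow> 'a \<Rightarrow> 'q) \<Rightarrow> 'a \<Rightarrow> 'a \<times> bool \<Rightarrow> 'q" where
  "edge Q E u a = (if snd a then E u (fst a) else inv\<^bsub>Q\<^esub> (E (u \<otimes> letter a) (fst a)))"

primrec path :: "('q, 'c) monoid_scheme \<Rightarrow> ('a \<Rightarrow> 'a \<Rightarrow> 'q) \<Rightarrow> 'a \<Rightarrow> ('a \<times> bool) list \<Rightarrow> 'q" where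
  "path Q E u [] = \<one>\<^bsub>Q\<^esub>"
| "path Q E u (a # w) = edge Q E u a \<otimes>\<^bsub>Q\<^esub> path Q E (u \<otimes> letter a) w"

text \<open>The holonomy of the labelling along the geodesic from \<open>u\<close> to
  \<open>u \<otimes> g\<close>.\<close>

definition cocycle :: "('q, 'c) monoid_scheme \<Rightarrow> ('a \<Rightarrow> 'a \<Rightarrow> 'q) \<Rightarrow> 'a \<Rightarrow> 'a \<Rightarrow> 'q" where
  "cocycle Q E u g = path Q E u (nf g)"

context
  fixes Q :: "('q, 'c) monoid_scheme" and E :: "'a \<Rightarrow> 'a \<Rightarrow> 'q"
  assumes Q: "group Q" and E: "\<And>u s. E u s \<in> carrier Q"
begin

interpretation Q: group Q by (rule Q)

lemma edge_closed: "edge Q E u a \<in> carrier Q"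
  by (simp add: edge_def E)

lemma path_closed: "path Q E u w \<in> carrier Q"
  by (induction w arbitrary: u) (auto simp: edge_closed)

lemma edge_neg:
  assumes "u \<in> carrier F" "a \<in> letters"
  shows "edge Q E u a \<otimes>\<^bsub>Q\<^esub> edge Q E (u \<otimes> letter a) (neg a) = \<one>\<^bsub>Q\<^esub>"
  using assms letter_closed[of a] by (auto simp: edge_def letter_neg m_assoc E)

lemma path_push:
  assumes "u \<in> carrier F" "a \<in> letters" "set w \<subseteq> letters"
  shows "path Q E u (push a w) = edge Q E u a \<otimes>\<^bsub>Q\<^esub> path Q E (u \<otimes> letter a) w"
proof (cases "w \<noteq> [] \<and> hd w = neg a")
  case True
  then obtain v where w: "w = neg a # v" by (cases w) auto
  have "edge Q E u a \<otimes>\<^bsub>Q\<^esub> path Q E (u \<otimes> letter a) w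
      = (edge Q E u a \<otimes>\<^bsub>Q\<^esub> edge Q E (u \<otimes> letter a) (neg a)) \<otimes>\<^bsub>Q\<^esub> path Q E (u \<otimes> letter a \<otimes> letter (neg a)) v"
    by (simp add: w Q.m_assoc edge_closed path_closed)
  also have "\<dots> = path Q E u v"
    using assms letter_closed[of a] by (simp add: edge_neg path_closed letter_neg m_assoc)
  finally show ?thesis by (simp add: push_def w)
qed (auto simp: push_def)

text \<open>Backtracking contributes a label and its inverse, so the holonomy depends on the end
  points only. This is where the Cayley graph being a tree enters.\<close>

lemma path_nf:
  assumes "u \<in> carrier F" "set w \<subseteq> letters"
  shows "path Q E u w = path Q E u (nf (val w))"
  using assms
proof (induction w arbitrary: u)
  case (Cons a w)
  then have "path Q E u (a # w) = edge Q E u a \<otimes>\<^bsub>Q\<^esub> path Q E (u \<otimes> letter a) (nf (val w))"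
    using letter_closed[of a] by simp
  also have "\<dots> = path Q E u (push a (nf (val w)))"
    using Cons.prems by (subst path_push) auto
  finally show ?case using Cons.prems by (simp add: nf_letter_mult val_closed)
qed simp

lemma path_append:
  assumes "u \<in> carrier F" "set v \<subseteq> letters"
  shows "path Q E u (v @ w) = path Q E u v \<otimes>\<^bsub>Q\<^esub> path Q E (u \<otimes> val v) w"
  using assms
proof (induction v arbitrary: u)
  case (Cons a v)
  then show ?case
    using letter_closed[of a] val_closed[of v]
    by (simp add: Q.m_assoc edge_closed path_closed m_assoc)
qed (simp add: path_closed)

lemma cocycle_closed: "cocycle Q E u g \<in> carrier Q"
  by (simp add: cocycle_def path_closed)

lemma cocycle_mult:
  assumes "u \<in> carrier F" "g \<in> carrier F" "h \<in> carrier F"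
  shows "cocycle Q E u (g \<otimes> h) = cocycle Q E u g \<otimes>\<^bsub>Q\<^esub> cocycle Q E (u \<otimes> g) h"
proof -
  have "path Q E u (nf g @ nf h) = path Q E u (nf (g \<otimes> h))"
    using path_nf[of u "nf g @ nf h"] assms by simp
  moreover have "path Q E u (nf g @ nf h) = path Q E u (nf g) \<otimes>\<^bsub>Q\<^esub> path Q E (u \<otimes> val (nf g)) (nf h)"
    using path_append[of u "nf g" "nf h"] assms nf_props(2) by blast
  ultimately show ?thesis using assms by (simp add: cocycle_def)
qed

lemma cocycle_letter: "a \<in> letters \<Longrightarrow> cocycle Q E u (letter a) = edge Q E u a"
  by (simp add: cocycle_def nf_letter edge_closed)

lemma cocycle_one: "cocycle Q E u \<one> = \<one>\<^bsub>Q\<^esub>"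
  by (simp add: cocycle_def)

lemma cocycle_translate:
  assumes "k \<in> carrier F" "u \<in> carrier F" "g \<in> carrier F"
    and "\<And>u s. u \<in> carrier F \<Longrightarrow> E (k \<otimes> u) s = E u s"
  shows "cocycle Q E (k \<otimes> u) g = cocycle Q E u g"
proof -
  have "path Q E (k \<otimes> u) w = path Q E u w" if "set w \<subseteq> letters" "u \<in> carrier F" for w u
    using that
  proof (induction w arbitrary: u)
    case (Cons a w)
    then have "letter a \<in> carrier F" by auto
    then show ?case using Cons assms(1,4) by (simp add: edge_def m_assoc)
  qed simp
  then show ?thesis using assms by (simp add: cocycle_def)
qed

end

text \<open>The cosets of \<open>K\<close> are the vertices of the Schreier graph. Choosing for each
  coset other than \<open>K\<close> a neighbour closer to \<open>K\<close> yields a spanning tree,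
  and \<open>r\<close> reads off the word along the tree path from \<open>K\<close>. The number
  \<open>d\<close> is the distance from \<open>K\<close> and serves as an induction measure; the
  last clause describes the final tree edge.\<close>

lemma ex_schreier_transversal:
  assumes "subgroup K F"
  obtains r and d :: "'a \<Rightarrow> nat"
  where "\<And>g. g \<in> carrier F \<Longrightarrow> r g \<in> K #> g"
    and "\<And>g k. g \<in> carrier F \<Longrightarrow> k \<in> K \<Longrightarrow> r (k \<otimes> g) = r g"
    and "r \<one> = \<one>"
    and "\<And>g. g \<in> carrier F \<Longrightarrow> r g = \<one> \<or>
      (\<exists>a\<in>letters. \<exists>h\<in>carrier F. d h < d g \<and> r g = r h \<otimes> letter a \<and> r (h \<otimes> letter a) = r g)"
proof -
  interpret K: subgroup K F by fact
  \<comment> \<open>\<open>dep\<close> is the distance of a coset from \<open>K\<close>,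
    \<open>desc C a\<close> says that the edge \<open>a\<close> enters \<open>C\<close> from a
    closer coset, and \<open>par\<close> fixes one such edge.\<close>
  define dep where "dep C = (LEAST n. \<exists>g\<in>C. len g = n)" for C
  define desc where "desc C a \<longleftrightarrow> a \<in> letters \<and> dep (C #> letter (neg a)) < dep C" for C a
  define par where "par C = (SOME a. desc C a)" for C
  \<comment> \<open>Among the cosets, \<open>K\<close> alone has no descending edge, so the default
    \<one> is its representative and the root of the tree.\<close>
  define R where "R = (\<lambda>f C. if Ex (desc C) then f (C #> letter (neg (par C))) \<otimes> letter (par C) else \<one>)"
  define rep where "rep = wfrec (measure dep) R"
  have par: "desc C (par C)" if "Ex (desc C)" for C
    unfolding par_def using that by (rule someI_ex)
  have rep: "rep C = (if Ex (desc C) then rep (C #> letter (neg (par C))) \<otimes> letter (par C) else \<one>)" for C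
  proof -
    have "rep C = R (cut rep (measure dep) C) C"
      unfolding rep_def by (rule wfrec) simp
    then show ?thesis using par[of C] by (auto simp: R_def cut_def desc_def)
  qed
  have dep_le: "dep C \<le> len g" if "g \<in> C" for C g
    unfolding dep_def by (rule Least_le) (use that in blast)
  \<comment> \<open>The last letter of a shortest element of the coset is a descending edge.\<close>
  have desc_ex: "Ex (desc (K #> g))" if g: "g \<in> carrier F" and nK: "K #> g \<noteq> K" for g
  proof -
    have "\<exists>h\<in>K #> g. len h = dep (K #> g)"
      unfolding dep_def by (rule LeastI_ex) (use rcos_self[OF g assms] in blast)
    then obtain h where h: "h \<in> K #> g" "len h = dep (K #> g)" by blast
    have hc: "h \<in> carrier F" using h(1) g K.subset r_coset_subset_G by blast
    have Kh: "K #> g = K #> h" using repr_independence[OF h(1) g assms] .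
    have "h \<noteq> \<one>" using nK Kh by (metis coset_mult_one K.subset)
    then obtain w a where w: "nf h = w @ [a]"
      using hc by (metis nf_eq_Nil rev_exhaust)
    have la: "a \<in> letters" "set w \<subseteq> letters" using nf_props(2)[OF hc] w by auto
    have "h = val w \<otimes> letter a"
      using nf_props(3)[OF hc] la by (simp add: w)
    then have hw: "h \<otimes> letter (neg a) = val w"
      using la letter_closed[OF la(1)] val_closed[OF la(2)] by (simp add: letter_neg m_assoc)
    have "len (val w) = length w"
      using nf_unique[of w] nf_props(1)[OF hc] la by (simp add: len_def w successively_append_iff)
    then have "len (val w) < dep (K #> g)"
      using h(2) w by (simp add: len_def)
    moreover have "val w \<in> (K #> g) #> letter (neg a)"
      using hw h(1) unfolding r_coset_def[of _ _ "letter (neg a)"] by force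
    ultimately have "desc (K #> g) a"
      using la dep_le unfolding desc_def by (metis le_less_trans)
    then show ?thesis by blast
  qed
  have coset: "(K #> g) #> letter a = K #> (g \<otimes> letter a)" if "g \<in> carrier F" "a \<in> letters" for g a
    using that K.subset by (simp add: coset_mult_assoc)
  have rep_in: "rep (K #> g) \<in> K #> g" if "g \<in> carrier F" for g
    using that
  proof (induction "dep (K #> g)" arbitrary: g rule: less_induct)
    case less
    show ?case
    proof (cases "Ex (desc (K #> g))")
      case True
      let ?a = "par (K #> g)"
      have a: "?a \<in> letters" "dep ((K #> g) #> letter (neg ?a)) < dep (K #> g)"
        using par[OF True] by (auto simp: desc_def)
      then have na: "neg ?a \<in> letters" by simp
      have "rep (K #> (g \<otimes> letter (neg ?a))) \<in> K #> (g \<otimes> letter (neg ?a))"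
        using less a na coset[OF less.prems na] by auto
      then have "rep (K #> (g \<otimes> letter (neg ?a))) \<otimes> letter ?a \<in> (K #> (g \<otimes> letter (neg ?a))) #> letter ?a"
        by (auto simp: r_coset_def[of _ _ "letter ?a"])
      also have "\<dots> = K #> g"
        using a na less.prems coset[of "g \<otimes> letter (neg ?a)" ?a] letter_closed[OF a(1)]
        by (simp add: letter_neg m_assoc)
      finally show ?thesis
        using rep[of "K #> g"] True coset[OF less.prems na] by simp
    next
      case False
      then have "K #> g = K" using desc_ex less.prems by blast
      then show ?thesis using False rep[of "K #> g"] by simp
    qed
  qed
  have K1: "K #> \<one> = K" using K.subset by simp
  show thesis
  proof (rule that[of "\<lambda>g. rep (K #> g)" "\<lambda>g. dep (K #> g)"])
    show "rep (K #> (k \<otimes> g)) = rep (K #> g)" if "g \<in> carrier F" "k \<in> K" for g k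
      using that K.subset by (metis coset_join2 coset_mult_assoc K.mem_carrier assms)
    have "dep K = 0" using dep_le[of \<one> K] by simp
    then have "\<not> Ex (desc K)" by (simp add: desc_def)
    then show "rep (K #> \<one>) = \<one>" using rep[of K] K1 by simp
    fix g assume g: "g \<in> carrier F"
    show "rep (K #> g) = \<one> \<or> (\<exists>a\<in>letters. \<exists>h\<in>carrier F. dep (K #> h) < dep (K #> g) \<and>
        rep (K #> g) = rep (K #> h) \<otimes> letter a \<and> rep (K #> (h \<otimes> letter a)) = rep (K #> g))"
    proof (cases "Ex (desc (K #> g))")
      case True
      let ?a = "par (K #> g)"
      have a: "?a \<in> letters" "dep ((K #> g) #> letter (neg ?a)) < dep (K #> g)"
        using par[OF True] by (auto simp: desc_def)
      then have na: "neg ?a \<in> letters" by simp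
      let ?h = "g \<otimes> letter (neg ?a)"
      have h: "?h \<otimes> letter ?a = g"
        using a letter_closed[OF a(1)] g by (simp add: letter_neg m_assoc)
      have hc: "?h \<in> carrier F" using g letter_closed[OF na] by simp
      have "rep (K #> g) = rep (K #> ?h) \<otimes> letter ?a"
        using rep[of "K #> g"] True coset[OF g na] by simp
      moreover have "dep (K #> ?h) < dep (K #> g)" using a coset[OF g na] by simp
      ultimately show ?thesis
        using a(1) h hc by (intro disjI2 bexI[OF _ a(1)] bexI[OF _ hc]) simp
    qed (use rep[of "K #> g"] in simp)
  qed (use rep_in in blast)
qed

end

section \<open>Freeness of subgroups: Schreier generators and their universal property\<close>

locale schreier = free_basis_group F S + sub: subgroup K F
  for F :: "('a, 'b) monoid_scheme" (structure) and S K +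
  fixes r :: "'a \<Rightarrow> 'a" and d :: "'a \<Rightarrow> nat"
  assumes rep_coset: "g \<in> carrier F \<Longrightarrow> r g \<in> K #> g"
    and rep_mult: "g \<in> carrier F \<Longrightarrow> k \<in> K \<Longrightarrow> r (k \<otimes> g) = r g"
    and rep_one [simp]: "r \<one> = \<one>"
    and rep_step: "g \<in> carrier F \<Longrightarrow> r g = \<one> \<or>
      (\<exists>a\<in>letters. \<exists>h\<in>carrier F. d h < d g \<and> r g = r h \<otimes> letter a \<and> r (h \<otimes> letter a) = r g)"
begin

definition schreier_gen :: "'a \<Rightarrow> 'a \<Rightarrow> 'a" where
  "schreier_gen u g = r u \<otimes> g \<otimes> inv (r (u \<otimes> g))"

text \<open>The edges of the spanning tree all contribute \<one>. Prescribed values must therefore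
  send \<one> to the identity, and dual elements exist only for generators other than
  \<one>.\<close>

definition schreier_gens :: "'a set" where
  "schreier_gens = {schreier_gen u s |u s. u \<in> carrier F \<and> s \<in> S}"

lemma rep_closed [simp, intro]: "g \<in> carrier F \<Longrightarrow> r g \<in> carrier F"
  using rep_coset r_coset_subset_G sub.subset by blast

lemma rep_eq: "g \<in> carrier F \<Longrightarrow> \<exists>k\<in>K. r g = k \<otimes> g"
  using rep_coset by (auto simp: r_coset_def)

lemma rep_mem [simp]: "k \<in> K \<Longrightarrow> r k = \<one>"
  using rep_mult[of \<one> k] by simp

lemma schreier_gen_mem:
  assumes "u \<in> carrier F" "g \<in> carrier F"
  shows "schreier_gen u g \<in> K"
proof -
  obtain k l where kl: "k \<in> K" "l \<in> K" "r u = k \<otimes> u" "r (u \<otimes> g) = l \<otimes> (u \<otimes> g)"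
    using rep_eq assms by (metis m_closed)
  then have "schreier_gen u g = k \<otimes> (u \<otimes> g) \<otimes> inv (u \<otimes> g) \<otimes> inv l"
    using assms by (simp add: schreier_gen_def inv_mult_group m_assoc)
  also have "\<dots> = k \<otimes> inv l"
    using assms kl by (simp add: m_assoc inv_mult_cancel)
  finally show ?thesis using kl by simp
qed

lemma schreier_gens_subset: "schreier_gens \<subseteq> K"
  by (auto simp: schreier_gens_def schreier_gen_mem)

lemma schreier_gen_translate:
  assumes "u \<in> carrier F" "g \<in> carrier F" "k \<in> K"
  shows "schreier_gen (k \<otimes> u) g = schreier_gen u g"
  using assms rep_mult[of u k] rep_mult[of "u \<otimes> g" k] by (simp add: schreier_gen_def m_assoc)

lemma schreier_gen_mult:
  assumes "u \<in> carrier F" "g \<in> carrier F" "h \<in> carrier F"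
  shows "schreier_gen u (g \<otimes> h) = schreier_gen u g \<otimes> schreier_gen (u \<otimes> g) h"
  using assms by (simp add: schreier_gen_def m_assoc inv_mult_cancel)

lemma schreier_gen_generate:
  assumes "g \<in> carrier F" "u \<in> carrier F"
  shows "schreier_gen u g \<in> generate F schreier_gens"
  using assms
proof (induction arbitrary: u rule: val_induct)
  case one
  then show ?case by (simp add: schreier_gen_def generate.one)
next
  case (step a g)
  have sa: "fst a \<in> S" using step by auto
  have "schreier_gen u (letter a) \<in> generate F schreier_gens"
  proof (cases "snd a")
    case True
    then show ?thesis using step sa by (auto simp: letter_def schreier_gens_def intro!: generate.incl)
  next
    case False
    let ?x = "schreier_gen (u \<otimes> letter a) (fst a)"
    have "schreier_gen u (letter a) = inv ?x"
      using False step sa by (simp add: letter_def schreier_gen_def inv_mult_group m_assoc)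
    moreover have "?x \<in> schreier_gens" using step sa by (auto simp: schreier_gens_def)
    ultimately show ?thesis by (simp add: generate.inv)
  qed
  with step show ?case
    using letter_closed[of a] by (simp add: schreier_gen_mult generate.eng)
qed

lemma generate_schreier_gens: "generate F schreier_gens = K"
proof
  show "generate F schreier_gens \<subseteq> K"
    using schreier_gens_subset by (rule generate_subgroup_incl) (rule sub.subgroup_axioms)
  show "K \<subseteq> generate F schreier_gens"
  proof
    fix x assume "x \<in> K"
    then show "x \<in> generate F schreier_gens"
      using schreier_gen_generate[of x \<one>] by (simp add: schreier_gen_def)
  qed
qed

text \<open>The Nielsen-Schreier theorem in the form of a universal property. Label each edge by the
  value prescribed for its Schreier generator. The labelling is invariant under \<open>K\<close>, so
  holonomy from \<one> is a homomorphism on \<open>K\<close>. Tree edges carry the identity, so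
  representatives have trivial holonomy, and a generator
  \<open>r u \<otimes> s \<otimes> inv (r (u \<otimes> s))\<close> receives exactly the label of its
  own edge.\<close>

lemma hom_extension:
  fixes Q :: "('q, 'c) monoid_scheme"
  assumes Q: "group Q" and q: "\<And>x. q x \<in> carrier Q" and q1: "q \<one> = \<one>\<^bsub>Q\<^esub>"
  obtains \<psi> where "\<psi> \<in> hom (F\<lparr>carrier := K\<rparr>) Q" "\<And>x. x \<in> schreier_gens \<Longrightarrow> \<psi> x = q x"
proof -
  interpret Q: group Q by fact
  define E where "E u s = q (schreier_gen u s)" for u s
  \<comment> \<open>Outside \<open>S\<close> the label is the identity, so that invariance under
    \<open>K\<close> holds for every second argument, as \<open>cocycle_translate\<close>
    demands.\<close>
  let ?T = "cocycle Q (\<lambda>u s. if s \<in> S then E u s else \<one>\<^bsub>Q\<^esub>)"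
  let ?E = "\<lambda>u s. if s \<in> S then E u s else \<one>\<^bsub>Q\<^esub>"
  have E: "?E u s \<in> carrier Q" for u s by (simp add: E_def q)
  note T = cocycle_closed[OF Q, of ?E, OF E] cocycle_mult[OF Q, of ?E, OF E]
    cocycle_letter[OF Q, of ?E, OF E] cocycle_one[OF Q, of ?E, OF E]
    cocycle_translate[OF Q, of ?E, OF E]
  have trans: "?T (k \<otimes> u) g = ?T u g" if "k \<in> K" "u \<in> carrier F" "g \<in> carrier F" for k u g
    by (rule T(5)) (use that in \<open>auto simp: E_def schreier_gen_translate\<close>)
  have transK: "?T k g = ?T \<one> g" if "k \<in> K" "g \<in> carrier F" for k g
    using trans[of k \<one> g] that by simp
  have Tlet: "?T u (letter a) = (if snd a then q (schreier_gen u (fst a))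
      else inv\<^bsub>Q\<^esub> q (schreier_gen (u \<otimes> letter a) (fst a)))" if "a \<in> letters" for u a
    using that T(3)[of a u] by (auto simp: edge_def E_def)
  have Trep: "?T \<one> (r g) = \<one>\<^bsub>Q\<^esub>" if "g \<in> carrier F" for g
    using that
  proof (induction "d g" arbitrary: g rule: less_induct)
    case less
    show ?case
    proof (cases "r g = \<one>")
      case False
      then obtain a h where ah: "a \<in> letters" "h \<in> carrier F" "d h < d g"
        "r g = r h \<otimes> letter a" "r (h \<otimes> letter a) = r g"
        using rep_step less by blast
      have la: "letter a \<in> carrier F" "fst a \<in> S" using ah by auto
      obtain k where k: "k \<in> K" "r h = k \<otimes> h" using rep_eq ah by blast
      have "?T \<one> (r g) = ?T \<one> (r h) \<otimes>\<^bsub>Q\<^esub> ?T (\<one> \<otimes> r h) (letter a)"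
        using ah la by (simp add: T(2))
      also have "\<dots> = ?T h (letter a)"
      proof -
        have "\<one> \<otimes> r h = k \<otimes> h" using ah k by simp
        then show ?thesis
          using less.hyps[OF ah(3,2)] trans[OF k(1) ah(2) la(1)] by (simp add: T(1))
      qed
      also have "\<dots> = \<one>\<^bsub>Q\<^esub>"
      proof (cases "snd a")
        case True
        then have "schreier_gen h (fst a) = \<one>"
          using ah la by (simp add: schreier_gen_def letter_def)
        then show ?thesis using True ah by (simp add: Tlet q1)
      next
        \<comment> \<open>An inverse letter traverses the tree edge from its other end, so the
          Schreier generator in question is based at \<open>h \<otimes> letter a\<close>.\<close>
        case False
        then have "r h = r g \<otimes> fst a"
          using ah la by (simp add: letter_def m_assoc)
        moreover have "h \<otimes> letter a \<otimes> fst a = h"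
          using False ah la by (simp add: letter_def m_assoc)
        ultimately have "schreier_gen (h \<otimes> letter a) (fst a) = \<one>"
          using ah la by (simp add: schreier_gen_def)
        then show ?thesis using False ah by (simp add: Tlet q1)
      qed
      finally show ?thesis .
    qed (simp add: T(4))
  qed
  show thesis
  proof
    show "?T \<one> \<in> hom (F\<lparr>carrier := K\<rparr>) Q"
    proof (rule homI)
      fix x y assume "x \<in> carrier (F\<lparr>carrier := K\<rparr>)" "y \<in> carrier (F\<lparr>carrier := K\<rparr>)"
      then show "?T \<one> (x \<otimes>\<^bsub>F\<lparr>carrier := K\<rparr>\<^esub> y) = ?T \<one> x \<otimes>\<^bsub>Q\<^esub> ?T \<one> y"
        using T(2)[of \<one> x y] transK[of x y] by simp
    qed (rule T(1))
    fix x assume "x \<in> schreier_gens"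
    then obtain u s where us: "u \<in> carrier F" "s \<in> S" "x = schreier_gen u s"
      by (auto simp: schreier_gens_def)
    then have xK: "x \<in> K" using schreier_gen_mem by auto
    have xr: "x \<otimes> r (u \<otimes> s) = r u \<otimes> s"
      using us by (simp add: schreier_gen_def m_assoc)
    have "?T \<one> (x \<otimes> r (u \<otimes> s)) = ?T \<one> x"
      using us xK Trep[of "u \<otimes> s"] transK[of x "r (u \<otimes> s)"] T(2)[of \<one> x "r (u \<otimes> s)"]
      by (simp add: T(1))
    moreover have "?T \<one> (r u \<otimes> s) = ?T u s"
    proof -
      obtain k where "k \<in> K" "r u = k \<otimes> u" using rep_eq us by blast
      then show ?thesis
        using us Trep[of u] trans[of k u s] T(2)[of \<one> "r u" s] by (simp add: T(1))
    qed
    moreover have "?T u s = q x"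
      using Tlet[of "(s, True)" u] us by (simp add: letter_def)
    ultimately show "?T \<one> x = q x" using xr by simp
  qed
qed

end

section \<open>Homomorphisms to a group of order two\<close>

locale height = group G + sub: subgroup K G for G :: "('a, 'b) monoid_scheme" (structure) and K +
  fixes e :: "'a \<Rightarrow> int"
  assumes height_mult: "x \<in> K \<Longrightarrow> y \<in> K \<Longrightarrow> e (x \<otimes> y) = e x + e y"
begin

lemma height_one [simp]: "e \<one> = 0"
  using height_mult[of \<one> \<one>] by simp

lemma height_inv: "x \<in> K \<Longrightarrow> e (inv x) = - e x"
  using height_mult[of x "inv x"] by simp

lemma int_pow_closed: "x \<in> K \<Longrightarrow> x [^] (i::int) \<in> K"
  using subgroup_int_pow_closed[OF sub.subgroup_axioms] .

lemma height_pow: "x \<in> K \<Longrightarrow> e (x [^] (i::int)) = i * e x"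
proof (induction i rule: int_induct[where k = 0])
  case (step1 i)
  then have "x [^] (i + 1) = x [^] i \<otimes> x"
    by (simp add: int_pow_mult)
  then show ?case using step1 by (simp add: height_mult int_pow_closed algebra_simps)
next
  case (step2 i)
  then have "x [^] (i - 1) = x [^] i \<otimes> inv x"
    by (simp add: int_pow_diff)
  then show ?case using step2 by (simp add: height_mult height_inv int_pow_closed algebra_simps)
qed simp

lemma kernel_subgroup: "subgroup {x \<in> K. e x = 0} G"
  by (rule subgroupI) (auto simp: height_mult height_inv intro!: exI[of _ \<one>])

lemma dvd_subgroup: "subgroup {x \<in> K. n dvd e x} G"
  by (rule subgroupI) (auto simp: height_mult height_inv intro!: exI[of _ \<one>])

lemma kernel_conj:
  "x \<in> K \<Longrightarrow> e x = 0 \<Longrightarrow> y \<in> K \<Longrightarrow> y \<otimes> x \<otimes> inv y \<in> {x \<in> K. e x = 0}"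
  by (simp add: height_mult height_inv)

text \<open>The values of \<open>e\<close> form a subgroup of the integers: the remainder of a value
  modulo the least positive one is again a value, hence zero.\<close>

lemma least_height:
  assumes "y \<in> K" "e y \<noteq> 0"
  obtains x where "x \<in> K" "e x > 0" "\<And>z. z \<in> K \<Longrightarrow> e x dvd e z"
proof -
  define P where "P n \<longleftrightarrow> n > 0 \<and> (\<exists>x\<in>K. e x = int n)" for n
  have "\<exists>x\<in>K. e x = \<bar>e y\<bar>"
    using assms height_inv[of y] by (cases "e y > 0") (auto intro: bexI[of _ "inv y"])
  then have "P (nat \<bar>e y\<bar>)" using assms by (auto simp: P_def)
  then have "P (LEAST n. P n)" by (rule LeastI)
  then obtain x where x: "x \<in> K" "e x = int (LEAST n. P n)" "e x > 0" by (auto simp: P_def)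
  have "e x dvd e z" if "z \<in> K" for z
  proof (rule ccontr)
    assume nd: "\<not> e x dvd e z"
    let ?w = "z \<otimes> x [^] (- (e z div e x))"
    have w: "?w \<in> K" "e ?w = e z mod e x"
      using that x by (auto simp: height_mult height_pow int_pow_closed minus_div_mult_eq_mod[symmetric]
          simp del: int_pow_neg)
    have "0 < e z mod e x" "e z mod e x < e x"
      using nd x(3) pos_mod_bound[of "e x" "e z"] pos_mod_sign[of "e x" "e z"]
      by (simp_all add: dvd_eq_mod_eq_0 order_less_le)
    then have "P (nat (e ?w))" using w unfolding P_def by (metis nat_0_le order_less_le zero_less_nat_eq)
    then have "(LEAST n. P n) \<le> nat (e ?w)" by (rule Least_le)
    then show False using \<open>e z mod e x < e x\<close> \<open>0 < e z mod e x\<close> w(2) x(2) by linarith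
  qed
  with x that show thesis by blast
qed

end

text \<open>This is Hom(K, Z/2), with \<open>\<noteq>\<close> as addition. The value outside
  \<open>K\<close> is fixed, so that homomorphisms agreeing on \<open>K\<close> are equal and the
  set can be finite.\<close>

definition xor_homs :: "('a, 'b) monoid_scheme \<Rightarrow> 'a set \<Rightarrow> ('a \<Rightarrow> bool) set" where
  "xor_homs G K =
     {\<theta>. (\<forall>x\<in>K. \<forall>y\<in>K. \<theta> (x \<otimes>\<^bsub>G\<^esub> y) = (\<theta> x \<noteq> \<theta> y)) \<and> (\<forall>x. x \<notin> K \<longrightarrow> \<not> \<theta> x)}"

lemma xor_homs_carrier_update [simp]: "xor_homs (G\<lparr>carrier := H\<rparr>) K = xor_homs G K"
  by (simp add: xor_homs_def)

lemma xor_homs_xor: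
  "\<theta> \<in> xor_homs G K \<Longrightarrow> \<eta> \<in> xor_homs G K \<Longrightarrow> (\<lambda>x. \<theta> x \<noteq> \<eta> x) \<in> xor_homs G K"
  by (auto simp: xor_homs_def)

lemma xor_homs_mult: "\<theta> \<in> xor_homs G K \<Longrightarrow> x \<in> K \<Longrightarrow> y \<in> K \<Longrightarrow> \<theta> (x \<otimes>\<^bsub>G\<^esub> y) = (\<theta> x \<noteq> \<theta> y)"
  by (auto simp: xor_homs_def)

lemma xor_homs_outside: "\<theta> \<in> xor_homs G K \<Longrightarrow> x \<notin> K \<Longrightarrow> \<not> \<theta> x"
  by (auto simp: xor_homs_def)

context group
begin

lemma xor_homs_one:
  assumes "subgroup K G" "\<theta> \<in> xor_homs G K"
  shows "\<not> \<theta> \<one>"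
  using xor_homs_mult[OF assms(2), of \<one> \<one>] subgroup.one_closed[OF assms(1)] by simp

lemma xor_homs_inv:
  assumes "subgroup K G" "\<theta> \<in> xor_homs G K" "x \<in> K"
  shows "\<theta> (inv x) = \<theta> x"
proof -
  interpret K: subgroup K G by fact
  show ?thesis
    using xor_homs_mult[OF assms(2), of x "inv x"] xor_homs_one[OF assms(1,2)] assms(3) by simp
qed

lemma xor_homs_kernel_subgroup:
  assumes "subgroup K G" "\<theta> \<in> xor_homs G K"
  shows "subgroup {x \<in> K. \<not> \<theta> x} G"
proof -
  interpret K: subgroup K G by fact
  show ?thesis
    by (rule subgroupI)
      (use xor_homs_one[OF assms] xor_homs_inv[OF assms] xor_homs_mult[OF assms(2)] in \<open>auto intro!: exI[of _ \<one>]\<close>)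
qed

lemma xor_homs_conj:
  assumes "subgroup K G" "\<theta> \<in> xor_homs G K" "x \<in> K" "y \<in> K"
  shows "\<theta> (y \<otimes> x \<otimes> inv y) = \<theta> x"
proof -
  interpret K: subgroup K G by fact
  show ?thesis
    using assms by (auto simp: xor_homs_mult xor_homs_inv)
qed

lemma xor_homs_eq_generate:
  assumes "subgroup K G" "\<theta> \<in> xor_homs G K" "\<eta> \<in> xor_homs G K"
    and "generate G A = K" "A \<subseteq> K" "\<And>x. x \<in> A \<Longrightarrow> \<theta> x = \<eta> x"
  shows "\<theta> = \<eta>"
proof -
  let ?\<zeta> = "\<lambda>x. \<theta> x \<noteq> \<eta> x"
  have "?\<zeta> \<in> xor_homs G K" using assms xor_homs_xor by blast
  then have "subgroup {x \<in> K. \<not> ?\<zeta> x} G" using assms xor_homs_kernel_subgroup by blast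
  then have "generate G A \<subseteq> {x \<in> K. \<not> ?\<zeta> x}"
    using assms by (intro generate_subgroup_incl) auto
  then have "\<theta> x = \<eta> x" if "x \<in> K" for x using that assms(4) by blast
  moreover have "\<theta> x = \<eta> x" if "x \<notin> K" for x using that assms(2,3) by (simp add: xor_homs_outside)
  ultimately show ?thesis by blast
qed

lemma finite_xor_homs:
  assumes "subgroup K G" "generate G A = K" "A \<subseteq> K" "finite A"
  shows "finite (xor_homs G K)"
proof (rule inj_on_finite[of "\<lambda>\<theta>. {x \<in> A. \<theta> x}" _ "Pow A"])
  show "inj_on (\<lambda>\<theta>. {x \<in> A. \<theta> x}) (xor_homs G K)"
    by (rule inj_onI) (rule xor_homs_eq_generate[OF assms(1) _ _ assms(2,3)]; blast)
qed (use assms in auto)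

end

definition xor_group :: "bool monoid" where
  "xor_group = \<lparr>carrier = UNIV, monoid.mult = (\<noteq>), one = False\<rparr>"

lemma group_xor_group: "group xor_group"
  by (rule groupI) (auto simp: xor_group_def)

context schreier
begin

text \<open>The dual basis vector of \<open>x\<close>: the indicator of \<open>x\<close> is an
  admissible prescription because \<open>x\<close> is not \<one>. Different generators have
  different dual vectors, which is how a finite dual forces finitely many generators.\<close>

lemma dual_schreier_gen:
  assumes "x \<in> schreier_gens" "x \<noteq> \<one>"
  obtains \<chi> where "\<chi> \<in> xor_homs F K" "\<And>y. y \<in> schreier_gens \<Longrightarrow> \<chi> y \<longleftrightarrow> y = x"
proof -
  obtain \<psi> where \<psi>: "\<psi> \<in> hom (F\<lparr>carrier := K\<rparr>) xor_group" "\<And>y. y \<in> schreier_gens \<Longrightarrow> \<psi> y \<longleftrightarrow> y = x"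
    using hom_extension[OF group_xor_group, of "\<lambda>y. y = x"] assms(2) by (auto simp: xor_group_def)
  have "(\<lambda>y. y \<in> K \<and> \<psi> y) \<in> xor_homs F K"
    using \<psi>(1) by (auto simp: xor_homs_def hom_def xor_group_def)
  with \<psi>(2) schreier_gens_subset that show thesis by blast
qed

lemma finite_schreier_gens:
  assumes "finite (xor_homs F K)"
  shows "finite schreier_gens"
proof -
  have "\<exists>\<chi>. \<forall>x\<in>schreier_gens - {\<one>}. \<chi> x \<in> xor_homs F K \<and> (\<forall>y\<in>schreier_gens. \<chi> x y \<longleftrightarrow> y = x)"
    by (rule bchoice) (metis DiffE dual_schreier_gen singletonI)
  then obtain \<chi> where \<chi>: "\<And>x. x \<in> schreier_gens - {\<one>} \<Longrightarrow> \<chi> x \<in> xor_homs F K"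
    "\<And>x y. x \<in> schreier_gens - {\<one>} \<Longrightarrow> y \<in> schreier_gens \<Longrightarrow> \<chi> x y \<longleftrightarrow> y = x" by blast
  have "inj_on \<chi> (schreier_gens - {\<one>})"
    by (rule inj_onI) (metis \<chi>(2) DiffE)
  then have "finite (schreier_gens - {\<one>})"
    using assms \<chi>(1) by (meson image_subsetI inj_on_finite)
  then show ?thesis by simp
qed

end

context free_basis_group
begin

lemma ex_schreier:
  assumes "subgroup K F"
  obtains r d where "schreier F S K r d"
proof -
  obtain r d where "\<And>g. g \<in> carrier F \<Longrightarrow> r g \<in> K #> g"
    "\<And>g k. g \<in> carrier F \<Longrightarrow> k \<in> K \<Longrightarrow> r (k \<otimes> g) = r g" "r \<one> = \<one>"
    "\<And>g. g \<in> carrier F \<Longrightarrow> r g = \<one> \<or>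
      (\<exists>a\<in>letters. \<exists>h\<in>carrier F. (d h :: nat) < d g \<and> r g = r h \<otimes> letter a \<and> r (h \<otimes> letter a) = r g)"
    using ex_schreier_transversal[OF assms] by metis
  then have "schreier F S K r d"
    using assms by (intro schreier.intro schreier_axioms.intro free_basis_group_axioms) blast+
  then show thesis by (rule that)
qed

lemma finitely_generated_if_finite_xor_homs:
  assumes "subgroup K F" "finite (xor_homs F K)"
  obtains A where "finite A" "A \<subseteq> K" "generate F A = K"
proof -
  obtain r d where "schreier F S K r d" using ex_schreier[OF assms(1)] by blast
  then interpret schreier F S K r d .
  show thesis
    using that[OF finite_schreier_gens[OF assms(2)] schreier_gens_subset generate_schreier_gens] .
qed

lemma nontrivial_xor_hom:
  assumes "subgroup K F" "K \<noteq> {\<one>}"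
  obtains \<chi> x where "\<chi> \<in> xor_homs F K" "x \<in> K" "\<chi> x"
proof -
  obtain r d where "schreier F S K r d" using ex_schreier[OF assms(1)] by blast
  then interpret schreier F S K r d .
  have "\<not> schreier_gens \<subseteq> {\<one>}"
  proof
    assume "schreier_gens \<subseteq> {\<one>}"
    then have "generate F schreier_gens \<subseteq> {\<one>}"
      by (rule generate_subgroup_incl) (rule triv_subgroup)
    then show False using generate_schreier_gens assms(2) sub.one_closed by auto
  qed
  then obtain x where x: "x \<in> schreier_gens" "x \<noteq> \<one>" by blast
  then obtain \<chi> where "\<chi> \<in> xor_homs F K" "\<And>y. y \<in> schreier_gens \<Longrightarrow> \<chi> y \<longleftrightarrow> y = x"
    using dual_schreier_gen by blast
  with x that schreier_gens_subset show thesis by blast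
qed

end

text \<open>The unrestricted wreath product of Z/2 by the integers. A homomorphism to Z/2 that is
  defined only on the kernel of a height with an element of height one induces a homomorphism from
  the whole group to this one.\<close>

definition shift_group :: "((int \<Rightarrow> bool) \<times> int) monoid" where
  "shift_group =
     \<lparr>carrier = UNIV,
      monoid.mult = (\<lambda>(f, m) (g, n). (\<lambda>i. f i \<noteq> g (i + m), m + n)),
      one = (\<lambda>_. False, 0)\<rparr>"

lemma group_shift_group: "group shift_group"
proof (rule groupI)
  fix x assume "x \<in> carrier shift_group"
  obtain f m where x: "x = (f, m)" by fastforce
  have "(\<lambda>i. f (i - m), - m) \<otimes>\<^bsub>shift_group\<^esub> x = \<one>\<^bsub>shift_group\<^esub>"
    by (simp add: x shift_group_def)
  then show "\<exists>y\<in>carrier shift_group. y \<otimes>\<^bsub>shift_group\<^esub> x = \<one>\<^bsub>shift_group\<^esub>"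
    by (intro bexI[of _ "(\<lambda>i. f (i - m), - m)"]) (simp_all add: shift_group_def)
qed (auto simp: shift_group_def fun_eq_iff algebra_simps split: prod.splits)

text \<open>Sum \<open>h\<close> from 0 to \<open>i\<close> modulo 2: \<open>B i\<close> collects
  the ones of \<open>h\<close> between 0 and \<open>i\<close>, on either side of 0, and their parity
  is the primitive vanishing at 0.\<close>

lemma ex_xor_primitive: "\<exists>f :: int \<Rightarrow> bool. \<forall>i. (f (i + 1) \<noteq> f i) = h i"
proof -
  define B where "B i = {j. (0 \<le> j \<and> j < i \<or> i \<le> j \<and> j < 0) \<and> h j}" for i :: int
  have fin: "finite (B i)" for i
    by (rule finite_subset[of _ "{- \<bar>i\<bar> .. \<bar>i\<bar>}"]) (auto simp: B_def)
  have "(odd (card (B (i + 1))) \<noteq> odd (card (B i))) = h i" for i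
  proof (cases "h i")
    case False
    have "j \<in> B (i + 1) \<longleftrightarrow> j \<in> B i" for j
      using False by (cases "j = i") (auto simp: B_def)
    then have "B (i + 1) = B i" by blast
    then show ?thesis using False by simp
  next
    case True
    show ?thesis
    proof (cases "i \<ge> 0")
      case nn: True
      have "B (i + 1) = insert i (B i)" "i \<notin> B i"
        using True nn by (auto simp: B_def)
      then show ?thesis using True fin by simp
    next
      case neg: False
      have "B i = insert i (B (i + 1))" "i \<notin> B (i + 1)"
        using True neg by (auto simp: B_def)
      then show ?thesis using True fin by simp
    qed
  qed
  then show ?thesis by (intro exI[of _ "\<lambda>i. odd (card (B i))"] allI)
qed

context free_basis_group
begin

text \<open>This is the vanishing of \<open>H\<^sup>2(K; Z/2)\<close> in disguise: the homomorphism to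
  \<open>shift_group\<close> induced by \<open>\<chi>\<close> lifts along the surjection that applies \<open>f \<mapsto> f (_ + 1) - f\<close>
  to the first component.\<close>

lemma conj_minus_id_surj:
  assumes "height F K e" "r \<in> K" "e r = 1" "\<chi> \<in> xor_homs F {x \<in> K. e x = 0}"
  obtains \<theta> where "\<theta> \<in> xor_homs F {x \<in> K. e x = 0}"
    "\<And>x. x \<in> K \<Longrightarrow> e x = 0 \<Longrightarrow> \<theta> (r \<otimes> x \<otimes> inv r) = (\<theta> x \<noteq> \<chi> x)"
proof -
  interpret e: height F K e by fact
  obtain t d where "schreier F S K t d" using ex_schreier[OF e.sub.subgroup_axioms] by blast
  then interpret schreier F S K t d .
  let ?L = "{x \<in> K. e x = 0}"
  have rc: "r \<in> carrier F" using assms by auto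
  \<comment> \<open>\<open>(\<delta> g, e g)\<close> is the homomorphism to
    \<open>shift_group\<close> induced by \<open>\<chi>\<close>. Coordinate \<open>i\<close> starts
    at the coset of \<open>r [^] i\<close>, multiplies by \<open>g\<close> and returns to the kernel
    by a power of \<open>r\<close>.\<close>
  define \<delta> where "\<delta> g i = \<chi> (r [^] i \<otimes> g \<otimes> r [^] (- e g - i))" for g and i :: int
  have inL: "r [^] i \<otimes> g \<otimes> r [^] (- e g - i) \<in> ?L" if "g \<in> K" for g and i :: int
    using that assms by (auto simp: e.height_mult e.height_pow e.int_pow_closed)
  have \<delta>_mult: "\<delta> (g \<otimes> h) i = (\<delta> g i \<noteq> \<delta> h (i + e g))" if "g \<in> K" "h \<in> K" for g h i
  proof -
    have "r [^] (- e g - i) \<otimes> r [^] (i + e g) = \<one>"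
      using rc by (simp flip: int_pow_mult)
    then have cancel: "r [^] (- e g - i) \<otimes> (r [^] (i + e g) \<otimes> z) = z" if "z \<in> carrier F" for z
      using rc that by (simp flip: m_assoc)
    have eq: "- e (g \<otimes> h) - i = - e h - (i + e g)"
      using that by (simp add: e.height_mult)
    have "r [^] i \<otimes> (g \<otimes> h) \<otimes> r [^] (- e (g \<otimes> h) - i)
        = (r [^] i \<otimes> g \<otimes> r [^] (- e g - i)) \<otimes> (r [^] (i + e g) \<otimes> h \<otimes> r [^] (- e h - (i + e g)))"
      unfolding eq using that rc cancel by (simp add: m_assoc)
    then show ?thesis
      unfolding \<delta>_def using xor_homs_mult[OF assms(4) inL[OF that(1), of i] inL[OF that(2), of "i + e g"]]
      by simp
  qed
  have \<delta>_one: "\<delta> \<one> i = False" for i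
    using \<delta>_mult[of \<one> \<one>] by simp
  \<comment> \<open>The lift is prescribed on generators only. Primitives are unique up to a
    constant, and at \<one> the zero function has to be taken for \<open>hom_extension\<close> to
    apply.\<close>
  have "\<exists>f. (\<forall>i. (f (i + 1) \<noteq> f i) = \<delta> x i) \<and> (x = \<one> \<longrightarrow> f = (\<lambda>_. False))" for x
  proof (cases "x = \<one>")
    case True
    then show ?thesis using \<delta>_one by auto
  next
    case False
    then show ?thesis using ex_xor_primitive[of "\<delta> x"] by simp
  qed
  then obtain f where f: "\<And>x i. (f x (i + 1) \<noteq> f x i) = \<delta> x i" "f \<one> = (\<lambda>_. False)" by metis
  obtain \<psi> where \<psi>: "\<psi> \<in> hom (F\<lparr>carrier := K\<rparr>) shift_group"
    "\<And>x. x \<in> schreier_gens \<Longrightarrow> \<psi> x = (f x, e x)"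
    using hom_extension[OF group_shift_group, of "\<lambda>x. (f x, e x)"] f(2) by (auto simp: shift_group_def)
  have \<psi>_mult: "\<psi> (x \<otimes> y) = (\<lambda>i. fst (\<psi> x) i \<noteq> fst (\<psi> y) (i + snd (\<psi> x)), snd (\<psi> x) + snd (\<psi> y))"
    if "x \<in> K" "y \<in> K" for x y
    using \<psi>(1) that by (auto simp: hom_def shift_group_def split: prod.splits)
  \<comment> \<open>\<open>good x\<close> says that \<open>\<psi>\<close> lifts the induced
    homomorphism at \<open>x\<close>. It holds on the generators by choice of \<open>f\<close> and
    passes to products and inverses.\<close>
  define good where "good x \<longleftrightarrow> snd (\<psi> x) = e x \<and> (\<forall>i. (fst (\<psi> x) (i + 1) \<noteq> fst (\<psi> x) i) = \<delta> x i)" for x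
  have good_mult: "good (x \<otimes> y)" if "x \<in> K" "y \<in> K" "good x" "good y" for x y
  proof -
    have "(fst (\<psi> (x \<otimes> y)) (i + 1) \<noteq> fst (\<psi> (x \<otimes> y)) i) = \<delta> (x \<otimes> y) i" for i
    proof -
      have "(fst (\<psi> y) (i + e x + 1) \<noteq> fst (\<psi> y) (i + e x)) = \<delta> y (i + e x)"
        using that by (auto simp: good_def)
      moreover have "i + e x + 1 = i + 1 + e x" by simp
      ultimately show ?thesis
        using that by (auto simp: good_def \<psi>_mult \<delta>_mult)
    qed
    then show ?thesis using that by (simp add: good_def \<psi>_mult e.height_mult)
  qed
  have \<psi>_one: "\<psi> \<one> = (\<lambda>_. False, 0)"
    using \<psi>_mult[of \<one> \<one>] by (cases "\<psi> \<one>") (auto simp: fun_eq_iff)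
  have good_inv: "good (inv x)" if "x \<in> K" "good x" for x
  proof -
    have s: "snd (\<psi> (inv x)) = - e x"
      using \<psi>_mult[of x "inv x"] \<psi>_one that by (auto simp: good_def)
    have a: "fst (\<psi> x) i = fst (\<psi> (inv x)) (i + e x)" for i
      using \<psi>_mult[of x "inv x"] \<psi>_one that by (auto simp: good_def fun_eq_iff)
    have b: "\<delta> x i = \<delta> (inv x) (i + e x)" for i
      using \<delta>_mult[of x "inv x" i] that \<delta>_one by auto
    have "(fst (\<psi> (inv x)) (i + 1) \<noteq> fst (\<psi> (inv x)) i) = \<delta> (inv x) i" for i
    proof -
      have "(fst (\<psi> x) (i - e x + 1) \<noteq> fst (\<psi> x) (i - e x)) = \<delta> x (i - e x)"
        using that(2) unfolding good_def by blast
      moreover have "i - e x + e x = i" "i - e x + 1 + e x = i + 1" by simp_all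
      ultimately show ?thesis
        using a[of "i - e x"] a[of "i - e x + 1"] b[of "i - e x"] by metis
    qed
    then show ?thesis using s that by (simp add: good_def e.height_inv)
  qed
  have "subgroup {x \<in> K. good x} F"
  proof (rule subgroupI)
    have "good \<one>" using \<psi>_one \<delta>_one by (simp add: good_def)
    then have "\<one> \<in> {x \<in> K. good x}" by simp
    then show "{x \<in> K. good x} \<noteq> {}" by (metis empty_iff)
  qed (use good_mult good_inv in auto)
  moreover have "schreier_gens \<subseteq> {x \<in> K. good x}"
  proof
    fix x assume x: "x \<in> schreier_gens"
    have "good x" unfolding good_def \<psi>(2)[OF x] fst_conv snd_conv using f(1) by blast
    then show "x \<in> {x \<in> K. good x}" using x schreier_gens_subset by blast
  qed
  ultimately have "generate F schreier_gens \<subseteq> {x \<in> K. good x}"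
    by (intro generate_subgroup_incl)
  then have good: "good x" if "x \<in> K" for x using that generate_schreier_gens by blast
  \<comment> \<open>Coordinate 0 of the lift. Conjugating \<open>x\<close> by \<open>r\<close>
    replaces coordinate 0 by coordinate 1, and these differ by \<open>\<delta> x 0\<close>, which is
    \<open>\<chi> x\<close>.\<close>
  define \<theta> where "\<theta> x \<longleftrightarrow> x \<in> ?L \<and> fst (\<psi> x) 0" for x
  show thesis
  proof (rule that)
    show "\<theta> \<in> xor_homs F ?L"
    proof -
      have "\<theta> (x \<otimes> y) = (\<theta> x \<noteq> \<theta> y)" if "x \<in> ?L" "y \<in> ?L" for x y
        using good[of x] that by (simp add: \<theta>_def \<psi>_mult good_def e.height_mult)
      moreover have "\<not> \<theta> x" if "x \<notin> ?L" for x
        using that by (simp only: \<theta>_def) blast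
      ultimately show ?thesis unfolding xor_homs_def by blast
    qed
    fix x assume x: "x \<in> K" "e x = 0"
    let ?y = "r \<otimes> x \<otimes> inv r"
    have y: "?y \<in> ?L" using e.kernel_conj[OF x assms(2)] .
    have "?y \<otimes> r = r \<otimes> x" using rc x by (simp add: m_assoc)
    then have "fst (\<psi> (?y \<otimes> r)) 0 = fst (\<psi> (r \<otimes> x)) 0" by simp
    then have "fst (\<psi> ?y) 0 = fst (\<psi> x) 1"
      using good[of r] good[of ?y] y x assms by (auto simp: \<psi>_mult good_def)
    moreover have "(fst (\<psi> x) 1 \<noteq> fst (\<psi> x) 0) = \<chi> x"
    proof -
      have "\<delta> x 0 = \<chi> x" using x by (simp add: \<delta>_def)
      moreover have "(fst (\<psi> x) (0 + 1) \<noteq> fst (\<psi> x) 0) = \<delta> x 0"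
        using good[OF x(1)] unfolding good_def by blast
      ultimately show ?thesis by simp
    qed
    ultimately show "\<theta> ?y = (\<theta> x \<noteq> \<chi> x)" using x y by (auto simp: \<theta>_def)
  qed
qed

end

text \<open>Used to show that a free-by-cyclic subgroup cannot lie in the free fibre: its own fibre
  would be such a kernel, and it is nontrivial.\<close>

lemma (in free_basis_group) fg_kernel_trivial:
  assumes "height F K e" "r \<in> K" "e r = 1"
    and A: "finite A" "A \<subseteq> {x \<in> K. e x = 0}" "generate F A = {x \<in> K. e x = 0}"
  shows "{x \<in> K. e x = 0} = {\<one>}"
proof (rule ccontr)
  interpret e: height F K e by fact
  let ?L = "{x \<in> K. e x = 0}"
  let ?X = "xor_homs F ?L"
  assume nontriv: "?L \<noteq> {\<one>}"
  obtain \<chi> z where \<chi>: "\<chi> \<in> ?X" "z \<in> ?L" "\<chi> z"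
    by (rule nontrivial_xor_hom[OF e.kernel_subgroup nontriv])
  have rc: "r \<in> carrier F" using assms by auto
  have fin: "finite ?X"
    using finite_xor_homs[OF e.kernel_subgroup A(3,2,1)] .
  have conj_in: "r [^] (i::int) \<otimes> x \<otimes> inv (r [^] i) \<in> ?L" if "x \<in> ?L" for x i
    using that e.kernel_conj[of x "r [^] i"] e.int_pow_closed[OF assms(2)] by simp
  define c where "c i \<theta> = (\<lambda>x. x \<in> ?L \<and> \<theta> (r [^] i \<otimes> x \<otimes> inv (r [^] i)))" for i :: int and \<theta>
  have c_closed: "c i \<theta> \<in> ?X" if "\<theta> \<in> ?X" for i \<theta>
  proof -
    have "c i \<theta> (x \<otimes> y) = (c i \<theta> x \<noteq> c i \<theta> y)" if "x \<in> ?L" "y \<in> ?L" for x y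
    proof -
      let ?r = "r [^] i"
      have "?r \<otimes> (x \<otimes> y) \<otimes> inv ?r = (?r \<otimes> x \<otimes> inv ?r) \<otimes> (?r \<otimes> y \<otimes> inv ?r)"
        using rc that by (simp add: m_assoc inv_mult_cancel)
      then show ?thesis
        using xor_homs_mult[OF \<open>\<theta> \<in> ?X\<close> conj_in[OF that(1), of i] conj_in[OF that(2), of i]] that
        by (simp add: c_def e.height_mult)
    qed
    moreover have "\<not> c i \<theta> x" if "x \<notin> ?L" for x
      using that by (simp only: c_def) blast
    ultimately show ?thesis unfolding xor_homs_def by blast
  qed
  \<comment> \<open>The powers of \<open>r\<close> act by self-maps of the finite set
    \<open>?X\<close>, so two different powers act alike.\<close>
  have "range (\<lambda>n. restrict (c (int n)) ?X) \<subseteq> ?X \<rightarrow>\<^sub>E ?X"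
    using c_closed by auto
  then have "finite (range (\<lambda>n. restrict (c (int n)) ?X))"
    using fin by (meson finite_PiE finite_subset)
  then have "\<not> inj (\<lambda>n. restrict (c (int n)) ?X)"
    by (meson finite_imageD infinite_UNIV_nat)
  then obtain m' n' where "m' \<noteq> n'" "restrict (c (int m')) ?X = restrict (c (int n')) ?X"
    unfolding inj_on_def by blast
  then obtain m n :: nat where mn: "m < n" "restrict (c (int m)) ?X = restrict (c (int n)) ?X"
    by (cases m' n' rule: linorder_cases) simp_all
  define j where "j = int n - int m"
  have j: "j > 0" using mn by (simp add: j_def)
  have period: "\<theta> (r [^] j \<otimes> x \<otimes> inv (r [^] j)) = \<theta> x" if "\<theta> \<in> ?X" "x \<in> ?L" for \<theta> x
  proof -
    let ?y = "r [^] (- int m) \<otimes> x \<otimes> inv (r [^] (- int m))"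
    have conj_conj: "r [^] a \<otimes> ?y \<otimes> inv (r [^] a) = r [^] (a - int m) \<otimes> x \<otimes> inv (r [^] (a - int m))" for a :: int
    proof -
      have "r [^] (a - int m) = r [^] a \<otimes> r [^] (- int m)"
        using rc by (simp flip: int_pow_mult)
      then show ?thesis using rc that by (simp add: inv_mult_group m_assoc del: int_pow_neg_int)
    qed
    have "c (int m) \<theta> ?y = c (int n) \<theta> ?y"
      using fun_cong[OF mn(2), of \<theta>] that(1) by simp
    moreover have "?y \<in> ?L" by (rule conj_in[OF that(2)])
    ultimately have "\<theta> (r [^] int m \<otimes> ?y \<otimes> inv (r [^] int m)) = \<theta> (r [^] int n \<otimes> ?y \<otimes> inv (r [^] int n))"
      unfolding c_def by blast
    then show ?thesis
      unfolding conj_conj j_def using that by simp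
  qed
  \<comment> \<open>\<open>conj_minus_id_surj\<close> asks for an element of height one. On the
    elements whose height is divisible by \<open>j\<close>, with heights divided by
    \<open>j\<close>, the power \<open>r [^] j\<close> is such an element and the kernel is
    unchanged.\<close>
  let ?K = "{x \<in> K. j dvd e x}"
  have K': "height F ?K (\<lambda>x. e x div j)"
  proof (rule height.intro[OF is_group e.dvd_subgroup], unfold_locales)
    fix x y assume "x \<in> ?K" "y \<in> ?K"
    then show "e (x \<otimes> y) div j = e x div j + e y div j"
      by (simp add: e.height_mult div_plus_div_distrib_dvd_left)
  qed
  have L': "{x \<in> ?K. e x div j = 0} = ?L"
    using j by auto
  have "r [^] j \<in> ?K" "e (r [^] j) div j = 1"
    using assms j by (auto simp: e.height_pow e.int_pow_closed)
  moreover have "\<chi> \<in> xor_homs F {x \<in> ?K. e x div j = 0}" unfolding L' by (rule \<chi>(1))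
  ultimately obtain \<theta> where \<theta>: "\<theta> \<in> xor_homs F {x \<in> ?K. e x div j = 0}"
    "\<And>x. x \<in> ?K \<Longrightarrow> e x div j = 0 \<Longrightarrow> \<theta> (r [^] j \<otimes> x \<otimes> inv (r [^] j)) = (\<theta> x \<noteq> \<chi> x)"
    using conj_minus_id_surj[OF K'] by blast
  have "\<theta> (r [^] j \<otimes> z \<otimes> inv (r [^] j)) = (\<theta> z \<noteq> \<chi> z)"
    using \<chi>(2) by (intro \<theta>(2)) auto
  moreover have "\<theta> (r [^] j \<otimes> z \<otimes> inv (r [^] j)) = \<theta> z"
    using \<theta>(1) unfolding L' by (rule period) (rule \<chi>(2))
  ultimately show False using \<chi>(3) by simp
qed

text \<open>Linear algebra over Z/2 by counting. Patterns of kernel elements on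
  \<open>W (n + c)\<close> and patterns of arbitrary elements on \<open>W n\<close> combine
  injectively to patterns on \<open>W (n + c)\<close>, and of these there are at most
  \<open>2 ^ m\<close> times as many as on \<open>W n\<close>. Cancelling leaves at most
  \<open>2 ^ m\<close> kernel patterns on each \<open>W (n + c)\<close>, uniformly in
  \<open>n\<close>.\<close>

lemma finite_kernel_of_local_surj:
  fixes W :: "nat \<Rightarrow> 'x set" and \<Theta> :: "('x \<Rightarrow> bool) set"
  assumes W: "\<And>n. finite (W n)" "\<And>n m. n \<le> m \<Longrightarrow> W n \<subseteq> W m" "\<And>n. card (W (n + c) - W n) \<le> m"
    and xor: "\<And>\<theta> \<eta>. \<theta> \<in> \<Theta> \<Longrightarrow> \<eta> \<in> \<Theta> \<Longrightarrow> (\<lambda>x. \<theta> x \<noteq> \<eta> x) \<in> \<Theta>"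
    and D_xor: "\<And>\<theta> \<eta> x. \<theta> \<in> \<Theta> \<Longrightarrow> \<eta> \<in> \<Theta> \<Longrightarrow> D (\<lambda>x. \<theta> x \<noteq> \<eta> x) x = (D \<theta> x \<noteq> D \<eta> x)"
    and surj: "\<And>\<chi>. \<chi> \<in> \<Theta> \<Longrightarrow> \<exists>\<theta>\<in>\<Theta>. D \<theta> = \<chi>"
    and loc: "\<And>\<theta> n x. \<theta> \<in> \<Theta> \<Longrightarrow> (\<And>y. y \<in> W (n + c) \<Longrightarrow> \<not> \<theta> y) \<Longrightarrow> x \<in> W n \<Longrightarrow> \<not> D \<theta> x"
    and sep: "\<And>\<theta>. \<theta> \<in> \<Theta> \<Longrightarrow> (\<And>n x. x \<in> W n \<Longrightarrow> \<not> \<theta> x) \<Longrightarrow> \<theta> = (\<lambda>_. False)"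
  shows "finite {\<theta> \<in> \<Theta>. \<forall>x. \<not> D \<theta> x}"
proof -
  let ?I = "{\<theta> \<in> \<Theta>. \<forall>x. \<not> D \<theta> x}"
  define \<rho> where "\<rho> n \<theta> = {x \<in> W n. \<theta> x}" for n and \<theta> :: "'x \<Rightarrow> bool"
  have \<rho>_sub: "\<rho> n \<theta> \<subseteq> W n" for n \<theta> by (auto simp: \<rho>_def)
  have fin: "finite (\<rho> n ` T)" for n T
    using finite_subset[of "\<rho> n ` T" "Pow (W n)"] W(1) \<rho>_sub by blast
  have bound: "card (\<rho> (n + c) ` ?I) \<le> 2 ^ m" for n
  proof -
    have "\<exists>\<theta>. \<theta> \<in> \<Theta> \<and> \<rho> n (D \<theta>) = v" if v: "v \<in> \<rho> n ` \<Theta>" for v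
    proof -
      obtain \<chi> where "\<chi> \<in> \<Theta>" "v = \<rho> n \<chi>" using v by blast
      with surj[of \<chi>] show ?thesis by blast
    qed
    then obtain l where l: "\<And>v. v \<in> \<rho> n ` \<Theta> \<Longrightarrow> l v \<in> \<Theta>" "\<And>v. v \<in> \<rho> n ` \<Theta> \<Longrightarrow> \<rho> n (D (l v)) = v"
      by metis
    define k where "k = inv_into ?I (\<rho> (n + c))"
    have k: "k u \<in> ?I" "\<rho> (n + c) (k u) = u" if "u \<in> \<rho> (n + c) ` ?I" for u
      unfolding k_def by (rule inv_into_into[OF that], rule f_inv_into_f[OF that])
    let ?s = "\<lambda>(u, v). \<lambda>x. k u x \<noteq> l v x"
    let ?A = "\<rho> (n + c) ` ?I \<times> \<rho> n ` \<Theta>"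
    have s: "?s p \<in> \<Theta>" if "p \<in> ?A" for p
      using that xor[of "k (fst p)" "l (snd p)"] k(1)[of "fst p"] l(1)[of "snd p"]
      by (cases p) simp
    \<comment> \<open>\<open>k u\<close> is a kernel element with pattern \<open>u\<close>, and
      \<open>D (l v)\<close> has pattern \<open>v\<close> on \<open>W n\<close>. From the sum of
      \<open>k u\<close> and \<open>l v\<close> on \<open>W (n + c)\<close>, locality of
      \<open>D\<close> recovers \<open>v\<close>; subtracting \<open>l v\<close> then recovers
      \<open>u\<close>.\<close>
    have "inj_on (\<lambda>p. \<rho> (n + c) (?s p)) ?A"
    proof (rule inj_onI)
      fix P P' assume P: "P \<in> ?A" "P' \<in> ?A" and eqP: "\<rho> (n + c) (?s P) = \<rho> (n + c) (?s P')"
      obtain u v u' v' where PP: "P = (u, v)" "P' = (u', v')" by (metis surj_pair)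
      have p: "u \<in> \<rho> (n + c) ` ?I" "v \<in> \<rho> n ` \<Theta>" "u' \<in> \<rho> (n + c) ` ?I" "v' \<in> \<rho> n ` \<Theta>"
        using P unfolding PP mem_Sigma_iff by blast+
      have eq: "\<rho> (n + c) (\<lambda>x. k u x \<noteq> l v x) = \<rho> (n + c) (\<lambda>x. k u' x \<noteq> l v' x)"
        using eqP by (simp add: PP)
      note mem = k(1)[OF p(1)] l(1)[OF p(2)] k(1)[OF p(3)] l(1)[OF p(4)]
      let ?a = "\<lambda>x. k u x \<noteq> l v x" and ?b = "\<lambda>x. k u' x \<noteq> l v' x"
      have ab: "?a \<in> \<Theta>" "?b \<in> \<Theta>"
        using mem xor[of "k u" "l v"] xor[of "k u'" "l v'"] by simp_all
      have ag: "?a x = ?b x" if "x \<in> W (n + c)" for x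
        using eq that unfolding \<rho>_def set_eq_iff mem_Collect_eq by metis
      have "\<not> D (\<lambda>x. ?a x \<noteq> ?b x) x" if "x \<in> W n" for x
        using loc[OF xor[OF ab] _ that] ag by blast
      then have "D ?a x = D ?b x" if "x \<in> W n" for x
        using D_xor[OF ab, of x] that by blast
      moreover have "D ?a x = D (l v) x" "D ?b x = D (l v') x" for x
        using D_xor[of "k u" "l v" x] D_xor[of "k u'" "l v'" x] mem by simp_all
      ultimately have "\<rho> n (D (l v)) = \<rho> n (D (l v'))"
        unfolding \<rho>_def by blast
      then have v: "v = v'" using l(2) p by metis
      then have "\<rho> (n + c) (k u) = \<rho> (n + c) (k u')"
        using ag unfolding \<rho>_def by blast
      then have "u = u'" using k(2) p by metis
      with v show "P = P'" by (simp add: PP)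
    qed
    moreover have "(\<lambda>p. \<rho> (n + c) (?s p)) ` ?A \<subseteq> \<rho> (n + c) ` \<Theta>"
      using s by blast
    ultimately have "card ?A \<le> card (\<rho> (n + c) ` \<Theta>)"
      using fin card_inj_on_le by blast
    moreover have "card (\<rho> (n + c) ` \<Theta>) \<le> card (\<rho> n ` \<Theta> \<times> Pow (W (n + c) - W n))"
    proof (rule card_inj_on_le[of "\<lambda>v. (v \<inter> W n, v - W n)"])
      show "inj_on (\<lambda>v. (v \<inter> W n, v - W n)) (\<rho> (n + c) ` \<Theta>)"
        by (rule inj_onI) (metis Int_Diff_Un prod.inject)
      have "\<rho> (n + c) \<theta> \<inter> W n = \<rho> n \<theta>" for \<theta>
        using W(2)[of n "n + c"] by (auto simp: \<rho>_def)
      then show "(\<lambda>v. (v \<inter> W n, v - W n)) ` (\<rho> (n + c) ` \<Theta>) \<subseteq> \<rho> n ` \<Theta> \<times> Pow (W (n + c) - W n)"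
        using \<rho>_sub[of "n + c"] by (auto simp: subset_iff)
      show "finite (\<rho> n ` \<Theta> \<times> Pow (W (n + c) - W n))"
        using fin W(1) by (intro finite_cartesian_product) auto
    qed
    moreover have "card (Pow (W (n + c) - W n)) \<le> 2 ^ m"
      using W(1,3) by (simp add: card_Pow)
    ultimately have "card (\<rho> (n + c) ` ?I) * card (\<rho> n ` \<Theta>) \<le> card (\<rho> n ` \<Theta>) * 2 ^ m"
      unfolding card_cartesian_product by (meson le_trans mult_le_mono2)
    then have le: "card (\<rho> n ` \<Theta>) * card (\<rho> (n + c) ` ?I) \<le> card (\<rho> n ` \<Theta>) * 2 ^ m"
      by (simp add: mult.commute)
    show ?thesis
    proof (cases "\<Theta> = {}")
      case False
      then have "card (\<rho> n ` \<Theta>) > 0" using fin by (simp add: card_gt_0_iff)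
      then show ?thesis using le by simp
    qed simp
  qed
  \<comment> \<open>The windows separate elements, so finitely many kernel elements are already
    distinguished on one large window, where the uniform bound applies.\<close>
  have "card J \<le> 2 ^ m" if J: "finite J" "J \<subseteq> ?I" for J
  proof -
    have "\<exists>n. \<exists>x\<in>W n. \<theta> x \<noteq> \<eta> x" if "\<theta> \<in> J" "\<eta> \<in> J" "\<theta> \<noteq> \<eta>" for \<theta> \<eta>
    proof (rule ccontr)
      assume "\<not> ?thesis"
      then have "(\<lambda>x. \<theta> x \<noteq> \<eta> x) = (\<lambda>_. False)"
        using that J(2) by (intro sep xor) auto
      then show False using that(3) by (auto simp: fun_eq_iff)
    qed
    then obtain N where N: "\<And>\<theta> \<eta>. \<theta> \<in> J \<Longrightarrow> \<eta> \<in> J \<Longrightarrow> \<theta> \<noteq> \<eta> \<Longrightarrow> \<exists>x\<in>W (N \<theta> \<eta>). \<theta> x \<noteq> \<eta> x"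
      by metis
    define n where "n = Max (case_prod N ` (J \<times> J))"
    have n: "N \<theta> \<eta> \<le> n" if "\<theta> \<in> J" "\<eta> \<in> J" for \<theta> \<eta>
      unfolding n_def using that J(1) by (intro Max_ge) force+
    have "inj_on (\<rho> (n + c)) J"
    proof (rule inj_onI, rule ccontr)
      fix \<theta> \<eta> assume a: "\<theta> \<in> J" "\<eta> \<in> J" "\<rho> (n + c) \<theta> = \<rho> (n + c) \<eta>" "\<theta> \<noteq> \<eta>"
      then obtain x where x: "x \<in> W (N \<theta> \<eta>)" "\<theta> x \<noteq> \<eta> x" using N by blast
      then have "x \<in> W (n + c)" using W(2) n[OF a(1,2)] by (meson subsetD trans_le_add1)
      then show False using a(3) x(2) unfolding \<rho>_def by blast
    qed
    then have "card J = card (\<rho> (n + c) ` J)" by (simp add: card_image)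
    also have "\<dots> \<le> card (\<rho> (n + c) ` ?I)"
      using J(2) fin by (intro card_mono image_mono)
    finally show ?thesis using bound le_trans by blast
  qed
  then show ?thesis
    by (metis (no_types, lifting) Suc_n_not_le_n infinite_arbitrarily_large)
qed

lemma (in group) generate_UN_chain:
  assumes "\<And>n m. n \<le> m \<Longrightarrow> W n \<subseteq> W m" "x \<in> generate G (\<Union>n::nat. W n)"
  shows "\<exists>n. x \<in> generate G (W n)"
  using assms(2)
proof induction
  case one
  show ?case by (rule exI, rule generate.one)
next
  case (incl h)
  then obtain n where "h \<in> W n" by blast
  then show ?case by (intro exI generate.incl)
next
  case (inv h)
  then obtain n where "h \<in> W n" by blast
  then show ?case by (intro exI generate.inv)
next
  case (eng g h)
  then obtain n m where "g \<in> generate G (W n)" "h \<in> generate G (W m)" by blast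
  then have "g \<in> generate G (W (max n m))" "h \<in> generate G (W (max n m))"
    using mono_generate[OF assms(1), of n "max n m"] mono_generate[OF assms(1), of m "max n m"]
    by auto
  then show ?case by (intro exI generate.eng)
qed

section \<open>Two characters: finiteness of Hom(Kp, Z/2) when Kq is finitely generated\<close>

locale two_heights = p: height G "carrier G" p + q: height G "carrier G" q
  for G :: "('a, 'b) monoid_scheme" (structure) and p q
begin

abbreviation "Kp \<equiv> {x \<in> carrier G. p x = 0}"
abbreviation "Kq \<equiv> {x \<in> carrier G. q x = 0}"
abbreviation "Kpq \<equiv> {x \<in> carrier G. p x = 0 \<and> q x = 0}"

lemmas heights = p.height_mult q.height_mult p.height_inv q.height_inv p.height_pow q.height_pow

lemma Kpq_subgroup: "subgroup Kpq G"
proof -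
  have "Kpq = Kp \<inter> Kq" by blast
  then show ?thesis using p.subgroups_Inter_pair[OF p.kernel_subgroup q.kernel_subgroup] by simp
qed

text \<open>The windows of generators of \<open>Kpq\<close> are translated by \<open>s\<close> and
  grow by a bounded number of elements, while conjugation by \<open>r\<close> enlarges them by a
  bounded amount, so \<open>finite_kernel_of_local_surj\<close> applies to r - 1. A homomorphism on
  \<open>Kp\<close> is determined by its restriction to \<open>Kpq\<close>, which lies in the kernel
  of r - 1, and by its value at \<open>r\<close>.\<close>

lemma finite_xor_homs_Kp:
  assumes A: "finite A" "A \<subseteq> Kq" "generate G A = Kq"
    and s: "s \<in> Kq" "p s > 0" "\<And>x. x \<in> Kq \<Longrightarrow> p s dvd p x"
    and r: "r \<in> Kp" "q r > 0" "\<And>x. x \<in> Kp \<Longrightarrow> q r dvd q x"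
    and lift: "\<And>\<chi>. \<chi> \<in> xor_homs G Kpq \<Longrightarrow>
      \<exists>\<theta>\<in>xor_homs G Kpq. \<forall>x\<in>Kpq. \<theta> (r \<otimes> x \<otimes> inv r) = (\<theta> x \<noteq> \<chi> x)"
  shows "finite (xor_homs G Kp)"
proof -
  let ?L = Kpq
  have sc [simp]: "s \<in> carrier G" and rc [simp]: "r \<in> carrier G" and s0: "q s = 0" and r0: "p r = 0"
    using s r by auto
  define k where "k = p s"
  have k: "k > 0" "\<And>x. x \<in> Kq \<Longrightarrow> k * (p x div k) = p x"
    using s(2,3) by (auto simp: k_def)
  \<comment> \<open>The Schreier generators of \<open>Kpq\<close> in \<open>Kq\<close> for the
    transversal of powers of \<open>s\<close>: start at \<open>s [^] i\<close>, multiply by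
    \<open>a\<close>, and return to height 0. \<open>b_mult\<close> and \<open>b_inv\<close> are the
    rewriting rules.\<close>
  define b where "b i a = s [^] i \<otimes> a \<otimes> s [^] (- (p a div k) - i)" for i :: int and a
  have b_mult: "b i (x \<otimes> y) = b i x \<otimes> b (p x div k + i) y" if "x \<in> Kq" "y \<in> Kq" for i x y
  proof -
    have e: "p (x \<otimes> y) div k = p x div k + p y div k"
      using that s(3) by (simp add: heights k_def div_plus_div_distrib_dvd_left)
    have c: "s [^] (- (p x div k) - i) \<otimes> (s [^] (p x div k + i) \<otimes> z) = z" if "z \<in> carrier G" for z
      using that by (simp add: p.m_assoc[symmetric] flip: p.int_pow_mult)
    have "- (p x div k + p y div k) - i = - (p y div k) - (p x div k + i)" by simp
    then show ?thesis unfolding b_def e using that c by (simp only: mem_Collect_eq) (simp add: p.m_assoc)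
  qed
  have b_inv: "b i (inv x) = inv (b (i - p x div k) x)" if "x \<in> Kq" for i x
  proof -
    have e: "- (p (inv x) div k) = p x div k"
      using that s(3) by (simp add: heights k_def dvd_neg_div)
    have "inv (s [^] (i - p x div k) \<otimes> x \<otimes> s [^] (- i)) = s [^] i \<otimes> inv x \<otimes> s [^] (p x div k - i)"
      using that by (simp add: p.inv_mult_group p.m_assoc p.int_pow_neg flip: p.int_pow_neg)
    then show ?thesis unfolding b_def e by simp
  qed
  have b_L: "b i x \<in> ?L" if "x \<in> Kq" for i x
    using that k(2)[OF that] s0 by (auto simp: b_def heights k_def[symmetric] algebra_simps)
  have b_shift: "s [^] i \<otimes> b l x \<otimes> inv (s [^] i) = b (i + l) x" if "x \<in> Kq" for i l x
  proof -
    have "s [^] (- (p x div k) - (i + l)) = s [^] (- (p x div k) - l) \<otimes> inv (s [^] i)"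
    proof -
      have "- (p x div k) - (i + l) = - (p x div k) - l + - i" by simp
      then show ?thesis by (simp only: p.int_pow_mult[OF sc] p.int_pow_neg[OF sc])
    qed
    moreover have "s [^] (i + l) = s [^] i \<otimes> s [^] l" by (simp add: p.int_pow_mult)
    ultimately show ?thesis using that by (simp add: b_def p.m_assoc)
  qed
  \<comment> \<open>Conjugation by \<open>s\<close> shifts the index \<open>i\<close>, so passing
    from \<open>n\<close> to \<open>n + c\<close> adds at most \<open>2 * c * card A\<close>
    elements, whatever \<open>n\<close> is.\<close>
  define W where "W n = (\<lambda>(i, a). b i a) ` ({- int n..int n} \<times> A)" for n
  have W_mono: "W n \<subseteq> W m" if "n \<le> m" for n m
    unfolding W_def using that by (intro image_mono Sigma_mono) auto
  have W_L: "W n \<subseteq> ?L" for n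
    using b_L A(2) by (auto simp: W_def)
  have W_fin: "finite (W n)" for n
    using A(1) by (simp add: W_def)
  have W_card: "card (W (n + c) - W n) \<le> 2 * c * card A" for n c
  proof -
    let ?I = "{- int (n + c)..int (n + c)} - {- int n..int n}"
    have "W (n + c) - W n \<subseteq> (\<lambda>(i, a). b i a) ` (?I \<times> A)"
      by (auto simp: W_def)
    then have "card (W (n + c) - W n) \<le> card (?I \<times> A)"
      using A(1) by (meson card_image_le card_mono finite_Diff finite_SigmaI finite_atLeastAtMost_int
          finite_imageI le_trans)
    also have "card ?I = 2 * c"
      by (subst card_Diff_subset) auto
    then have "card (?I \<times> A) = 2 * c * card A" by (simp add: card_cartesian_product)
    finally show ?thesis .
  qed
  let ?M = "generate G (\<Union>n. W n)"
  have W_car: "(\<Union>n. W n) \<subseteq> carrier G" using W_L by blast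
  then have M_sub: "subgroup ?M G" by (rule p.generate_is_subgroup)
  have "subgroup {x \<in> Kq. \<forall>i. b i x \<in> ?M} G"
  proof (rule p.subgroupI)
    have "b i \<one> = \<one>" for i using b_mult[of \<one> \<one> i] b_L[of \<one> i]
      by (simp add: b_def p.int_pow_mult[symmetric])
    then have "\<one> \<in> {x \<in> Kq. \<forall>i. b i x \<in> ?M}" by (simp add: generate.one)
    then show "{x \<in> Kq. \<forall>i. b i x \<in> ?M} \<noteq> {}" by (metis empty_iff)
  next
    fix x assume "x \<in> {x \<in> Kq. \<forall>i. b i x \<in> ?M}"
    then show "inv x \<in> {x \<in> Kq. \<forall>i. b i x \<in> ?M}"
      using b_inv[of x] subgroup.m_inv_closed[OF M_sub] by (simp add: heights)
  next
    fix x y assume "x \<in> {x \<in> Kq. \<forall>i. b i x \<in> ?M}" "y \<in> {x \<in> Kq. \<forall>i. b i x \<in> ?M}"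
    then show "x \<otimes> y \<in> {x \<in> Kq. \<forall>i. b i x \<in> ?M}"
      using b_mult[of x y] subgroup.m_closed[OF M_sub] by (simp add: heights)
  qed auto
  moreover have "b i a \<in> ?M" if "a \<in> A" for i a
  proof -
    have "b i a \<in> W (nat \<bar>i\<bar>)" using that by (force simp: W_def)
    then show ?thesis by (intro generate.incl) blast
  qed
  then have "A \<subseteq> {x \<in> Kq. \<forall>i. b i x \<in> ?M}" using A(2) by blast
  ultimately have "Kq \<subseteq> {x \<in> Kq. \<forall>i. b i x \<in> ?M}"
    unfolding A(3)[symmetric] by (intro p.generate_subgroup_incl)
  then have bM: "b 0 x \<in> ?M" if "x \<in> Kq" for x using that by blast
  have L_M: "?L = ?M"
  proof
    show "?M \<subseteq> ?L" using W_L by (intro p.generate_subgroup_incl Kpq_subgroup) blast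
    show "?L \<subseteq> ?M"
    proof
      fix x assume "x \<in> ?L"
      then show "x \<in> ?M" using bM[of x] by (simp add: b_def)
    qed
  qed
  have conj_r: "r \<otimes> x \<otimes> inv r \<in> ?L" if "x \<in> ?L" for x
    using that by (simp add: heights)
  have "\<exists>n. r \<otimes> b 0 a \<otimes> inv r \<in> generate G (W n)" if "a \<in> A" for a
  proof (rule p.generate_UN_chain[OF W_mono])
    have "a \<in> Kq" using that A(2) by blast
    then show "r \<otimes> b 0 a \<otimes> inv r \<in> ?M" unfolding L_M[symmetric] by (intro conj_r b_L)
  qed
  then obtain N where N: "\<And>a. a \<in> A \<Longrightarrow> r \<otimes> b 0 a \<otimes> inv r \<in> generate G (W (N a))" by metis
  \<comment> \<open>Since \<open>A\<close> is finite, one window captures the conjugates by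
    \<open>r\<close> of all generators with index 0; the other indices follow by shifting with
    \<open>s\<close>.\<close>
  define c where "c = Max (insert 0 (N ` A))"
  have c: "r \<otimes> b 0 a \<otimes> inv r \<in> generate G (W c)" if "a \<in> A" for a
  proof -
    have "N a \<le> c" using that A(1) by (simp add: c_def)
    then show ?thesis using N[OF that] p.mono_generate[OF W_mono] by blast
  qed
  have shift: "s [^] i \<otimes> x \<otimes> inv (s [^] i) \<in> generate G (W (n + c))"
    if "x \<in> generate G (W c)" "\<bar>i\<bar> \<le> int n" for x i n
  proof -
    let ?T = "generate G (W (n + c))"
    have T: "subgroup ?T G" using W_car by (intro p.generate_is_subgroup) blast
    have "subgroup {x \<in> carrier G. s [^] i \<otimes> x \<otimes> inv (s [^] i) \<in> ?T} G"
    proof (rule p.subgroupI)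
      have "\<one> \<in> {x \<in> carrier G. s [^] i \<otimes> x \<otimes> inv (s [^] i) \<in> ?T}" by (simp add: generate.one)
      then show "{x \<in> carrier G. s [^] i \<otimes> x \<otimes> inv (s [^] i) \<in> ?T} \<noteq> {}" by (metis empty_iff)
    next
      fix x assume x: "x \<in> {x \<in> carrier G. s [^] i \<otimes> x \<otimes> inv (s [^] i) \<in> ?T}"
      then have "s [^] i \<otimes> inv x \<otimes> inv (s [^] i) = inv (s [^] i \<otimes> x \<otimes> inv (s [^] i))"
        by (simp add: p.inv_mult_group p.m_assoc)
      then show "inv x \<in> {x \<in> carrier G. s [^] i \<otimes> x \<otimes> inv (s [^] i) \<in> ?T}"
        using x subgroup.m_inv_closed[OF T] by simp
    next
      fix x y assume xy: "x \<in> {x \<in> carrier G. s [^] i \<otimes> x \<otimes> inv (s [^] i) \<in> ?T}"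
        "y \<in> {x \<in> carrier G. s [^] i \<otimes> x \<otimes> inv (s [^] i) \<in> ?T}"
      then have "s [^] i \<otimes> (x \<otimes> y) \<otimes> inv (s [^] i)
          = (s [^] i \<otimes> x \<otimes> inv (s [^] i)) \<otimes> (s [^] i \<otimes> y \<otimes> inv (s [^] i))"
        by (simp add: p.m_assoc p.inv_mult_cancel)
      then show "x \<otimes> y \<in> {x \<in> carrier G. s [^] i \<otimes> x \<otimes> inv (s [^] i) \<in> ?T}"
        using xy subgroup.m_closed[OF T] by simp
    qed auto
    moreover have "W c \<subseteq> {x \<in> carrier G. s [^] i \<otimes> x \<otimes> inv (s [^] i) \<in> ?T}"
    proof
      fix w assume w: "w \<in> W c"
      then obtain l a where la: "w = b l a" "\<bar>l\<bar> \<le> int c" "a \<in> A" by (auto simp: W_def)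
      then have "s [^] i \<otimes> w \<otimes> inv (s [^] i) = b (i + l) a" using b_shift A(2) by blast
      moreover have "b (i + l) a \<in> W (n + c)"
        unfolding W_def using la that(2) by (intro image_eqI[of _ _ "(i + l, a)"]) auto
      ultimately show "w \<in> {x \<in> carrier G. s [^] i \<otimes> x \<otimes> inv (s [^] i) \<in> ?T}"
        using w W_L by (auto intro: generate.incl)
    qed
    ultimately have "generate G (W c) \<subseteq> {x \<in> carrier G. s [^] i \<otimes> x \<otimes> inv (s [^] i) \<in> ?T}"
      by (intro p.generate_subgroup_incl)
    then show ?thesis using that(1) by blast
  qed
  define D where "D \<theta> = (\<lambda>x. x \<in> ?L \<and> (\<theta> (r \<otimes> x \<otimes> inv r) \<noteq> \<theta> x))" for \<theta> :: "'a \<Rightarrow> bool"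
  have fin: "finite {\<theta> \<in> xor_homs G ?L. \<forall>x. \<not> D \<theta> x}"
  proof (rule finite_kernel_of_local_surj[where W = W and c = c, OF W_fin W_mono W_card])
    fix \<theta> \<eta> assume "\<theta> \<in> xor_homs G ?L" "\<eta> \<in> xor_homs G ?L"
    then show "(\<lambda>x. \<theta> x \<noteq> \<eta> x) \<in> xor_homs G ?L" by (rule xor_homs_xor)
  next
    fix \<theta> \<eta> x
    show "D (\<lambda>x. \<theta> x \<noteq> \<eta> x) x = (D \<theta> x \<noteq> D \<eta> x)" unfolding D_def by blast
  next
    fix \<chi> assume \<chi>: "\<chi> \<in> xor_homs G ?L"
    obtain \<theta> where \<theta>: "\<theta> \<in> xor_homs G ?L" "\<And>x. x \<in> ?L \<Longrightarrow> \<theta> (r \<otimes> x \<otimes> inv r) = (\<theta> x \<noteq> \<chi> x)"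
      using lift[OF \<chi>] by blast
    have "D \<theta> x = \<chi> x" for x
      using \<theta>(2)[of x] xor_homs_outside[OF \<chi>, of x] unfolding D_def by blast
    then show "\<exists>\<theta>\<in>xor_homs G ?L. D \<theta> = \<chi>" using \<theta>(1) by blast
  next
    fix \<theta> n x assume \<theta>: "\<theta> \<in> xor_homs G ?L" and z: "\<And>y. y \<in> W (n + c) \<Longrightarrow> \<not> \<theta> y" and x: "x \<in> W n"
    then obtain i a where ia: "x = b i a" "\<bar>i\<bar> \<le> int n" "a \<in> A" by (auto simp: W_def)
    then have aq: "a \<in> Kq" using A(2) by blast
    have "subgroup {x \<in> ?L. \<not> \<theta> x} G" using p.xor_homs_kernel_subgroup[OF Kpq_subgroup \<theta>] .
    then have zero: "generate G (W (n + c)) \<subseteq> {x \<in> ?L. \<not> \<theta> x}"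
      using z W_L by (intro p.generate_subgroup_incl) blast
    let ?y = "s [^] i \<otimes> (r \<otimes> b 0 a \<otimes> inv r) \<otimes> inv (s [^] i)"
    \<comment> \<open>\<open>r\<close> and \<open>s [^] i\<close> commute up to the commutator
      \<open>?z\<close>, which lies in \<open>Kpq\<close>, and homomorphisms on \<open>Kpq\<close>
      do not see conjugation by it. Hence the bound \<open>c\<close>, found at index 0, serves every
      index.\<close>
    let ?z = "r \<otimes> s [^] i \<otimes> inv r \<otimes> inv (s [^] i)"
    have y: "?y \<in> ?L" "\<not> \<theta> ?y" using zero shift[OF c[OF ia(3)] ia(2)] by blast+
    have "?z \<in> ?L" by (simp add: heights)
    then have \<theta>z: "\<theta> (?z \<otimes> ?y \<otimes> inv ?z) = \<theta> ?y"
      using p.xor_homs_conj[OF Kpq_subgroup \<theta>] y by blast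
    have eq: "r \<otimes> x \<otimes> inv r = ?z \<otimes> ?y \<otimes> inv ?z"
    proof -
      have bc: "b 0 a \<in> carrier G" using b_L[OF aq] by blast
      have "x = s [^] i \<otimes> b 0 a \<otimes> inv (s [^] i)" using b_shift[OF aq, of i 0] ia by simp
      then show ?thesis using bc by (simp add: p.inv_mult_group p.m_assoc p.inv_mult_cancel)
    qed
    have "\<not> \<theta> (r \<otimes> x \<otimes> inv r)" unfolding eq \<theta>z by (rule y(2))
    moreover have "\<not> \<theta> x" using z x W_mono[of n "n + c"] by auto
    ultimately show "\<not> D \<theta> x" unfolding D_def by blast
  next
    fix \<theta> assume \<theta>: "\<theta> \<in> xor_homs G ?L" and z: "\<And>n x. x \<in> W n \<Longrightarrow> \<not> \<theta> x"
    have "(\<lambda>_. False) \<in> xor_homs G ?L" by (simp add: xor_homs_def)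
    then show "\<theta> = (\<lambda>_. False)"
      using z W_L by (intro p.xor_homs_eq_generate[OF Kpq_subgroup \<theta> _ L_M[symmetric]]) auto
  qed
  show ?thesis
  proof (rule inj_on_finite[of "\<lambda>\<chi>. (\<lambda>x. x \<in> ?L \<and> \<chi> x, \<chi> r)" _ "{\<theta> \<in> xor_homs G ?L. \<forall>x. \<not> D \<theta> x} \<times> UNIV"])
    show "inj_on (\<lambda>\<chi>. (\<lambda>x. x \<in> ?L \<and> \<chi> x, \<chi> r)) (xor_homs G Kp)"
    proof (rule inj_onI)
      fix \<chi> \<chi>' assume h: "\<chi> \<in> xor_homs G Kp" "\<chi>' \<in> xor_homs G Kp"
        and eq: "(\<lambda>x. x \<in> ?L \<and> \<chi> x, \<chi> r) = (\<lambda>x. x \<in> ?L \<and> \<chi>' x, \<chi>' r)"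
      have "generate G (insert r ?L) = Kp"
      proof
        show "generate G (insert r ?L) \<subseteq> Kp"
          using r by (intro p.generate_subgroup_incl p.kernel_subgroup) auto
        show "Kp \<subseteq> generate G (insert r ?L)"
        proof
          fix x assume x: "x \<in> Kp"
          let ?T = "generate G (insert r ?L)"
          have T: "subgroup ?T G" by (intro p.generate_is_subgroup) auto
          let ?i = "q x div q r"
          have "x \<otimes> r [^] (- ?i) \<in> ?L"
            using x r0 r(3)[OF x] r(2) by (simp add: heights del: p.int_pow_neg)
          then have "x \<otimes> r [^] (- ?i) \<in> ?T" by (intro generate.incl) blast
          moreover have "r [^] ?i \<in> ?T"
            by (intro p.subgroup_int_pow_closed[OF T] generate.incl) blast
          ultimately have "x \<otimes> r [^] (- ?i) \<otimes> r [^] ?i \<in> ?T" by (rule generate.eng)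
          moreover have "x \<otimes> r [^] (- ?i) \<otimes> r [^] ?i = x"
            using x by (simp add: p.m_assoc flip: p.int_pow_mult)
          ultimately show "x \<in> ?T" by simp
        qed
      qed
      moreover have "\<chi> x = \<chi>' x" if "x \<in> insert r ?L" for x
        using eq that by (auto simp: fun_eq_iff)
      ultimately show "\<chi> = \<chi>'"
        using r by (intro p.xor_homs_eq_generate[OF p.kernel_subgroup h]) auto
    qed
    show "(\<lambda>\<chi>. (\<lambda>x. x \<in> ?L \<and> \<chi> x, \<chi> r)) ` xor_homs G Kp \<subseteq> {\<theta> \<in> xor_homs G ?L. \<forall>x. \<not> D \<theta> x} \<times> UNIV"
    proof (rule image_subsetI)
      fix \<chi> assume h: "\<chi> \<in> xor_homs G Kp"
      have mem: "(\<lambda>x. x \<in> ?L \<and> \<chi> x) \<in> xor_homs G ?L"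
        using xor_homs_mult[OF h] by (auto simp: xor_homs_def heights)
      have "\<not> D (\<lambda>x. x \<in> ?L \<and> \<chi> x) x" for x
        using conj_r[of x] p.xor_homs_conj[OF p.kernel_subgroup h, of x r] r(1) unfolding D_def by blast
      then show "(\<lambda>x. x \<in> ?L \<and> \<chi> x, \<chi> r) \<in> {\<theta> \<in> xor_homs G ?L. \<forall>x. \<not> D \<theta> x} \<times> UNIV"
        using mem by blast
    qed
  qed (use fin in simp)
qed

end

section \<open>Coarse retractions of Cayley graphs\<close>

lemma cayley_graph_simps [simp]:
  "verts (cayley_graph G A) = carrier G" "arcs (cayley_graph G A) = carrier G \<times> A"
  "tail (cayley_graph G A) e = fst e" "head (cayley_graph G A) (g, s) = g \<otimes>\<^bsub>G\<^esub> s"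
  by (simp_all add: cayley_graph_def)

section \<open>Word metrics and the metric on Cayley graphs\<close>

locale cayley = group G for G :: "('a, 'b) monoid_scheme" (structure) +
  fixes A :: "'a set"
  assumes gen: "generates G A"
begin

abbreviation adj :: "('a \<times> 'a) set" where
  "adj \<equiv> symcl (arcs_ends (cayley_graph G A))"

abbreviation d :: "'a \<Rightarrow> 'a \<Rightarrow> nat" where
  "d \<equiv> vertex_dist (cayley_graph G A)"

lemma gen_closed [simp]: "s \<in> A \<Longrightarrow> s \<in> carrier G"
  using gen by (auto simp: generates_def)

lemma adj_iff:
  "(x, y) \<in> adj \<longleftrightarrow> (\<exists>g\<in>carrier G. \<exists>s\<in>A. x = g \<and> y = g \<otimes> s \<or> y = g \<and> x = g \<otimes> s)"
  by (force simp: symcl_def arcs_ends_conv)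

lemma adj_sym: "(x, y) \<in> adj \<Longrightarrow> (y, x) \<in> adj"
  unfolding adj_iff by blast

lemma relpow_sym: "(x, y) \<in> adj ^^ n \<Longrightarrow> (y, x) \<in> adj ^^ n"
proof (induction n arbitrary: y)
  case (Suc n)
  then obtain z where "(x, z) \<in> adj ^^ n" "(z, y) \<in> adj" by (auto elim: relpow_Suc_E)
  then have "(z, x) \<in> adj ^^ n" "(y, z) \<in> adj" using Suc.IH adj_sym by blast+
  then show ?case by (rule relpow_Suc_I2[rotated])
qed simp

lemma dist_le: "(x, y) \<in> adj ^^ n \<Longrightarrow> d x y \<le> n"
  unfolding vertex_dist_def by (rule Least_le)

lemma dist_path:
  assumes "x \<in> carrier G" "y \<in> carrier G"
  shows "(x, y) \<in> adj ^^ d x y"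
  unfolding vertex_dist_def by (rule LeastI_ex) (rule cayley_graph_connected[OF is_group gen assms])

lemma dist_sym:
  assumes "x \<in> carrier G" "y \<in> carrier G"
  shows "d x y = d y x"
  using dist_le[OF relpow_sym[OF dist_path]] assms by (metis antisym)

lemma dist_self [simp]: "d x x = 0"
  using dist_le[of x x 0] by simp

lemma dist_triangle:
  assumes "x \<in> carrier G" "y \<in> carrier G" "z \<in> carrier G"
  shows "d x z \<le> d x y + d y z"
proof (rule dist_le)
  show "(x, z) \<in> adj ^^ (d x y + d y z)"
    unfolding relpow_add using dist_path assms by blast
qed

lemma dist_adj: "(x, y) \<in> adj \<Longrightarrow> d x y \<le> 1"
  using dist_le[of x y 1] by simp

lemma adj_closed: "(x, y) \<in> adj \<Longrightarrow> x \<in> carrier G \<and> y \<in> carrier G"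
  by (auto simp: adj_iff)

lemma dist_translate:
  assumes "g \<in> carrier G" "x \<in> carrier G" "y \<in> carrier G"
  shows "d (g \<otimes> x) (g \<otimes> y) \<le> d x y"
proof (rule dist_le)
  have "(g \<otimes> x, g \<otimes> z) \<in> adj ^^ n" if "(x, z) \<in> adj ^^ n" for n z
    using that
  proof (induction n arbitrary: z)
    case (Suc n)
    then obtain w where w: "(x, w) \<in> adj ^^ n" "(w, z) \<in> adj" by (auto elim: relpow_Suc_E)
    then obtain h s where h: "h \<in> carrier G" "s \<in> A" "w = h \<and> z = h \<otimes> s \<or> z = h \<and> w = h \<otimes> s"
      unfolding adj_iff by blast
    then have "g \<otimes> w = g \<otimes> h \<and> g \<otimes> z = g \<otimes> h \<otimes> s \<or> g \<otimes> z = g \<otimes> h \<and> g \<otimes> w = g \<otimes> h \<otimes> s"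
      using assms(1) by (auto simp: m_assoc)
    moreover have "g \<otimes> h \<in> carrier G" using h assms(1) by simp
    ultimately have "(g \<otimes> w, g \<otimes> z) \<in> adj" unfolding adj_iff using h(2) by blast
    then show ?case using Suc.IH[OF w(1)] by (rule relpow_Suc_I[rotated])
  qed simp
  then show "(g \<otimes> x, g \<otimes> y) \<in> adj ^^ d x y" using dist_path assms by blast
qed

text \<open>Left translation by \<open>inv x\<close> reduces the claim to distances from \<one> to
  the finitely many elements of \<open>E\<close>.\<close>

lemma dist_bounded:
  assumes "finite E" "E \<subseteq> carrier G"
  shows "\<exists>C. \<forall>x\<in>carrier G. \<forall>y\<in>carrier G. inv x \<otimes> y \<in> E \<longrightarrow> d x y \<le> C"
proof (intro exI ballI impI)
  fix x y assume xy: "x \<in> carrier G" "y \<in> carrier G" "inv x \<otimes> y \<in> E"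
  then have "d x y = d (x \<otimes> \<one>) (x \<otimes> (inv x \<otimes> y))" by (simp flip: m_assoc)
  also have "\<dots> \<le> d \<one> (inv x \<otimes> y)" using xy by (intro dist_translate) auto
  also have "\<dots> \<le> Max (d \<one> ` E)" using assms xy by simp
  finally show "d x y \<le> Max (d \<one> ` E)" .
qed

lemma dist_lipschitz:
  assumes "cayley G' A'" "f \<in> carrier G \<rightarrow> carrier G'"
    and "\<And>g s. g \<in> carrier G \<Longrightarrow> s \<in> A \<Longrightarrow> vertex_dist (cayley_graph G' A') (f g) (f (g \<otimes> s)) \<le> C"
    and "x \<in> carrier G" "y \<in> carrier G"
  shows "vertex_dist (cayley_graph G' A') (f x) (f y) \<le> C * d x y"
proof -
  interpret G': cayley G' A' by fact
  have "G'.d (f x) (f z) \<le> C * n \<and> z \<in> carrier G" if "(x, z) \<in> adj ^^ n" for n z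
    using that
  proof (induction n arbitrary: z)
    case 0
    then show ?case using assms(4) by simp
  next
    case (Suc n)
    then obtain w where w: "(x, w) \<in> adj ^^ n" "(w, z) \<in> adj" by (auto elim: relpow_Suc_E)
    then have c: "w \<in> carrier G" "z \<in> carrier G" using adj_closed by blast+
    then have fc: "f x \<in> carrier G'" "f w \<in> carrier G'" "f z \<in> carrier G'"
      using assms(2,4) by (auto simp: Pi_iff)
    have "G'.d (f w) (f z) \<le> C"
      using w(2) assms(3) fc G'.dist_sym unfolding adj_iff by metis
    then have "G'.d (f x) (f z) \<le> C * Suc n"
      using Suc.IH[OF w(1)] G'.dist_triangle[OF fc] by simp
    then show ?case using c by simp
  qed
  then show ?thesis using dist_path assms by blast
qed

text \<open>Interior points are pushed to the tail of their edge. Each end of an edge path is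
  shifted by at most 1, which is the origin of the additive error 2 in the bounds on the graph
  metric.\<close>

fun base :: "('a, 'a \<times> 'a) graph_point \<Rightarrow> 'a" where
  "base (Vertex v) = v"
| "base (Inner e r) = fst e"

abbreviation points :: "('a, 'a \<times> 'a) graph_point set" where
  "points \<equiv> graph_points (cayley_graph G A)"

lemma base_closed: "p \<in> points \<Longrightarrow> base p \<in> carrier G"
  by (auto simp: graph_points_def)

lemma nearby_vertices_bounds:
  assumes "p \<in> points" "(u, a) \<in> nearby_vertices (cayley_graph G A) p"
  shows "0 \<le> a" "a \<le> 1" "u \<in> carrier G" "d u (base p) \<le> 1"
proof -
  have *: "0 \<le> a \<and> a \<le> 1 \<and> u \<in> carrier G \<and> d u (base p) \<le> 1"
  proof (cases p)
    case (Vertex v)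
    then show ?thesis using assms by (auto simp: graph_points_def)
  next
    case (Inner e r)
    then obtain g s where e: "e = (g, s)" "g \<in> carrier G" "s \<in> A" "0 < r" "r < 1"
      using assms(1) by (auto simp: graph_points_def)
    then have "(g \<otimes> s, g) \<in> adj" unfolding adj_iff by blast
    then have "d (g \<otimes> s) g \<le> 1" by (rule dist_adj)
    then show ?thesis using assms(2) Inner e by auto
  qed
  then show "0 \<le> a" "a \<le> 1" "u \<in> carrier G" "d u (base p) \<le> 1" by simp_all
qed

lemma base_nearby: "\<exists>a. (base p, a) \<in> nearby_vertices (cayley_graph G A) p"
  by (cases p) auto

lemma dist_via_vertices_bounds:
  assumes "p \<in> points" "q \<in> points"
  defines "D \<equiv> dist_via_vertices (cayley_graph G A) p q"
  shows "0 \<le> D" "real (d (base p) (base q)) - 2 \<le> D" "D \<le> real (d (base p) (base q)) + 2"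
proof -
  let ?N = "nearby_vertices (cayley_graph G A)"
  let ?T = "{a + real (d u v) + b |u a v b. (u, a) \<in> ?N p \<and> (v, b) \<in> ?N q}"
  have D: "D = Min ?T" by (simp add: D_def dist_via_vertices_def)
  have "finite (?N p)" for p :: "('a, 'a \<times> 'a) graph_point" by (cases p) auto
  then have "finite ((\<lambda>((u, a), (v, b)). a + real (d u v) + b) ` (?N p \<times> ?N q))" by blast
  moreover have "?T \<subseteq> (\<lambda>((u, a), (v, b)). a + real (d u v) + b) ` (?N p \<times> ?N q)" by force
  ultimately have fin: "finite ?T" by (rule rev_finite_subset)
  obtain a b where ab: "(base p, a) \<in> ?N p" "(base q, b) \<in> ?N q" using base_nearby by blast
  then have mem: "a + real (d (base p) (base q)) + b \<in> ?T" by blast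
  then have ne: "?T \<noteq> {}" by blast
  have "D \<le> a + real (d (base p) (base q)) + b" unfolding D by (rule Min_le[OF fin mem])
  then show "D \<le> real (d (base p) (base q)) + 2"
    using nearby_vertices_bounds[OF assms(1) ab(1)] nearby_vertices_bounds[OF assms(2) ab(2)] by linarith
  have low: "0 \<le> x \<and> real (d (base p) (base q)) - 2 \<le> x" if "x \<in> ?T" for x
  proof -
    obtain u a v b where x: "x = a + real (d u v) + b" "(u, a) \<in> ?N p" "(v, b) \<in> ?N q"
      using \<open>x \<in> ?T\<close> by blast
    note P = nearby_vertices_bounds[OF assms(1) x(2)] and Q = nearby_vertices_bounds[OF assms(2) x(3)]
    note c = base_closed[OF assms(1)] base_closed[OF assms(2)]
    have "d (base p) (base q) \<le> d (base p) u + (d u v + d v (base q))"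
      using dist_triangle[OF c(1) P(3) c(2)] dist_triangle[OF P(3) Q(3) c(2)] by linarith
    also have "\<dots> \<le> d u v + 2" using P(4) Q(4) dist_sym[OF c(1) P(3)] by linarith
    finally show ?thesis using x(1) P(1) Q(1) by linarith
  qed
  show "0 \<le> D" "real (d (base p) (base q)) - 2 \<le> D"
    unfolding D using low fin ne by (simp_all add: Min_ge_iff)
qed

lemma graph_dist_bounds:
  assumes "p \<in> points" "q \<in> points"
  defines "D \<equiv> graph_dist (cayley_graph G A) p q"
  shows "0 \<le> D" "real (d (base p) (base q)) - 2 \<le> D" "D \<le> real (d (base p) (base q)) + 2"
proof -
  note B = dist_via_vertices_bounds[OF assms(1,2)]
  have *: "0 \<le> D \<and> real (d (base p) (base q)) - 2 \<le> D \<and> D \<le> real (d (base p) (base q)) + 2"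
  proof (cases "\<exists>e r s. p = Inner e r \<and> q = Inner e s")
    case True
    then obtain e r s where "p = Inner e r" "q = Inner e s" by blast
    then show ?thesis using B unfolding D_def by auto
  next
    case False
    then have "D = dist_via_vertices (cayley_graph G A) p q"
      unfolding D_def by (cases p; cases q) auto
    then show ?thesis using B by simp
  qed
  then show "0 \<le> D" "real (d (base p) (base q)) - 2 \<le> D" "D \<le> real (d (base p) (base q)) + 2"
    by simp_all
qed

lemma graph_dist_Vertex: "graph_dist (cayley_graph G A) (Vertex u) (Vertex v) = real (d u v)"
  by (simp add: dist_via_vertices_def)

end

text \<open>The displacement under \<open>inv s\<close> at \<open>g\<close> is the inverse of the
  one under \<open>s\<close> at \<open>g \<otimes> inv s\<close>. The displacement under
  \<open>s \<otimes> t\<close> at \<open>g\<close> is the product of the one under \<open>s\<close>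
  at \<open>g\<close> and the one under \<open>t\<close> at \<open>g \<otimes> s\<close>.\<close>

lemma (in group) finite_displacement_subgroup:
  assumes "\<And>g. g \<in> carrier G \<Longrightarrow> \<rho> g \<in> carrier G"
  shows "subgroup {s \<in> carrier G. finite {inv (\<rho> g) \<otimes> \<rho> (g \<otimes> s) |g. g \<in> carrier G}} G"
proof (rule subgroupI)
  let ?E = "\<lambda>s. {inv (\<rho> g) \<otimes> \<rho> (g \<otimes> s) |g. g \<in> carrier G}"
  have "?E \<one> \<subseteq> {\<one>}" using assms by auto
  then have "finite (?E \<one>)" by (rule finite_subset) simp
  then have "\<one> \<in> {s \<in> carrier G. finite (?E s)}" by simp
  then show "{s \<in> carrier G. finite (?E s)} \<noteq> {}" by (metis empty_iff)
  fix s assume "s \<in> {s \<in> carrier G. finite (?E s)}"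
  then have s: "s \<in> carrier G" "finite (?E s)" by simp_all
  have "?E (inv s) \<subseteq> m_inv G ` ?E s"
  proof
    fix x assume "x \<in> ?E (inv s)"
    then obtain g where g: "g \<in> carrier G" "x = inv (\<rho> g) \<otimes> \<rho> (g \<otimes> inv s)" by auto
    have "x = inv (inv (\<rho> (g \<otimes> inv s)) \<otimes> \<rho> (g \<otimes> inv s \<otimes> s))"
      using g s assms by (simp add: inv_mult_group m_assoc)
    then show "x \<in> m_inv G ` ?E s" using g s by blast
  qed
  then have "finite (?E (inv s))" using s(2) by (rule finite_surj[rotated])
  then show "inv s \<in> {s \<in> carrier G. finite (?E s)}" using s by simp
  fix t assume "t \<in> {s \<in> carrier G. finite (?E s)}"
  then have t: "t \<in> carrier G" "finite (?E t)" by simp_all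
  have "?E (s \<otimes> t) \<subseteq> (\<lambda>(x, y). x \<otimes> y) ` (?E s \<times> ?E t)"
  proof
    fix x assume "x \<in> ?E (s \<otimes> t)"
    then obtain g where g: "g \<in> carrier G" "x = inv (\<rho> g) \<otimes> \<rho> (g \<otimes> (s \<otimes> t))" by auto
    let ?a = "inv (\<rho> g) \<otimes> \<rho> (g \<otimes> s)" and ?b = "inv (\<rho> (g \<otimes> s)) \<otimes> \<rho> (g \<otimes> s \<otimes> t)"
    have "\<rho> g \<in> carrier G" "\<rho> (g \<otimes> s) \<in> carrier G" "\<rho> (g \<otimes> s \<otimes> t) \<in> carrier G"
      using g s t assms by simp_all
    moreover have "g \<otimes> (s \<otimes> t) = g \<otimes> s \<otimes> t" using g s t by (simp add: m_assoc)
    ultimately have "x = ?a \<otimes> ?b"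
      unfolding g(2) by (simp add: m_assoc inv_mult_cancel)
    moreover have "?a \<in> ?E s" "?b \<in> ?E t" using g s by blast+
    ultimately show "x \<in> (\<lambda>(x, y). x \<otimes> y) ` (?E s \<times> ?E t)" by (intro image_eqI[of _ _ "(?a, ?b)"]) auto
  qed
  then have "finite (?E (s \<otimes> t))" by (rule finite_surj[rotated]) (use s t in simp)
  then show "s \<otimes> t \<in> {s \<in> carrier G. finite (?E s)}" using s t by simp
qed auto

text \<open>\<open>\<rho>\<close> turns a path in \<open>G\<close> between two elements of
  \<open>H\<close> into a chain in \<open>H\<close> with bounded jumps whose ends are near the given
  elements, so distances in \<open>H\<close> are bounded linearly by distances in \<open>G\<close>.
  The opposite bound holds because the generators of \<open>H\<close> have bounded length in
  \<open>G\<close>.\<close>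

theorem undistorted_if_coarse_retract:
  fixes G (structure)
  assumes G: "group G" "finite B0" "generates G B0"
    and H: "subgroup H G" "finite A0" "generates (G\<lparr>carrier := H\<rparr>) A0"
    and \<rho>: "\<And>g. g \<in> carrier G \<Longrightarrow> \<rho> g \<in> H"
      "\<And>s. s \<in> B0 \<Longrightarrow> finite {inv (\<rho> g) \<otimes> \<rho> (g \<otimes> s) |g. g \<in> carrier G}"
      "finite {inv h \<otimes> \<rho> h |h. h \<in> H}"
  shows "undistorted H G"
proof -
  interpret group G by fact
  interpret H: subgroup H G by fact
  let ?H = "G\<lparr>carrier := H\<rparr>"
  have gH: "group ?H" using H.subgroup_is_group[OF G(1)] .
  have invH: "inv\<^bsub>?H\<^esub> x = inv x" if "x \<in> H" for x
    using m_inv_consistent[OF H(1) that] .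
  have \<rho>c: "\<rho> g \<in> carrier G" if "g \<in> carrier G" for g using \<rho>(1)[OF that] by simp
  let ?E = "\<lambda>s. {inv (\<rho> g) \<otimes> \<rho> (g \<otimes> s) |g. g \<in> carrier G}"
  have "B0 \<subseteq> {s \<in> carrier G. finite (?E s)}"
    using \<rho>(2) G(3) unfolding generates_def by (simp add: subset_iff)
  then have "generate G B0 \<subseteq> {s \<in> carrier G. finite (?E s)}"
    by (rule generate_subgroup_incl[OF _ finite_displacement_subgroup[OF \<rho>c]])
  then have E: "finite (?E s)" if "s \<in> carrier G" for s
    using G(3) that unfolding generates_def by blast
  have "\<exists>f. quasi_isometric_embedding (cayley_graph ?H A) (cayley_graph G B) f \<and> (\<forall>h\<in>H. f (Vertex h) = Vertex h)"
    if AB: "finite A" "generates ?H A" "finite B" "generates G B" for A B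
  proof -
    interpret cH: cayley ?H A
      by (intro cayley.intro cayley_axioms.intro gH AB)
    interpret cG: cayley G B
      by (intro cayley.intro cayley_axioms.intro G AB)
    have A: "A \<subseteq> H" using AB(2) by (auto simp: generates_def)
    have "A \<subseteq> carrier G" using A H.subset by (rule subset_trans)
    from cG.dist_bounded[OF AB(1) this] obtain C1
      where C1: "\<forall>x\<in>carrier G. \<forall>y\<in>carrier G. inv x \<otimes> y \<in> A \<longrightarrow> cG.d x y \<le> C1" ..
    have d1: "cG.d (id x) (id y) \<le> C1 * cH.d x y" if "x \<in> H" "y \<in> H" for x y
    proof (rule cH.dist_lipschitz[OF cG.cayley_axioms])
      fix g s assume "g \<in> carrier ?H" "s \<in> A"
      then have c: "g \<in> carrier G" "s \<in> carrier G" "s \<in> A" using A by auto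
      then have "inv g \<otimes> (g \<otimes> s) = s" by (simp flip: m_assoc)
      then show "cG.d (id g) (id (g \<otimes>\<^bsub>?H\<^esub> s)) \<le> C1" using c by (simp add: C1)
    qed (use that in auto)
    let ?F = "\<Union>s\<in>B. ?E s"
    have finF: "finite ?F" using AB(3) E by simp
    have subF: "?F \<subseteq> carrier ?H"
      using \<rho>(1) AB(4) by (auto simp: generates_def)
    from cH.dist_bounded[OF finF subF] obtain C2
      where C2: "\<forall>x\<in>carrier ?H. \<forall>y\<in>carrier ?H. inv\<^bsub>?H\<^esub> x \<otimes>\<^bsub>?H\<^esub> y \<in> ?F \<longrightarrow> cH.d x y \<le> C2" ..
    have d2: "cH.d (\<rho> x) (\<rho> y) \<le> C2 * cG.d x y" if "x \<in> carrier G" "y \<in> carrier G" for x y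
    proof (rule cG.dist_lipschitz[OF cH.cayley_axioms])
      fix g s assume gs: "g \<in> carrier G" "s \<in> B"
      then have "inv (\<rho> g) \<otimes> \<rho> (g \<otimes> s) \<in> ?F" by blast
      then show "cH.d (\<rho> g) (\<rho> (g \<otimes> s)) \<le> C2" using gs \<rho>(1) by (intro C2[rule_format]) (simp_all add: invH)
    qed (use that \<rho>(1) in auto)
    have sub3: "{inv h \<otimes> \<rho> h |h. h \<in> H} \<subseteq> carrier ?H" using \<rho>(1) by auto
    from cH.dist_bounded[OF \<rho>(3) sub3] obtain C3
      where C3: "\<forall>x\<in>carrier ?H. \<forall>y\<in>carrier ?H.
        inv\<^bsub>?H\<^esub> x \<otimes>\<^bsub>?H\<^esub> y \<in> {inv h \<otimes> \<rho> h |h. h \<in> H} \<longrightarrow> cH.d x y \<le> C3" ..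
    have d3: "cH.d h (\<rho> h) \<le> C3" if "h \<in> H" for h
      using that \<rho>(1) by (intro C3[rule_format]) (auto simp: invH)
    have d4: "cH.d x y \<le> C2 * cG.d x y + 2 * C3" if xy: "x \<in> H" "y \<in> H" for x y
    proof -
      have c: "x \<in> carrier ?H" "y \<in> carrier ?H" "\<rho> x \<in> carrier ?H" "\<rho> y \<in> carrier ?H"
        "x \<in> carrier G" "y \<in> carrier G"
        using xy \<rho>(1) by auto
      show ?thesis
        using cH.dist_triangle[OF c(1,3,2)] cH.dist_triangle[OF c(3,4,2)] d2[OF c(5,6)]
          d3[OF xy(1)] d3[OF xy(2)] cH.dist_sym[OF c(2,4)] by linarith
    qed
    define f where "f = (\<lambda>p. Vertex (cH.base p) :: ('a, 'a \<times> 'a) graph_point)"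
    \<comment> \<open>One constant for both inequalities: the upper bound needs
      \<open>2 * C1\<close>, the lower one needs \<open>C2\<close> and \<open>2 * C3 + 2\<close>,
      where the 2 is the error of moving points to vertices.\<close>
    define K where "K = real (2 * C1 + C2 + 2 * C3 + 3)"
    have K1: "K \<ge> 1" by (simp add: K_def)
    have "1 / K * graph_dist (cayley_graph ?H A) p q - K \<le> graph_dist (cayley_graph G B) (f p) (f q) \<and>
        graph_dist (cayley_graph G B) (f p) (f q) \<le> K * graph_dist (cayley_graph ?H A) p q + K"
      if pq: "p \<in> cH.points" "q \<in> cH.points" for p q
    proof -
      let ?x = "cH.base p" and ?y = "cH.base q"
      have xy: "?x \<in> H" "?y \<in> H" using cH.base_closed[OF pq(1)] cH.base_closed[OF pq(2)] by simp_all
      let ?g = "graph_dist (cayley_graph ?H A) p q"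
      note g = cH.graph_dist_bounds[OF pq]
      have fd: "graph_dist (cayley_graph G B) (f p) (f q) = real (cG.d ?x ?y)"
        unfolding f_def by (rule cG.graph_dist_Vertex)
      have "real (cG.d ?x ?y) \<le> real C1 * real (cH.d ?x ?y)"
        using d1[OF xy] by (simp flip: of_nat_mult)
      also have "\<dots> \<le> real C1 * (?g + 2)" using g(2) by (intro mult_left_mono) auto
      also have "\<dots> \<le> K * ?g + K"
      proof -
        have "real C1 * ?g \<le> K * ?g" using g(1) by (intro mult_right_mono) (auto simp: K_def)
        moreover have "real C1 * 2 \<le> K" by (simp add: K_def)
        ultimately show ?thesis by (simp add: distrib_left)
      qed
      finally have up: "real (cG.d ?x ?y) \<le> K * ?g + K" .
      have "real (cH.d ?x ?y) \<le> real C2 * real (cG.d ?x ?y) + 2 * real C3"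
        using of_nat_mono[OF d4[OF xy], where ?'a = real] by simp
      moreover have "real C2 * real (cG.d ?x ?y) \<le> K * real (cG.d ?x ?y)"
        by (intro mult_right_mono) (auto simp: K_def)
      moreover have "2 * real C3 + 2 \<le> K" by (simp add: K_def)
      moreover have "K \<le> K * K" using K1 by simp
      ultimately have "?g \<le> K * real (cG.d ?x ?y) + K * K" using g(3) by linarith
      then have "?g \<le> K * (real (cG.d ?x ?y) + K)" by (simp add: distrib_left)
      then have "1 / K * ?g \<le> real (cG.d ?x ?y) + K"
        using K1 by (simp add: divide_simps mult.commute)
      then show ?thesis using up unfolding fd by simp
    qed
    moreover have "f \<in> cH.points \<rightarrow> cG.points"
    proof
      fix p assume "p \<in> cH.points"
      then have "cH.base p \<in> carrier G" using cH.base_closed[of p] by simp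
      then show "f p \<in> cG.points" by (auto simp: f_def graph_points_def)
    qed
    ultimately have "quasi_isometric_embedding (cayley_graph ?H A) (cayley_graph G B) f"
      unfolding quasi_isometric_embedding_def using K1 by blast
    moreover have "\<forall>h\<in>H. f (Vertex h) = Vertex h" by (simp add: f_def)
    ultimately show ?thesis by blast
  qed
  moreover have "finitely_generated G" "finitely_generated ?H"
    using G(2,3) H(2,3) unfolding finitely_generated_def by blast+
  ultimately show ?thesis
    unfolding undistorted_def using G(1) H(1) by simp
qed

section \<open>Free-by-cyclic subgroups\<close>

text \<open>Serves to carry a basis of the given free group over to its copy inside the semidirect
  product.\<close>

lemma free_basis_iso:
  assumes "group G" "group G'" "\<iota> \<in> iso G G'" "free_basis G S"
  shows "free_basis G' (\<iota> ` S)"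
proof -
  interpret G: group G by fact
  interpret G': group G' by fact
  interpret h: group_hom G G' \<iota>
    using assms(3) by (simp add: group_hom.intro group_hom_axioms.intro assms iso_def)
  have S: "S \<subseteq> carrier G" and val: "bij_betw (word_value G) (reduced_words S) (carrier G)"
    using assms(4) by (simp_all add: free_basis_def)
  have bij: "bij_betw \<iota> (carrier G) (carrier G')" using assms(3) by (simp add: iso_def)
  then have inj: "inj_on \<iota> S" using S by (meson bij_betw_def inj_on_subset)
  define m where "m = map (map_prod \<iota> (id :: bool \<Rightarrow> bool))"
  have red: "reduced (m w) \<longleftrightarrow> reduced w" if "set w \<subseteq> S \<times> UNIV" for w
  proof -
    have cp: "compat (map_prod \<iota> id a) (map_prod \<iota> id b) = compat a b" if "a \<in> S \<times> UNIV" "b \<in> S \<times> UNIV" for a b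
      using that inj by (cases a; cases b) (auto simp: compat_def neg_def dest: inj_onD)
    have "successively (\<lambda>a b. compat (map_prod \<iota> id a) (map_prod \<iota> id b)) w \<longleftrightarrow> reduced w"
    proof (rule successively_cong[OF _ refl])
      fix a b assume "a \<in> set w" "b \<in> set w"
      then have "a \<in> S \<times> UNIV" "b \<in> S \<times> UNIV" using that by auto
      then show "compat (map_prod \<iota> id a) (map_prod \<iota> id b) = compat a b" by (rule cp)
    qed
    then show ?thesis by (simp add: m_def successively_map)
  qed
  have injm: "inj_on m {w. set w \<subseteq> S \<times> UNIV}"
  proof -
    have "inj_on (map_prod \<iota> (id :: bool \<Rightarrow> bool)) (S \<times> UNIV)" using inj by (intro map_prod_inj_on) auto
    then show ?thesis unfolding m_def
      by (intro inj_onI) (auto dest!: inj_on_map_eq_map[THEN iffD1, rotated] elim: inj_on_subset)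
  qed
  have "bij_betw m (reduced_words S) (reduced_words (\<iota> ` S))"
  proof (rule bij_betw_imageI)
    show "inj_on m (reduced_words S)"
      by (rule inj_on_subset[OF injm]) (auto simp: reduced_words_iff)
    show "m ` reduced_words S = reduced_words (\<iota> ` S)"
    proof
      show "m ` reduced_words S \<subseteq> reduced_words (\<iota> ` S)"
      proof (rule image_subsetI)
        fix w assume "w \<in> reduced_words S"
        then show "m w \<in> reduced_words (\<iota> ` S)"
          using red[of w] by (auto simp: reduced_words_iff m_def)
      qed
      show "reduced_words (\<iota> ` S) \<subseteq> m ` reduced_words S"
      proof
        fix v assume v: "v \<in> reduced_words (\<iota> ` S)"
        then have "set v \<subseteq> map_prod \<iota> id ` (S \<times> UNIV)" by (force simp: reduced_words_iff)
        then have "v \<in> lists (map_prod \<iota> id ` (S \<times> UNIV))" unfolding lists_eq_set by (rule CollectI)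
        then have "v \<in> m ` lists (S \<times> UNIV)" unfolding lists_image m_def .
        then obtain w where w: "set w \<subseteq> S \<times> UNIV" "v = m w" unfolding lists_eq_set by blast
        then show "v \<in> m ` reduced_words S" using v red[of w] by (auto simp: reduced_words_iff)
      qed
    qed
  qed
  moreover have "bij_betw (word_value G' \<circ> m) (reduced_words S) (carrier G')"
  proof -
    have "(word_value G' \<circ> m) w = (\<iota> \<circ> word_value G) w" if "w \<in> reduced_words S" for w
    proof -
      have "word_value G w \<in> carrier G \<and> word_value G' (m w) = \<iota> (word_value G w)"
        if "set w \<subseteq> S \<times> UNIV" for w
        using that
      proof (induction w)
        case (Cons a w)
        then have "fst a \<in> carrier G" using S by auto
        with Cons show ?case by (cases a) (auto simp: word_value_def m_def)
      qed (simp add: word_value_def m_def)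
      then show ?thesis using that by (simp add: reduced_words_iff)
    qed
    then show ?thesis using bij_betw_trans[OF val bij] by (simp cong: bij_betw_cong)
  qed
  ultimately have "bij_betw (word_value G') (reduced_words (\<iota> ` S)) (carrier G')"
    by (simp add: bij_betw_comp_iff)
  then show ?thesis using S by (auto simp: free_basis_def)
qed

context free_basis_group
begin

lemma generate_basis: "generate F S = carrier F"
proof
  show "generate F S \<subseteq> carrier F" by (rule generate_incl) auto
  have "g \<in> generate F S" if "g \<in> carrier F" for g
    using that
  proof (induction rule: val_induct)
    case (step a g)
    then have "letter a \<in> generate F S"
      by (auto simp: letter_def intro: generate.incl generate.inv)
    with step show ?case by (simp add: generate.eng)
  qed (rule generate.one)
  then show "carrier F \<subseteq> generate F S" by blast
qed

text \<open>Finitely many generators involve finitely many basis letters, and the elements whose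
  normal form uses only these letters form a subgroup.\<close>

lemma finite_basis:
  assumes "finitely_generated F"
  shows "finite S"
proof -
  obtain A where A: "finite A" "A \<subseteq> carrier F" "generate F A = carrier F"
    using assms by (auto simp: finitely_generated_def generates_def)
  define S0 where "S0 = fst ` (\<Union>a\<in>A. set (nf a))"
  let ?P = "{g \<in> carrier F. set (nf g) \<subseteq> S0 \<times> UNIV}"
  have P_inv: "inv g \<in> ?P" if "g \<in> ?P" for g using that by (simp add: nf_inv)
  have "subgroup ?P F"
  proof (rule subgroupI)
    have "\<one> \<in> ?P" by simp
    then show "?P \<noteq> {}" by (metis empty_iff)
    fix g h assume gh: "g \<in> ?P" "h \<in> ?P"
    then have gi: "inv g \<in> ?P" by (intro P_inv)
    have c: "inv g \<in> carrier F" "h \<in> carrier F" using gh by simp_all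
    obtain p a b where s: "nf (inv g) = p @ a" "nf h = p @ b" "nf (inv (inv g) \<otimes> h) = inv_word a @ b"
      using nf_split[OF c] by metis
    have "set a \<subseteq> S0 \<times> UNIV" "set b \<subseteq> S0 \<times> UNIV" using s gi gh by auto
    then have "set (inv_word a @ b) \<subseteq> S0 \<times> UNIV" by simp
    then show "g \<otimes> h \<in> ?P" using s(3) gh by simp
  qed (use P_inv in auto)
  moreover have "A \<subseteq> ?P" using A(2) by (force simp: S0_def)
  ultimately have "carrier F \<subseteq> ?P" using generate_subgroup_incl A(3) by metis
  have "S \<subseteq> S0"
  proof
    fix s assume s: "s \<in> S"
    then have "letter (s, True) \<in> carrier F" by (intro letter_closed) simp
    then have "set (nf (letter (s, True))) \<subseteq> S0 \<times> UNIV" using \<open>carrier F \<subseteq> ?P\<close> by blast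
    then show "s \<in> S0" using s nf_letter[of "(s, True)"] by simp
  qed
  moreover have "finite S0" using A(1) by (simp add: S0_def)
  ultimately show ?thesis by (rule finite_subset)
qed

end

text \<open>\<open>q x\<close> is the exponent of the coset of \<open>x\<close> as a power of a
  generator \<open>c\<close> of the quotient. It is additive because exponents are unique in an
  infinite cyclic group.\<close>

lemma infinite_cyclic_quotient_height:
  assumes "N \<lhd> G" "cyclic_group (G Mod N)" "infinite (carrier (G Mod N))"
  obtains q r where "height G (carrier G) q" "N = {x \<in> carrier G. q x = 0}" "r \<in> carrier G" "q r = 1"
proof -
  interpret N: normal N G by fact
  interpret Q: group "G Mod N" by (rule N.factorgroup_is_group)
  obtain c where c: "c \<in> carrier (G Mod N)" "subgroup_generated (G Mod N) {c} = G Mod N"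
    using assms(2) by (auto simp: cyclic_group_def)
  have inj: "i = j" if "c [^]\<^bsub>G Mod N\<^esub> i = c [^]\<^bsub>G Mod N\<^esub> j" for i j :: int
    using Q.infinite_cyclic_subgroup_int[OF c(1)] assms(3) that unfolding c(2) by blast
  have range: "carrier (G Mod N) = range (\<lambda>n::int. c [^]\<^bsub>G Mod N\<^esub> n)"
    using Q.carrier_subgroup_generated_by_singleton[OF c(1)] unfolding c(2) .
  have coset_in: "N #>\<^bsub>G\<^esub> x \<in> carrier (G Mod N)" if "x \<in> carrier G" for x
    using that by (auto simp: carrier_FactGroup)
  define q where "q x = (SOME n. N #>\<^bsub>G\<^esub> x = c [^]\<^bsub>G Mod N\<^esub> (n::int))" for x
  have q: "N #>\<^bsub>G\<^esub> x = c [^]\<^bsub>G Mod N\<^esub> q x" if "x \<in> carrier G" for x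
    unfolding q_def by (rule someI_ex) (use coset_in[OF that] range in blast)
  obtain x where x: "x \<in> carrier G" "c = N #>\<^bsub>G\<^esub> x" using c(1) by (auto simp: carrier_FactGroup)
  show thesis
  proof (rule that[of q x])
    show "height G (carrier G) q"
    proof (rule height.intro[OF N.is_group N.subgroup_self], unfold_locales)
      fix x y assume xy: "x \<in> carrier G" "y \<in> carrier G"
      have "c [^]\<^bsub>G Mod N\<^esub> q (x \<otimes>\<^bsub>G\<^esub> y) = (N #>\<^bsub>G\<^esub> x) \<otimes>\<^bsub>G Mod N\<^esub> (N #>\<^bsub>G\<^esub> y)"
        using xy q[of "x \<otimes>\<^bsub>G\<^esub> y"] by (simp add: N.rcos_sum)
      also have "\<dots> = c [^]\<^bsub>G Mod N\<^esub> (q x + q y)"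
        using c(1) by (simp only: q[OF xy(1)] q[OF xy(2)] Q.int_pow_mult)
      finally show "q (x \<otimes>\<^bsub>G\<^esub> y) = q x + q y" by (rule inj)
    qed
    have c0: "c [^]\<^bsub>G Mod N\<^esub> (0::int) = N" by simp
    show "N = {x \<in> carrier G. q x = 0}"
    proof (intro equalityI subsetI)
      fix x assume x: "x \<in> N"
      then have xc: "x \<in> carrier G" by (rule N.mem_carrier)
      have "N #>\<^bsub>G\<^esub> x = N" by (rule N.coset_join2[OF xc N.subgroup_axioms x])
      then have "q x = 0" using q[OF xc] c0 by (intro inj) simp
      then show "x \<in> {x \<in> carrier G. q x = 0}" using xc by simp
    next
      fix x assume "x \<in> {x \<in> carrier G. q x = 0}"
      then have xc: "x \<in> carrier G" and "q x = 0" by simp_all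
      then have "N #>\<^bsub>G\<^esub> x = N" using q[OF xc] c0 by simp
      then show "x \<in> N" using N.rcos_self[OF xc N.subgroup_axioms] by simp
    qed
    show "x \<in> carrier G" by fact
    show "q x = 1" using q[OF x(1)] x(2) c(1) inj[of "q x" 1] by (simp add: Q.int_pow_1)
  qed
qed

lemma heightI:
  assumes "group G" "subgroup K G"
    and "\<And>x y. x \<in> K \<Longrightarrow> y \<in> K \<Longrightarrow> e (x \<otimes>\<^bsub>G\<^esub> y) = e x + (e y :: int)"
  shows "height G K e"
  using assms by (intro height.intro height_axioms.intro)

section \<open>Groups with a character whose kernel is free\<close>

locale free_fiber = height G "carrier G" p
  for G :: "('a, 'b) monoid_scheme" (structure) and p +
  fixes S
  assumes fiber_basis: "free_basis (G\<lparr>carrier := {x \<in> carrier G. p x = 0}\<rparr>) S"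
begin

abbreviation "fiber \<equiv> {x \<in> carrier G. p x = 0}"
abbreviation "F \<equiv> G\<lparr>carrier := fiber\<rparr>"

lemma group_F: "group F"
  by (rule subgroup_imp_group[OF kernel_subgroup])

lemma inv_F: "x \<in> fiber \<Longrightarrow> inv\<^bsub>F\<^esub> x = inv x"
  by (rule m_inv_consistent[OF kernel_subgroup])

lemma F_basis: "free_basis_group F S"
  by (intro free_basis_group.intro free_basis_group_axioms.intro group_F fiber_basis)

lemma subgroup_F: "subgroup K G \<Longrightarrow> K \<subseteq> fiber \<Longrightarrow> subgroup K F"
  by (rule subgroup_incl[OF _ kernel_subgroup])

lemma free_by_cyclic_subgroup_structure:
  assumes H: "subgroup H G" "free_by_cyclic (G\<lparr>carrier := H\<rparr>)"
  shows "(\<exists>y\<in>H. p y \<noteq> 0) \<and>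
    (\<exists>A. finite A \<and> A \<subseteq> {x \<in> H. p x = 0} \<and> generate G A = {x \<in> H. p x = 0})"
proof -
  interpret H: subgroup H G by fact
  interpret FB: free_basis_group F S by (rule F_basis)
  let ?H = "G\<lparr>carrier := H\<rparr>"
  let ?K = "{x \<in> H. p x = 0}"
  have gH: "group ?H" by (rule subgroup_imp_group[OF H(1)])
  obtain N where N: "N \<lhd> ?H" "N \<noteq> {\<one>}" "finitely_generated (G\<lparr>carrier := N\<rparr>)"
    "cyclic_group (?H Mod N)" "infinite (carrier (?H Mod N))"
    using H(2) by (auto simp: free_by_cyclic_def)
  have N_H: "subgroup N ?H" using N(1) by (simp add: normal_def)
  have N_G: "subgroup N G" by (rule incl_subgroup[OF H(1) N_H])
  have NH: "N \<subseteq> H" using subgroup.subset[OF N_H] by simp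
  obtain A where A: "finite A" "A \<subseteq> N" "generate G A = N"
    using N(3) generate_consistent[OF _ N_G] by (auto simp: finitely_generated_def generates_def)
  have A_H: "generate ?H A = N"
    using generate_consistent[of A H] A NH H(1) by auto
  obtain q r0 where q: "height ?H (carrier ?H) q" "N = {x \<in> carrier ?H. q x = 0}" "r0 \<in> carrier ?H" "q r0 = 1"
    using infinite_cyclic_quotient_height[OF N(1,4,5)] by blast
  have r0: "r0 \<in> H" using q(3) by simp
  have pH: "height ?H (carrier ?H) p"
    by (rule heightI[OF gH group.subgroup_self[OF gH]]) (simp add: height_mult)
  interpret two: two_heights ?H p q
    by (intro two_heights.intro pH q(1))
  have inv_H: "inv\<^bsub>?H\<^esub> x = inv x" if "x \<in> H" for x by (rule m_inv_consistent[OF H(1) that])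
  have Nq: "N = {x \<in> H. q x = 0}" using q(2) by simp
  have ex: "\<exists>y\<in>H. p y \<noteq> 0"
  proof (rule ccontr)
    assume "\<not> ?thesis"
    then have HF: "H \<subseteq> fiber" using H.subset by blast
    then have sH: "subgroup H F" by (rule subgroup_F[OF H(1)])
    have "height F H q"
      by (rule heightI[OF group_F sH]) (use two.q.height_mult in simp)
    moreover have "generate F A = {x \<in> H. q x = 0}"
      using generate_consistent[OF _ kernel_subgroup, of A] A NH HF Nq by auto
    \<comment> \<open>If \<open>H\<close> lies in the fibre, then \<open>N\<close> is the finitely
      generated kernel of \<open>q\<close> on a subgroup of a free group, hence trivial, contrary to
      the definition of free-by-cyclic.\<close>
    ultimately have "{x \<in> H. q x = 0} = {\<one>\<^bsub>F\<^esub>}"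
      using A Nq r0 q(4) by (intro FB.fg_kernel_trivial[of H q r0 A]) auto
    then show False using N(2) Nq by simp
  qed
  have "\<exists>A. finite A \<and> A \<subseteq> ?K \<and> generate G A = ?K"
  proof (cases "\<forall>x\<in>N. p x = 0")
    case True
    \<comment> \<open>Here \<open>p\<close> vanishes on the kernel of \<open>q\<close>, so it
      factors through \<open>q\<close>. As \<open>p\<close> is not zero on \<open>H\<close>, the two
      characters have the same kernel.\<close>
    have pq: "p x = q x * p r0" if x: "x \<in> H" for x
    proof -
      let ?z = "x \<otimes>\<^bsub>?H\<^esub> r0 [^]\<^bsub>?H\<^esub> (- q x)"
      have rc: "r0 [^]\<^bsub>?H\<^esub> (- q x) \<in> carrier ?H" using two.p.int_pow_closed[OF q(3)] .
      have xc: "x \<in> carrier ?H" using x by simp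
      have "q ?z = 0" using two.q.height_mult[OF xc rc] two.q.height_pow[OF q(3), of "- q x"] q(4) by simp
      moreover have "?z \<in> carrier ?H" using two.p.m_closed[OF xc rc] .
      ultimately have "p ?z = 0" using True q(2) by blast
      then show ?thesis using two.p.height_mult[OF xc rc] two.p.height_pow[OF q(3), of "- q x"] by simp
    qed
    then have "p r0 \<noteq> 0" using ex by auto
    then have "?K = N" using True Nq pq by auto
    then show ?thesis using A by auto
  next
    case False
    then obtain x0 where x0: "x0 \<in> N" "p x0 \<noteq> 0" by blast
    interpret pN: height ?H N p
      by (rule heightI[OF gH N_H]) (use NH height_mult in \<open>simp add: subset_iff\<close>)
    obtain s where s: "s \<in> N" "p s > 0" "\<And>z. z \<in> N \<Longrightarrow> p s dvd p z"
      using pN.least_height[OF x0] by blast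
    have sH: "s \<in> carrier ?H" "q s = 0" using s(1) q(2) by blast+
    have K_sub: "subgroup ?K ?H" using two.p.kernel_subgroup by simp
    interpret qK: height ?H ?K q
      by (rule heightI[OF gH K_sub]) (use two.q.height_mult in simp)
    \<comment> \<open>The exponents cancel the heights of \<open>s\<close> and \<open>r0\<close>, so
      \<open>?z\<close> lies in \<open>?K\<close>. Since \<open>q\<close> vanishes at
      \<open>s\<close> and is 1 at \<open>r0\<close>, \<open>q ?z\<close> equals \<open>p s\<close>,
      so \<open>q\<close> is not zero on \<open>?K\<close>.\<close>
    let ?z = "s [^]\<^bsub>?H\<^esub> (- p r0) \<otimes>\<^bsub>?H\<^esub> r0 [^]\<^bsub>?H\<^esub> p s"
    have zc: "s [^]\<^bsub>?H\<^esub> (- p r0) \<in> carrier ?H" "r0 [^]\<^bsub>?H\<^esub> p s \<in> carrier ?H"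
      using two.p.int_pow_closed[OF sH(1)] two.p.int_pow_closed[OF q(3)] by blast+
    have "p ?z = 0"
      using two.p.height_mult[OF zc] two.p.height_pow[OF sH(1), of "- p r0"] two.p.height_pow[OF q(3), of "p s"]
      by simp
    moreover have "q ?z \<noteq> 0"
      using two.q.height_mult[OF zc] two.q.height_pow[OF sH(1), of "- p r0"] two.q.height_pow[OF q(3), of "p s"]
        sH(2) q(4) s(2) by simp
    moreover have "?z \<in> carrier ?H" using two.p.m_closed[OF zc] .
    ultimately have z: "?z \<in> ?K" "q ?z \<noteq> 0" by simp_all
    obtain r where r: "r \<in> ?K" "q r > 0" "\<And>z. z \<in> ?K \<Longrightarrow> q r dvd q z"
      using qK.least_height[OF z] by blast
    have K_F: "?K \<subseteq> fiber" using H.subset by blast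
    have K_G: "subgroup ?K G" by (rule incl_subgroup[OF H(1) K_sub])
    have sK: "subgroup ?K F" by (rule subgroup_F[OF K_G K_F])
    \<comment> \<open>Dividing by the least positive value of \<open>q\<close> on \<open>?K\<close>
      gives \<open>r\<close> height one, as \<open>conj_minus_id_surj\<close> requires, without
      changing the kernel.\<close>
    define e where "e x = q x div q r" for x
    have eK: "height F ?K e"
    proof (rule heightI[OF group_F sK])
      fix x y assume xy: "x \<in> ?K" "y \<in> ?K"
      have "q (x \<otimes> y) = q x + q y" using two.q.height_mult[of x y] xy by simp
      then show "e (x \<otimes>\<^bsub>F\<^esub> y) = e x + e y"
        unfolding e_def using r(3)[OF xy(1)] by (simp add: div_plus_div_distrib_dvd_left)
    qed
    have er: "e r = 1" using r(2) by (simp add: e_def)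
    have L: "{x \<in> ?K. e x = 0} = {x \<in> H. p x = 0 \<and> q x = 0}"
    proof -
      have "e x = 0 \<longleftrightarrow> q x = 0" if "x \<in> ?K" for x
        using r(3)[OF that] r(2) unfolding e_def by (metis div_0 dvd_div_eq_0_iff)
      then show ?thesis by blast
    qed
    have rF: "r \<in> fiber" using r(1) K_F by blast
    have rH: "r \<in> H" using r(1) by blast
    have "finite (xor_homs ?H {x \<in> carrier ?H. p x = 0})"
    proof (rule two.finite_xor_homs_Kp[of A s r])
      show "finite A" by fact
      show "A \<subseteq> {x \<in> carrier ?H. q x = 0}" "generate ?H A = {x \<in> carrier ?H. q x = 0}"
        using A(2) A_H q(2) by simp_all
      show "s \<in> {x \<in> carrier ?H. q x = 0}" using s(1) q(2) by simp
      show "p s dvd p x" if "x \<in> {x \<in> carrier ?H. q x = 0}" for x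
        using s(3) that q(2) by blast
      show "r \<in> {x \<in> carrier ?H. p x = 0}" using r(1) by simp
      show "q r dvd q x" if "x \<in> {x \<in> carrier ?H. p x = 0}" for x
        using r(3) that by simp
      show "p s > 0" "q r > 0" by fact+
      fix \<chi> assume "\<chi> \<in> xor_homs ?H {x \<in> carrier ?H. p x = 0 \<and> q x = 0}"
      then have "\<chi> \<in> xor_homs F {x \<in> ?K. e x = 0}" unfolding L by simp
      then obtain \<theta> where \<theta>: "\<theta> \<in> xor_homs F {x \<in> ?K. e x = 0}"
        "\<And>x. x \<in> ?K \<Longrightarrow> e x = 0 \<Longrightarrow> \<theta> (r \<otimes>\<^bsub>F\<^esub> x \<otimes>\<^bsub>F\<^esub> inv\<^bsub>F\<^esub> r) = (\<theta> x \<noteq> \<chi> x)"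
        using FB.conj_minus_id_surj[OF eK r(1) er] by blast
      show "\<exists>\<theta>\<in>xor_homs ?H {x \<in> carrier ?H. p x = 0 \<and> q x = 0}.
          \<forall>x\<in>{x \<in> carrier ?H. p x = 0 \<and> q x = 0}. \<theta> (r \<otimes>\<^bsub>?H\<^esub> x \<otimes>\<^bsub>?H\<^esub> inv\<^bsub>?H\<^esub> r) = (\<theta> x \<noteq> \<chi> x)"
      proof (intro bexI[of _ \<theta>] ballI)
        show "\<theta> \<in> xor_homs ?H {x \<in> carrier ?H. p x = 0 \<and> q x = 0}"
          using \<theta>(1) unfolding L by simp
        fix x assume "x \<in> {x \<in> carrier ?H. p x = 0 \<and> q x = 0}"
        then have "x \<in> {x \<in> ?K. e x = 0}" unfolding L by simp
        then have "x \<in> ?K" "e x = 0" by simp_all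
        then show "\<theta> (r \<otimes>\<^bsub>?H\<^esub> x \<otimes>\<^bsub>?H\<^esub> inv\<^bsub>?H\<^esub> r) = (\<theta> x \<noteq> \<chi> x)"
          using \<theta>(2)[of x] inv_F[OF rF] inv_H[OF rH] by simp
      qed
    qed
    then have "finite (xor_homs F ?K)" by simp
    then obtain B where "finite B" "B \<subseteq> ?K" "generate F B = ?K"
      using FB.finitely_generated_if_finite_xor_homs[OF sK] by blast
    moreover have "generate F B = generate G B"
      using generate_consistent[OF _ kernel_subgroup, of B] \<open>B \<subseteq> ?K\<close> K_F by auto
    ultimately show ?thesis by auto
  qed
  with ex show ?thesis by blast
qed

end

section \<open>The coarse retraction onto a free-by-cyclic subgroup\<close>

context free_fiber
begin

theorem free_by_cyclic_subgroup_undistorted: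
  assumes S: "finite S" and t: "t \<in> carrier G" "p t = 1"
    and H: "subgroup H G" "free_by_cyclic (G\<lparr>carrier := H\<rparr>)"
  shows "undistorted H G"
proof -
  interpret H: subgroup H G by fact
  interpret FB: free_basis_group F S by (rule F_basis)
  let ?K = "{x \<in> H. p x = 0}"
  obtain y0 A where y0: "y0 \<in> H" "p y0 \<noteq> 0" and A: "finite A" "A \<subseteq> ?K" "generate G A = ?K"
    using free_by_cyclic_subgroup_structure[OF H] by blast
  interpret pH: height G H p
    by (rule heightI[OF is_group H(1)]) (simp add: height_mult)
  obtain y where y: "y \<in> H" "p y > 0" "\<And>z. z \<in> H \<Longrightarrow> p y dvd p z"
    using pH.least_height[OF y0] by blast
  define d where "d = p y"
  have d: "d > 0" using y by (simp add: d_def)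
  have yc [simp]: "y \<in> carrier G" using y by simp
  note tc [simp] = t(1)
  have K_F: "?K \<subseteq> fiber" using H.subset by blast
  have K_G: "subgroup ?K G" by (rule pH.kernel_subgroup)
  have sK: "subgroup ?K F" by (rule subgroup_F[OF K_G K_F])
  have genK: "generate F A = ?K"
    using generate_consistent[OF _ kernel_subgroup, of A] A K_F by auto
  define \<psi> where "\<psi> x = y \<otimes> x \<otimes> inv y" for x
  define \<phi> where "\<phi> x = inv y \<otimes> x \<otimes> y" for x
  have \<psi>\<phi>: "\<psi> (\<phi> x) = x" "\<phi> (\<psi> x) = x" if "x \<in> carrier G" for x
    using that by (simp_all add: \<psi>_def \<phi>_def m_assoc inv_mult_cancel)
  have \<psi>_fiber: "\<psi> x \<in> fiber" and \<phi>_fiber: "\<phi> x \<in> fiber" if "x \<in> fiber" for x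
    using that by (simp_all add: \<psi>_def \<phi>_def height_mult height_inv)
  have \<psi>_hom: "\<psi> \<in> hom F F"
  proof (rule homI)
    show "\<psi> x \<in> carrier F" if "x \<in> carrier F" for x using \<psi>_fiber that by simp
    show "\<psi> (x \<otimes>\<^bsub>F\<^esub> z) = \<psi> x \<otimes>\<^bsub>F\<^esub> \<psi> z" if "x \<in> carrier F" "z \<in> carrier F" for x z
      using that by (simp add: \<psi>_def m_assoc inv_mult_cancel)
  qed
  have \<phi>_hom: "\<phi> \<in> hom F F"
  proof (rule homI)
    show "\<phi> x \<in> carrier F" if "x \<in> carrier F" for x using \<phi>_fiber that by simp
    show "\<phi> (x \<otimes>\<^bsub>F\<^esub> z) = \<phi> x \<otimes>\<^bsub>F\<^esub> \<phi> z" if "x \<in> carrier F" "z \<in> carrier F" for x z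
      using that by (simp add: \<phi>_def m_assoc inv_mult_cancel)
  qed
  have \<psi>K: "\<psi> ` ?K = ?K"
  proof
    show "\<psi> ` ?K \<subseteq> ?K"
      using y(1) by (auto simp: \<psi>_def height_mult height_inv)
    show "?K \<subseteq> \<psi> ` ?K"
    proof
      fix x assume x: "x \<in> ?K"
      then have "\<phi> x \<in> ?K" using y(1) by (simp add: \<phi>_def height_mult height_inv)
      moreover have "x = \<psi> (\<phi> x)" using x \<psi>\<phi>(1) by simp
      ultimately show "x \<in> \<psi> ` ?K" by blast
    qed
  qed
  obtain \<pi> where \<pi>: "\<And>f. f \<in> carrier F \<Longrightarrow> \<pi> f \<in> ?K"
    and \<pi>_mult: "\<And>c. c \<in> carrier F \<Longrightarrow>
      finite {inv\<^bsub>F\<^esub> (\<pi> f) \<otimes>\<^bsub>F\<^esub> \<pi> (f \<otimes>\<^bsub>F\<^esub> c) |f. f \<in> carrier F}"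
    and \<pi>_K: "finite {inv\<^bsub>F\<^esub> k \<otimes>\<^bsub>F\<^esub> \<pi> k |k. k \<in> ?K}"
    and \<pi>_hom: "\<And>\<psi> \<phi>. \<psi> \<in> hom F F \<Longrightarrow> \<phi> \<in> hom F F \<Longrightarrow>
      (\<And>x. x \<in> carrier F \<Longrightarrow> \<phi> (\<psi> x) = x) \<Longrightarrow> \<psi> ` ?K = ?K \<Longrightarrow>
      finite {inv\<^bsub>F\<^esub> (\<psi> (\<pi> f)) \<otimes>\<^bsub>F\<^esub> \<pi> (\<psi> f) |f. f \<in> carrier F}"
    by (rule FB.coarse_projection[OF S sK A(1,2) genK]) blast
  have \<pi>H: "\<pi> f \<in> H" "\<pi> f \<in> carrier G" "\<pi> f \<in> fiber" if "f \<in> fiber" for f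
    using \<pi>[of f] that by simp_all
  define E where "E c = (\<lambda>f. inv (\<pi> f) \<otimes> \<pi> (f \<otimes> c)) ` fiber" for c
  have E: "finite (E c)" if "c \<in> fiber" for c
  proof -
    have "E c = {inv\<^bsub>F\<^esub> (\<pi> f) \<otimes>\<^bsub>F\<^esub> \<pi> (f \<otimes>\<^bsub>F\<^esub> c) |f. f \<in> carrier F}"
      unfolding E_def Setcompr_eq_image
    proof (rule image_cong)
      fix f assume "f \<in> carrier F"
      then have "\<pi> f \<in> fiber" by (intro \<pi>H(3)) simp
      then show "inv (\<pi> f) \<otimes> \<pi> (f \<otimes> c) = inv\<^bsub>F\<^esub> (\<pi> f) \<otimes>\<^bsub>F\<^esub> \<pi> (f \<otimes>\<^bsub>F\<^esub> c)"
        by (simp add: inv_F)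
    qed simp
    then show ?thesis using \<pi>_mult[of c] that by simp
  qed
  define EK where "EK = (\<lambda>k. inv k \<otimes> \<pi> k) ` ?K"
  have EK: "finite EK"
  proof -
    have "EK = {inv\<^bsub>F\<^esub> k \<otimes>\<^bsub>F\<^esub> \<pi> k |k. k \<in> ?K}"
      unfolding EK_def Setcompr_eq_image by (rule image_cong) (simp_all add: inv_F)
    then show ?thesis using \<pi>_K by simp
  qed
  define E\<psi> where "E\<psi> = (\<lambda>f. inv (\<psi> (\<pi> f)) \<otimes> \<pi> (\<psi> f)) ` fiber"
  have E\<psi>: "finite E\<psi>"
  proof -
    have "E\<psi> = {inv\<^bsub>F\<^esub> (\<psi> (\<pi> f)) \<otimes>\<^bsub>F\<^esub> \<pi> (\<psi> f) |f. f \<in> carrier F}"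
      unfolding E\<psi>_def Setcompr_eq_image
    proof (rule image_cong)
      fix f assume "f \<in> carrier F"
      then have "\<psi> (\<pi> f) \<in> fiber" by (intro \<psi>_fiber \<pi>H) simp
      then show "inv (\<psi> (\<pi> f)) \<otimes> \<pi> (\<psi> f) = inv\<^bsub>F\<^esub> (\<psi> (\<pi> f)) \<otimes>\<^bsub>F\<^esub> \<pi> (\<psi> f)"
        by (simp add: inv_F)
    qed simp
    moreover have "\<phi> (\<psi> x) = x" if "x \<in> carrier F" for x using \<psi>\<phi>(2) that by simp
    ultimately show ?thesis using \<pi>_hom[OF \<psi>_hom \<phi>_hom _ \<psi>K] by simp
  qed
  \<comment> \<open>Powers of \<open>y\<close> reach only heights divisible by \<open>d\<close>, so
    a remainder between 0 and \<open>d - 1\<close> is left to \<open>t\<close>. \<open>c g\<close>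
    is the fibre part of \<open>g\<close> between the power of \<open>y\<close> and the power of
    \<open>t\<close>.\<close>
  define c where "c g = y [^] (- (p g div d)) \<otimes> g \<otimes> t [^] (- (p g mod d))" for g
  define \<rho> where "\<rho> g = y [^] (p g div d) \<otimes> \<pi> (c g)" for g
  have c_fiber: "c g \<in> fiber" if "g \<in> carrier G" for g
  proof -
    have "p (c g) = - (p g div d) * d + p g - (p g mod d)"
      unfolding c_def using that t(2) by (simp only: height_mult height_pow m_closed yc tc int_pow_closed d_def)
    also have "\<dots> = 0" by (simp add: minus_div_mult_eq_mod)
    finally show ?thesis using that by (simp add: c_def)
  qed
  have S_fiber: "s \<in> fiber" if "s \<in> S" for s using FB.basis_closed[OF that] by simp
  have cancel: "y [^] (- i) \<otimes> (y [^] i \<otimes> z) = z" "t [^] (- i) \<otimes> (t [^] i \<otimes> z) = z"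
    if "z \<in> carrier G" for i :: int and z
    using that by (simp_all add: m_assoc[symmetric] flip: int_pow_mult)
  show ?thesis
  proof (rule undistorted_if_coarse_retract[of G "insert t S" H "insert y A" \<rho>])
    show "group G" "subgroup H G" "finite (insert t S)" "finite (insert y A)"
      using is_group H S A by simp_all
    show "generates G (insert t S)"
    proof -
      have sub: "insert t S \<subseteq> carrier G" using S_fiber by auto
      have "x \<in> generate G (insert t S)" if x: "x \<in> carrier G" for x
      proof -
        let ?T = "generate G (insert t S)"
        have "x \<otimes> t [^] (- p x) \<in> fiber"
          using x t height_mult[of x "t [^] (- p x)"] height_pow[of t "- p x"] int_pow_closed[of t "- p x"] by simp
        also have "fiber = generate F S" using FB.generate_basis by simp
        also have "\<dots> = generate G S"
          using generate_consistent[OF _ kernel_subgroup, of S] S_fiber by auto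
        also have "\<dots> \<subseteq> ?T" by (rule mono_generate) blast
        finally have "x \<otimes> t [^] (- p x) \<in> ?T" .
        moreover have "t [^] p x \<in> ?T"
          by (intro subgroup_int_pow_closed generate_is_subgroup sub generate.incl) simp
        ultimately have "x \<otimes> t [^] (- p x) \<otimes> t [^] p x \<in> ?T" by (rule generate.eng)
        then show ?thesis using x by (simp add: m_assoc flip: int_pow_mult)
      qed
      moreover have "generate G (insert t S) \<subseteq> carrier G" by (rule generate_incl[OF sub])
      ultimately show ?thesis using sub unfolding generates_def by blast
    qed
    show "generates (G\<lparr>carrier := H\<rparr>) (insert y A)"
    proof -
      let ?T = "generate G (insert y A)"
      have sub: "insert y A \<subseteq> H" using A(2) y(1) by auto
      then have subG: "insert y A \<subseteq> carrier G" using H.subset by blast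
      have "x \<in> ?T" if x: "x \<in> H" for x
      proof -
        let ?i = "p x div d"
        have pd: "?i * d = p x" using y(3)[OF x] by (simp add: d_def)
        have yi: "y [^] (- ?i) \<in> H" by (rule pH.int_pow_closed[OF y(1)])
        have "p (x \<otimes> y [^] (- ?i)) = 0"
          using pH.height_mult[OF x yi] pH.height_pow[OF y(1), of "- ?i"] pd by (simp add: d_def)
        moreover have "x \<otimes> y [^] (- ?i) \<in> H" using x yi by (rule H.m_closed)
        ultimately have "x \<otimes> y [^] (- ?i) \<in> ?K" by simp
        also have "?K = generate G A" using A(3) by simp
        also have "\<dots> \<subseteq> ?T" by (rule mono_generate) blast
        finally have "x \<otimes> y [^] (- ?i) \<in> ?T" .
        moreover have "y [^] ?i \<in> ?T"
          by (intro subgroup_int_pow_closed generate_is_subgroup subG generate.incl) simp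
        ultimately have "x \<otimes> y [^] (- ?i) \<otimes> y [^] ?i \<in> ?T" by (rule generate.eng)
        then show ?thesis using x by (simp add: m_assoc flip: int_pow_mult)
      qed
      moreover have "?T \<subseteq> H" by (rule generate_subgroup_incl[OF sub H(1)])
      moreover have "generate (G\<lparr>carrier := H\<rparr>) (insert y A) = ?T"
        using generate_consistent[OF sub H(1)] .
      ultimately show ?thesis using sub unfolding generates_def by auto
    qed
    show "\<rho> g \<in> H" if "g \<in> carrier G" for g
      unfolding \<rho>_def by (intro H.m_closed pH.int_pow_closed y(1) \<pi>H(1) c_fiber that)
    show "finite {inv h \<otimes> \<rho> h |h. h \<in> H}"
    proof (rule finite_subset[OF _ EK])
      show "{inv h \<otimes> \<rho> h |h. h \<in> H} \<subseteq> EK"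
      proof clarify
        fix h assume h: "h \<in> H"
        then have hc: "h \<in> carrier G" by simp
        \<comment> \<open>For an element of \<open>H\<close> the remainder is 0 and its fibre part
          lies in \<open>?K\<close>, where \<open>\<pi>\<close> moves points by finitely many
          displacements only.\<close>
        have "p h mod d = 0" using y(3)[OF h] by (simp add: d_def)
        then have ch: "c h = y [^] (- (p h div d)) \<otimes> h" using hc by (simp add: c_def)
        have "c h \<in> H" unfolding ch by (intro H.m_closed pH.int_pow_closed y(1) h)
        then have cK: "c h \<in> ?K" using c_fiber[OF hc] by simp
        have "inv (c h) = inv h \<otimes> y [^] (p h div d)"
          unfolding ch using hc by (simp add: inv_mult_group int_pow_neg)
        then have "inv h \<otimes> \<rho> h = inv (c h) \<otimes> \<pi> (c h)"
          unfolding \<rho>_def using hc \<pi>H(2)[OF c_fiber[OF hc]] by (simp add: m_assoc)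
        then show "inv h \<otimes> \<rho> h \<in> EK" unfolding EK_def using cK by blast
      qed
    qed
    fix s assume s: "s \<in> insert t S"
    have inv_\<rho>: "inv (\<rho> g) = inv (\<pi> (c g)) \<otimes> y [^] (- (p g div d))" if "g \<in> carrier G" for g
      unfolding \<rho>_def using \<pi>H(2)[OF c_fiber[OF that]] by (simp add: inv_mult_group int_pow_neg)
    show "finite {inv (\<rho> g) \<otimes> \<rho> (g \<otimes> s) |g. g \<in> carrier G}"
    proof (cases "s = t")
      case False
      then have sF: "s \<in> fiber" using s S_fiber by blast
      then have sc: "s \<in> carrier G" "p s = 0" by simp_all
      \<comment> \<open>Moving \<open>s\<close> past \<open>t [^] i\<close> multiplies the fibre
        part by \<open>e i\<close>. The remainder \<open>i\<close> takes only \<open>d\<close>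
        values, so finitely many sets \<open>E (e i)\<close> suffice.\<close>
      define e where "e i = t [^] i \<otimes> s \<otimes> t [^] (- i)" for i :: int
      have eF: "e i \<in> fiber" for i
      proof -
        have "p (e i) = 0"
          unfolding e_def using sc t(2) by (simp add: height_mult height_pow int_pow_closed)
        then show ?thesis using sc by (simp add: e_def)
      qed
      have "{inv (\<rho> g) \<otimes> \<rho> (g \<otimes> s) |g. g \<in> carrier G} \<subseteq> (\<Union>i\<in>{0..<d}. E (e i))"
      proof clarify
        fix g assume g: "g \<in> carrier G"
        let ?i = "p g mod d"
        have pgs: "p (g \<otimes> s) = p g" using g sc by (simp add: height_mult)
        have cgs: "c (g \<otimes> s) = c g \<otimes> e ?i"
          unfolding c_def e_def pgs using g sc cancel(2) by (simp add: m_assoc)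
        have \<pi>c: "\<pi> (c g) \<in> carrier G" "\<pi> (c g \<otimes> e ?i) \<in> carrier G"
          using \<pi>H(2)[OF c_fiber[OF g]] \<pi>H(2)[OF c_fiber[of "g \<otimes> s"]] g sc cgs by simp_all
        have "inv (\<rho> g) \<otimes> \<rho> (g \<otimes> s) = inv (\<pi> (c g)) \<otimes> \<pi> (c g \<otimes> e ?i)"
          unfolding inv_\<rho>[OF g] \<rho>_def[of "g \<otimes> s"] pgs cgs using \<pi>c cancel(1) by (simp add: m_assoc)
        then have "inv (\<rho> g) \<otimes> \<rho> (g \<otimes> s) \<in> E (e ?i)"
          unfolding E_def using c_fiber[OF g] by blast
        moreover have "?i \<in> {0..<d}" using d by simp
        ultimately show "inv (\<rho> g) \<otimes> \<rho> (g \<otimes> s) \<in> (\<Union>i\<in>{0..<d}. E (e i))" by blast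
      qed
      moreover have "finite (\<Union>i\<in>{0..<d}. E (e i))" using E eF by blast
      ultimately show ?thesis by (rule finite_subset)
    next
      case True
      \<comment> \<open>When the exponent of \<open>t\<close> wraps from \<open>d - 1\<close> to 0,
        one \<open>y\<close> is split off and the fibre part \<open>f\<close> becomes
        \<open>inv y \<otimes> f \<otimes> t [^] d\<close>, which is
        \<open>\<phi> f \<otimes> z\<close>.\<close>
      define z where "z = inv y \<otimes> t [^] d"
      have zF: "z \<in> fiber"
      proof -
        have "p z = - d + d * 1"
          unfolding z_def using height_mult[of "inv y" "t [^] d"] height_inv[OF yc] height_pow[OF tc, of d] t(2)
          by (simp add: d_def)
        then show ?thesis by (simp add: z_def)
      qed
      \<comment> \<open>\<one> covers the steps without wrapping, where the fibre part and the power
        of \<open>y\<close> stay the same; the products cover the wrapping steps.\<close>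
      let ?X = "insert \<one> ((\<lambda>(a, b). inv a \<otimes> y \<otimes> b) ` (E\<psi> \<times> E z))"
      have "{inv (\<rho> g) \<otimes> \<rho> (g \<otimes> s) |g. g \<in> carrier G} \<subseteq> ?X"
      proof clarify
        fix g assume g: "g \<in> carrier G" and nX: "inv (\<rho> g) \<otimes> \<rho> (g \<otimes> s) \<notin> (\<lambda>(a, b). inv a \<otimes> y \<otimes> b) ` (E\<psi> \<times> E z)"
        let ?k = "p g div d" and ?i = "p g mod d" and ?f = "c g"
        have pg: "p (g \<otimes> s) = d * ?k + (?i + 1)" using g True t by (simp add: height_mult)
        have i: "0 \<le> ?i" "?i < d" using d by simp_all
        have f: "?f \<in> fiber" "?f \<in> carrier G" using c_fiber[OF g] by simp_all
        show "inv (\<rho> g) \<otimes> \<rho> (g \<otimes> s) = \<one>"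
        proof (cases "?i + 1 < d")
          case lt: True
          have dm: "p (g \<otimes> s) div d = ?k" "p (g \<otimes> s) mod d = ?i + 1"
            using int_div_pos_eq[OF pg] int_mod_pos_eq[OF pg] i lt by simp_all
          have tt: "t \<otimes> t [^] (- (?i + 1)) = t [^] (- ?i)"
          proof -
            have "t [^] (1::int) \<otimes> t [^] (- (?i + 1)) = t [^] (1 + - (?i + 1))"
              by (rule int_pow_mult[symmetric]) simp
            then show ?thesis by (simp add: int_pow_1)
          qed
          have "c (g \<otimes> s) = y [^] (- ?k) \<otimes> (g \<otimes> s) \<otimes> t [^] (- (?i + 1))"
            by (simp only: c_def[of "g \<otimes> s"] dm)
          also have "\<dots> = ?f"
            unfolding c_def True using g by (simp only: m_assoc m_closed yc tc int_pow_closed tt)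
          finally have "c (g \<otimes> s) = ?f" .
          then show ?thesis
            unfolding \<rho>_def dm using \<pi>H(2)[OF f(1)] by (simp add: l_inv)
        next
          case False
          then have id: "?i + 1 = d" using i by simp
          have pg': "p (g \<otimes> s) = d * (?k + 1) + 0" using pg[unfolded id] by (simp only: distrib_left mult_1_right add_0_right)
          have dm: "p (g \<otimes> s) div d = ?k + 1" "p (g \<otimes> s) mod d = 0"
            using int_div_pos_eq[OF pg'] int_mod_pos_eq[OF pg'] d by simp_all
          have yk: "y [^] (- (?k + 1)) = inv y \<otimes> y [^] (- ?k)"
          proof -
            have "- (?k + 1) = - 1 + - ?k" by simp
            then have "y [^] (- (?k + 1)) = y [^] (- 1 + - ?k)" by (rule arg_cong)
            also have "\<dots> = y [^] (- 1 :: int) \<otimes> y [^] (- ?k)" by (rule int_pow_mult) simp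
            finally show ?thesis by (simp add: int_pow_neg int_pow_1)
          qed
          have td: "t [^] (- ?i) \<otimes> t [^] d = t"
          proof -
            have "t [^] (- ?i) \<otimes> t [^] d = t [^] (- ?i + d)" by (rule int_pow_mult[symmetric]) simp
            also have "- ?i + d = 1" using id by simp
            finally show ?thesis by (simp add: int_pow_1)
          qed
          have "c (g \<otimes> s) = y [^] (- (?k + 1)) \<otimes> (g \<otimes> s) \<otimes> t [^] (- 0 :: int)"
            by (simp only: c_def[of "g \<otimes> s"] dm)
          also have "\<dots> = inv y \<otimes> (y [^] (- ?k) \<otimes> g \<otimes> t)"
            unfolding yk True using g by (simp add: m_assoc)
          also have "y [^] (- ?k) \<otimes> g \<otimes> t = ?f \<otimes> t [^] d"
          proof -
            have "?f \<otimes> t [^] d = y [^] (- ?k) \<otimes> g \<otimes> (t [^] (- ?i) \<otimes> t [^] d)"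
              unfolding c_def using g by (simp only: m_assoc m_closed yc tc int_pow_closed)
            then show ?thesis unfolding td by simp
          qed
          also have "inv y \<otimes> (?f \<otimes> t [^] d) = \<phi> ?f \<otimes> z"
            using f by (simp add: \<phi>_def z_def m_assoc inv_mult_cancel)
          finally have cgs: "c (g \<otimes> s) = \<phi> ?f \<otimes> z" .
          have \<phi>f: "\<phi> ?f \<in> fiber" by (rule \<phi>_fiber[OF f(1)])
          let ?u = "\<pi> (\<phi> ?f)" and ?v = "\<pi> (\<phi> ?f \<otimes> z)"
          have gs: "g \<otimes> s \<in> carrier G" using g True by simp
          have cl: "?u \<in> carrier G" "?v \<in> carrier G" "\<pi> ?f \<in> carrier G"
            using \<pi>H(2)[OF \<phi>f] \<pi>H(2)[OF c_fiber[OF gs]] \<pi>H(2)[OF f(1)] cgs by simp_all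
          \<comment> \<open>The displacement is
            \<open>inv (\<pi> ?f) \<otimes> y \<otimes> ?v\<close>. Inserting
            \<open>\<psi> ?u\<close>, which is \<open>y \<otimes> ?u \<otimes> inv y\<close>, splits
            it into \<open>inv a \<otimes> y \<otimes> b\<close>: \<open>a\<close> measures how far
            \<open>\<pi>\<close> and \<open>\<psi>\<close> fail to commute at
            \<open>\<phi> ?f\<close>, and \<open>b\<close> is the effect of right multiplication by
            \<open>z\<close>.\<close>
          define a where "a = inv (\<psi> ?u) \<otimes> \<pi> (\<psi> (\<phi> ?f))"
          define b where "b = inv ?u \<otimes> ?v"
          have a: "a \<in> E\<psi>" unfolding a_def E\<psi>_def using \<phi>f by blast
          have b: "b \<in> E z" unfolding b_def E_def using \<phi>f by blast
          have a': "a = inv (\<psi> ?u) \<otimes> \<pi> ?f" unfolding a_def \<psi>\<phi>(1)[OF f(2)] ..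
          have yy: "y [^] (- ?k) \<otimes> y [^] (?k + 1) = y"
          proof -
            have "y [^] (- ?k) \<otimes> y [^] (?k + 1) = y [^] (- ?k + (?k + 1))" by (rule int_pow_mult[symmetric]) simp
            then show ?thesis by (simp add: int_pow_1)
          qed
          have "inv (\<rho> g) \<otimes> \<rho> (g \<otimes> s) = inv (\<pi> ?f) \<otimes> (y [^] (- ?k) \<otimes> y [^] (?k + 1)) \<otimes> ?v"
            unfolding inv_\<rho>[OF g] \<rho>_def[of "g \<otimes> s"] dm cgs using cl
            by (simp only: m_assoc m_closed yc int_pow_closed inv_closed)
          also have "\<dots> = inv (\<pi> ?f) \<otimes> y \<otimes> ?v" unfolding yy ..
          also have "\<dots> = inv a \<otimes> y \<otimes> b"
            unfolding a' b_def \<psi>_def using cl by (simp add: inv_mult_group m_assoc inv_mult_cancel)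
          finally have "inv (\<rho> g) \<otimes> \<rho> (g \<otimes> s) = inv a \<otimes> y \<otimes> b" .
          then have "inv (\<rho> g) \<otimes> \<rho> (g \<otimes> s) \<in> (\<lambda>(a, b). inv a \<otimes> y \<otimes> b) ` (E\<psi> \<times> E z)"
            using a b by (intro image_eqI[of _ _ "(a, b)"]) simp_all
          with nX show ?thesis by blast
        qed
      qed
      moreover have "finite ?X" using E\<psi> E[OF zF] by simp
      ultimately show ?thesis by (rule finite_subset)
    qed
  qed
qed

end

theorem lemma4p1:
  fixes F :: "('a, 'b) monoid_scheme" and \<Phi> :: "'a \<Rightarrow> 'a" and H :: "('a \<times> int) set"
  assumes "free_group F" and "finitely_generated F" and "\<not> cyclic_group F"
    and "\<Phi> \<in> auto F"
    and "subgroup H (semidirect_Z F \<Phi>)"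
    and "free_by_cyclic ((semidirect_Z F \<Phi>)\<lparr>carrier := H\<rparr>)"
  shows "undistorted H (semidirect_Z F \<Phi>)"
proof -
  let ?G = "semidirect_Z F \<Phi>" and ?\<iota> = "\<lambda>x. (x, 0 :: int)"
  obtain S where F: "group F" and S: "free_basis F S"
    using assms(1) by (auto simp: free_group_def)
  interpret F: free_basis_group F S
    by (intro free_basis_group.intro free_basis_group_axioms.intro F S)
  have G: "group ?G" by (rule group_semidirect_Z[OF F assms(4)])
  have height: "height ?G (carrier ?G) snd"
    by (rule heightI[OF G group.subgroup_self[OF G]]) (auto simp: semidirect_Z_def split: prod.splits)
  let ?F = "?G\<lparr>carrier := {x \<in> carrier ?G. snd x = 0}\<rparr>"
  have gF: "group ?F"
    by (rule group.subgroup_imp_group[OF G height.kernel_subgroup[OF height]])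
  have zero: "(\<Phi> [^]\<^bsub>AutoGroup F\<^esub> (0::int)) x = x" if "x \<in> carrier F" for x
    using that by (simp add: AutoGroup_def BijGroup_def)
  \<comment> \<open>The fibre of \<open>snd\<close> consists of the pairs with second component 0,
    where the zeroth power of \<open>\<Phi>\<close> acts as the identity and the twisted product is
    that of \<open>F\<close>.\<close>
  have "?\<iota> \<in> iso F ?F"
  proof (rule isoI)
    show "?\<iota> \<in> hom F ?F"
      by (rule homI) (use zero in \<open>simp_all add: semidirect_Z_def del: int_pow_0\<close>)
    show "bij_betw ?\<iota> (carrier F) (carrier ?F)"
      by (rule bij_betw_imageI) (auto simp: inj_on_def semidirect_Z_def)
  qed
  then have "free_basis ?F (?\<iota> ` S)" by (rule free_basis_iso[OF F gF _ S])
  then interpret free_fiber ?G snd "?\<iota> ` S"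
    by (intro free_fiber.intro free_fiber_axioms.intro height)
  show ?thesis
  proof (rule free_by_cyclic_subgroup_undistorted)
    show "finite (?\<iota> ` S)" using F.finite_basis[OF assms(2)] by simp
    show "(\<one>\<^bsub>F\<^esub>, 1) \<in> carrier ?G" by (simp add: semidirect_Z_def)
    show "snd (\<one>\<^bsub>F\<^esub>, 1 :: int) = 1" by simp
  qed (use assms in auto)
qed

end
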